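(* Let $r\ge 2$ and $n\ge 0$ be integers and let $p,p'$ be a pair of positive coprime integers. Let $J_{T(p,p')}(L_r(n\Lambda_1))$ be the framing-dependent, un-normalized $\mathfrak{sl}_r$ invariant of the torus knot $T(p,p')$ (with the framing inherited from the $(p,p')$ cabling of the zero-framed unknot), coloured by $L_r(n\Lambda_1)$. Then $$J_{T(p,p')}(L_r(n\Lambda_1))=\frac{q^{-\frac{p'}{2p}\|\delta\|^2}}{\operatorname{qdim}(\Delta_r)}\sum_{\lambda\in\Pi_{r,n}}\ \sum_{w\in\mathfrak{S}_r}(-1)^{\ell(w)}\,q^{\frac{p'}{2p}\|p\lambda+w\delta\|^2+(p\lambda+w\delta,\,\delta)} .$$
   Context: Lie algebra notation. Consider $\mathfrak{sl}_r$ over $\mathbb{C}$; its weights are realized in the space spanned by orthonormal symbols $\epsilon_1,\dots,\epsilon_r$ with form $(\cdot,\cdot)$, $(\epsilon_i,\epsilon_j)=\delta_{ij}$, $\|v\|^2=(v,v)$. Simple roots: $\alpha_i=\epsilon_i-\epsilon_{i+1}$, $1\le i\le r-1$. Fundamental weights: $\Lambda_i=\frac{r-i}{r}(\epsilon_1+\cdots+\epsilon_i)-\frac{i}{r}(\epsilon_{i+1}+\cdots+\epsilon_r)$. $P_r=\bigoplus_i\mathbb{Z}\Lambda_i$ is the weight lattice and $P_r^+$ the set of dominant integral weights. $\Phi_r^+=\{\epsilon_i-\epsilon_j: i<j\}$ is the set of positive roots. The Weyl vector is $\delta=\sum_{i=1}^r\frac{r+1-2i}{2}\epsilon_i$. The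 Weyl group $\mathfrak{S}_r$ permutes the subscripts of the $\epsilon_i$, and $\ell(w)$ is Coxeter length with respect to the simple transpositions $(i,i+1)$. $L_r(\lambda)$ is the finite-dimensional irreducible $\mathfrak{sl}_r$-module of highest weight $\lambda\in P_r^+$, and $\Pi_{r,n}$ is the set of weights of $L_r(n\Lambda_1)$, i.e. $\Pi_{r,n}=\{n\Lambda_1-a_1\alpha_1-\cdots-a_{r-1}\alpha_{r-1}: n\ge a_1\ge\cdots\ge a_{r-1}\ge 0,\ a_i\in\mathbb{Z}\}$ (each weight has multiplicity one). Characters. Characters live in the group algebra of $P_r$ with basis $\mathbf{x}^\lambda$, $\lambda\in P_r$, $\mathbf{x}^\lambda\mathbf{x}^\mu=\mathbf{x}^{\lambda+\mu}$. $\Delta_r=\sum_{w\in\mathfrak{S}_r}(-1)^{\ell(w)}\mathbf{x}^{w\delta}$ is the Weyl denominator. The quantum dimension (principal specialization) is the algebra homomorphism $\operatorname{qdim}(\mathbf{x}^\lambda)=q^{(\lambda,\delta)}$; so $\operatorname{qdim}(\Delta_r)=\sum_w(-1)^{\ell(w)}q^{(w\delta,\delta)}=\prod_{\alpha\in\Phi_r^+}\bigl(q^{\frac12(\alpha,\delta)}-q^{-\frac12(\alpha,\delta)}\bigr)$, and $\operatorname{qdim}(L_r(\lambda))$ means $\operatorname{qdim}$ of the character of $L_r(\lambda)$. The $p$th Adams operation is $\psi_p(\mathbf{x}^\lambda)=\mathbf{x}^{p\lambda}$; for $\lambda\in P_r^+$ define integers $m^\mu_{\lambda,p}$ (finitely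 many nonzero) by $\psi_p(\operatorname{ch}L_r(\lambda))=\sum_{\mu\in P_r^+}m^\mu_{\lambda,p}\operatorname{ch}L_r(\mu)$. The invariant. $J_{T(p,p')}(L_r(\lambda))$ is the Reshetikhin–Turaev invariant of $T(p,p')$ coloured by $L_r(\lambda)$, with the framing of writhe $pp'$ inherited from the $(p,p')$ cabling of the zero-framed unknot, not normalized by the value on the unknot. By the Rosso–Jones formula (a known theorem, which may be taken as the definition) it equals $$J_{T(p,p')}(L_r(\lambda))=\sum_{\mu\in P_r^+}m^\mu_{\lambda,p}\cdot\operatorname{qdim}(L_r(\mu))\cdot\theta_{L_r(\mu)}^{p'/p},\qquad \theta_{L_r(\mu)}=q^{\frac12(\mu,\mu+2\delta)} .$$ Here $q$ is a formal variable and fractional powers are allowed: all expressions are (ratios of) Laurent polynomials in $q^{1/N}$ for a suitable positive integer $N$. *)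

theory Defs
  imports
    "Jordan_Normal_Form.Matrix"
    "HOL-Library.Function_Algebras"
    "HOL-Library.Poly_Mapping"
    "HOL-Combinatorics.Permutations"
    "HOL-Computational_Algebra.Polynomial_Factorial"
begin

section \<open>Weights of sl_r\<close>

text \<open>
  A weight is a rational combination of the orthonormal symbols \<open>\<epsilon>\<^sub>1, \<dots>, \<epsilon>\<^sub>r\<close>, represented
  by its coefficient function, which vanishes outside \<open>{1..r}\<close>.
\<close>

type_synonym weight = "nat \<Rightarrow> rat"

definition eps :: "nat \<Rightarrow> weight" where
  "eps i = (\<lambda>j. if j = i then 1 else 0)"

definition wscale :: "rat \<Rightarrow> weight \<Rightarrow> weight" where
  "wscale c v = (\<lambda>j. c * v j)"

definition wform :: "nat \<Rightarrow> weight \<Rightarrow> weight \<Rightarrow> rat" where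
  "wform r u v = (\<Sum>i=1..r. u i * v i)"

definition wnormsq :: "nat \<Rightarrow> weight \<Rightarrow> rat" where
  "wnormsq r v = wform r v v"

definition simple_root :: "nat \<Rightarrow> weight" where
  "simple_root i = eps i - eps (i + 1)"

definition fund_weight :: "nat \<Rightarrow> nat \<Rightarrow> weight" where
  "fund_weight r i =
     wscale ((of_nat r - of_nat i) / of_nat r) (\<Sum>j=1..i. eps j)
     - wscale (of_nat i / of_nat r) (\<Sum>j=i+1..r. eps j)"

definition weight_lattice :: "nat \<Rightarrow> weight set" where
  "weight_lattice r =
     {\<Sum>i=1..r-1. wscale (of_int (c i)) (fund_weight r i) | c :: nat \<Rightarrow> int. True}"

definition dominant_weights :: "nat \<Rightarrow> weight set" where
  "dominant_weights r =
     {\<Sum>i=1..r-1. wscale (of_nat (c i)) (fund_weight r i) | c :: nat \<Rightarrow> nat. True}"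

definition weyl_vector :: "nat \<Rightarrow> weight" where
  "weyl_vector r =
     (\<Sum>i=1..r. wscale ((of_nat r + 1 - 2 * of_nat i) / 2) (eps i))"

text \<open>The weights of the irreducible module of highest weight \<open>n \<Lambda>\<^sub>1\<close>.\<close>

definition Pi_weights :: "nat \<Rightarrow> nat \<Rightarrow> weight set" where
  "Pi_weights r n =
     {wscale (of_nat n) (fund_weight r 1)
        - (\<Sum>i=1..r-1. wscale (of_nat (a i)) (simple_root i)) | a :: nat \<Rightarrow> nat.
        a 1 \<le> n \<and> (\<forall>i. 1 \<le> i \<and> i < r - 1 \<longrightarrow> a (i + 1) \<le> a i)}"


section \<open>The Weyl group\<close>

text \<open>
  The Weyl group is the set of \<open>w\<close> with \<open>w permutes {1..r}\<close>. Permuting subscripts,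
  \<open>\<epsilon>\<^sub>i \<mapsto> \<epsilon>\<^bsub>w(i)\<^esub>\<close>, is precomposition of the coefficient function with the inverse of \<open>w\<close>.
\<close>

definition weyl_act :: "(nat \<Rightarrow> nat) \<Rightarrow> weight \<Rightarrow> weight" where
  "weyl_act w v = v \<circ> Hilbert_Choice.inv w"

definition coxeter_length :: "nat \<Rightarrow> (nat \<Rightarrow> nat) \<Rightarrow> nat" where
  "coxeter_length r w =
     (LEAST k. \<exists>is. length is = k \<and> set is \<subseteq> {1..<r}
        \<and> w = foldr (\<lambda>i u. Transposition.transpose i (i + 1) \<circ> u) is id)"


section \<open>Finite-dimensional modules of sl_r over the complex numbers\<close>

definition sl :: "nat \<Rightarrow> complex mat set" where
  "sl r = {X \<in> carrier_mat r r. (\<Sum>i<r. X $$ (i, i)) = 0}"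

text \<open>
  Every finite-dimensional complex vector space is isomorphic to a subspace of the space of
  complex sequences, so modules are taken with such a subspace as underlying space.
\<close>

type_synonym cseq = "nat \<Rightarrow> complex"

definition cscale :: "complex \<Rightarrow> cseq \<Rightarrow> cseq" where
  "cscale c v = (\<lambda>i. c * v i)"

global_interpretation cseq: vector_space cscale
  by unfold_locales (auto simp: cscale_def fun_eq_iff algebra_simps)

locale sl_module =
  fixes r :: nat and V :: "cseq set" and \<rho> :: "complex mat \<Rightarrow> cseq \<Rightarrow> cseq"
  assumes subspace: "cseq.subspace V"
    and finite_dimensional: "\<exists>B. finite B \<and> cseq.span B = V"
    and closed: "X \<in> sl r \<Longrightarrow> v \<in> V \<Longrightarrow> \<rho> X v \<in> V"
    and act_add: "X \<in> sl r \<Longrightarrow> u \<in> V \<Longrightarrow> v \<in> V \<Longrightarrow> \<rho> X (u + v) = \<rho> X u + \<rho> X v"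
    and act_scale: "X \<in> sl r \<Longrightarrow> v \<in> V \<Longrightarrow> \<rho> X (cscale c v) = cscale c (\<rho> X v)"
    and add_act: "X \<in> sl r \<Longrightarrow> Y \<in> sl r \<Longrightarrow> v \<in> V \<Longrightarrow> \<rho> (X + Y) v = \<rho> X v + \<rho> Y v"
    and scale_act: "X \<in> sl r \<Longrightarrow> v \<in> V \<Longrightarrow> \<rho> (c \<cdot>\<^sub>m X) v = cscale c (\<rho> X v)"
    and bracket: "X \<in> sl r \<Longrightarrow> Y \<in> sl r \<Longrightarrow> v \<in> V \<Longrightarrow>
      \<rho> (X * Y - Y * X) v = \<rho> X (\<rho> Y v) - \<rho> Y (\<rho> X v)"

locale irreducible_sl_module = sl_module +
  assumes nonzero: "V \<noteq> {0}"
    and irreducible: "cseq.subspace U \<Longrightarrow> U \<subseteq> V \<Longrightarrow>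
      (\<And>X v. X \<in> sl r \<Longrightarrow> v \<in> U \<Longrightarrow> \<rho> X v \<in> U) \<Longrightarrow> U = {0} \<or> U = V"

text \<open>
  The symbol \<open>\<epsilon>\<^sub>i\<close> is the functional reading off the \<open>i\<close>-th diagonal entry; matrix indices
  start at 0, subscripts of \<open>\<epsilon>\<close> at 1.
\<close>

definition weight_eval :: "nat \<Rightarrow> weight \<Rightarrow> complex mat \<Rightarrow> complex" where
  "weight_eval r \<mu> H = (\<Sum>i=1..r. of_rat (\<mu> i) * H $$ (i - 1, i - 1))"

definition weight_space ::
  "nat \<Rightarrow> cseq set \<Rightarrow> (complex mat \<Rightarrow> cseq \<Rightarrow> cseq) \<Rightarrow> weight \<Rightarrow> cseq set" where
  "weight_space r V \<rho> \<mu> =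
     {v \<in> V. \<forall>H \<in> sl r. diagonal_mat H \<longrightarrow> \<rho> H v = cscale (weight_eval r \<mu> H) v}"

text \<open>
  The positive root spaces (for \<open>\<epsilon>\<^sub>i - \<epsilon>\<^sub>j\<close>, \<open>i < j\<close>) span the strictly upper triangular matrices.
\<close>

definition is_highest_weight ::
  "nat \<Rightarrow> cseq set \<Rightarrow> (complex mat \<Rightarrow> cseq \<Rightarrow> cseq) \<Rightarrow> weight \<Rightarrow> bool" where
  "is_highest_weight r V \<rho> \<mu> \<longleftrightarrow>
     (\<exists>v \<in> weight_space r V \<rho> \<mu>. v \<noteq> 0 \<and>
        (\<forall>X \<in> carrier_mat r r. (\<forall>i<r. \<forall>j\<le>i. X $$ (i, j) = 0) \<longrightarrow> \<rho> X v = 0))"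

text \<open>A choice of representative of the isomorphism class of the irreducible module.\<close>

definition irrep :: "nat \<Rightarrow> weight \<Rightarrow> cseq set \<times> (complex mat \<Rightarrow> cseq \<Rightarrow> cseq)" where
  "irrep r \<mu> =
     (SOME (V, \<rho>). irreducible_sl_module r V \<rho> \<and> is_highest_weight r V \<rho> \<mu>)"


section \<open>Characters\<close>

text \<open>
  \<open>weight \<Rightarrow>\<^sub>0 int\<close> carries the convolution product, so it contains the group algebra of the
  weight lattice, and \<open>Poly_Mapping.single \<mu> 1\<close> is the basis element \<open>x\<^sup>\<mu>\<close>.
\<close>

definition module_character ::
  "nat \<Rightarrow> cseq set \<Rightarrow> (complex mat \<Rightarrow> cseq \<Rightarrow> cseq) \<Rightarrow> (weight \<Rightarrow>\<^sub>0 int)" where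
  "module_character r V \<rho> =
     (\<Sum>\<mu> | \<mu> \<in> weight_lattice r \<and> weight_space r V \<rho> \<mu> \<noteq> {0}.
        Poly_Mapping.single \<mu> (int (cseq.dim (weight_space r V \<rho> \<mu>))))"

definition irrep_char :: "nat \<Rightarrow> weight \<Rightarrow> (weight \<Rightarrow>\<^sub>0 int)" where
  "irrep_char r \<mu> = (case irrep r \<mu> of (V, \<rho>) \<Rightarrow> module_character r V \<rho>)"

definition weyl_denominator :: "nat \<Rightarrow> (weight \<Rightarrow>\<^sub>0 int)" where
  "weyl_denominator r =
     (\<Sum>w | w permutes {1..r}.
        Poly_Mapping.single (weyl_act w (weyl_vector r)) ((-1) ^ coxeter_length r w))"

definition adams :: "nat \<Rightarrow> (weight \<Rightarrow>\<^sub>0 int) \<Rightarrow> (weight \<Rightarrow>\<^sub>0 int)" where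
  "adams p f =
     (\<Sum>\<mu> \<in> Poly_Mapping.keys f.
        Poly_Mapping.single (wscale (of_nat p) \<mu>) (Poly_Mapping.lookup f \<mu>))"

definition adams_coeffs :: "nat \<Rightarrow> nat \<Rightarrow> weight \<Rightarrow> (weight \<Rightarrow>\<^sub>0 int)" where
  "adams_coeffs r p \<mu> =
     (THE m. Poly_Mapping.keys m \<subseteq> dominant_weights r \<and>
        adams p (irrep_char r \<mu>) =
          (\<Sum>\<nu> \<in> Poly_Mapping.keys m. of_int (Poly_Mapping.lookup m \<nu>) * irrep_char r \<nu>))"


section \<open>Quantum dimension and the torus knot invariant\<close>

text \<open>
  Laurent polynomials in fractional powers of \<open>q\<close> form the group ring of the additive group of
  rationals, an integral domain; ratios are taken in its field of fractions.
\<close>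

type_synonym qlaurent = "rat \<Rightarrow>\<^sub>0 int"

definition qpow :: "rat \<Rightarrow> qlaurent" where
  "qpow a = Poly_Mapping.single a 1"

definition qdim :: "nat \<Rightarrow> (weight \<Rightarrow>\<^sub>0 int) \<Rightarrow> qlaurent" where
  "qdim r f =
     (\<Sum>\<mu> \<in> Poly_Mapping.keys f.
        of_int (Poly_Mapping.lookup f \<mu>) * qpow (wform r \<mu> (weyl_vector r)))"

text \<open>\<open>twist_pow r \<mu> s\<close> is the \<open>s\<close>-th power of the twist \<open>\<theta> = q\<^bsup>(\<mu>, \<mu> + 2\<delta>)/2\<^esup>\<close>.\<close>

definition twist_pow :: "nat \<Rightarrow> weight \<Rightarrow> rat \<Rightarrow> qlaurent" where
  "twist_pow r \<mu> s = qpow (s * (wform r \<mu> (\<mu> + wscale 2 (weyl_vector r)) / 2))"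

text \<open>
  The un-normalized invariant of the torus knot \<open>T(p, p')\<close> coloured by the irreducible module of
  highest weight \<open>\<mu>\<close>, in the framing of writhe \<open>p p'\<close>, given by the Rosso--Jones formula.
\<close>

definition torus_knot_invariant :: "nat \<Rightarrow> nat \<Rightarrow> nat \<Rightarrow> weight \<Rightarrow> qlaurent" where
  "torus_knot_invariant r p p' \<mu> =
     (\<Sum>\<nu> \<in> Poly_Mapping.keys (adams_coeffs r p \<mu>).
        of_int (Poly_Mapping.lookup (adams_coeffs r p \<mu>) \<nu>)
          * qdim r (irrep_char r \<nu>) * twist_pow r \<nu> (of_nat p' / of_nat p))"

end

theory Submission
  imports Defs
begin

text \<open>
  Multiplying the Rosso--Jones sum by the Weyl denominator turns every irreducible character into an
  alternating sum \<open>a\<^bsub>\<nu>+\<delta>\<^esub>\<close>, on which the linear map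
  \<open>x\<^sup>\<mu> \<mapsto> q\<^bsup>(p'/2p) |\<mu>|\<^sup>2 + (\<mu>, \<delta>)\<^esup>\<close> produces exactly the twists, because \<open>|\<mu>|\<^sup>2\<close> is constant on
  Weyl orbits; the other side is the same map applied to \<open>\<psi>\<^sub>p(ch L(n\<Lambda>\<^sub>1))\<close> times the denominator.

  This requires the Weyl character formula. Taking the trace of the Casimir operator on weight spaces
  (Freudenthal) shows that the Laplacian \<open>x\<^sup>\<mu> \<mapsto> |\<mu>|\<^sup>2 x\<^sup>\<mu>\<close> acts on \<open>ch L(\<nu>)\<close> times the denominator
  as the scalar \<open>|\<nu>+\<delta>|\<^sup>2\<close>. This element is antisymmetric with highest term \<open>\<nu>+\<delta>\<close>, and no
  other strictly dominant weight below \<open>\<nu>+\<delta>\<close> has the same norm. The irreducible modules themselves are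
  found inside a fermionic Fock space, where a Young diagram is a highest weight vector and
  irreducibility follows from the invariant Hermitian form.
\<close>

text \<open>The characters in the definition of the invariant belong to modules picked by a choice
  operator, so nothing is known about \<open>irrep_char\<close> until every dominant weight is the
  highest weight of some irreducible module. The carrier has to be a space of complex sequences; a
  Fock space fits, its basis states being natural numbers read as sets of occupied modes.

  No Verma modules are used for Weyl's formula. Along root strings the traces of lowering times
  raising operators satisfy a recursion saying that their generating function is the derivative of
  the character along the root \<alpha>, divided by \<open>x^\<alpha> - 1\<close>. The logarithmic
  gradient of the denominator product yields the same quotients, so multiplication by the
  denominator absorbs the first-order part of the Casimir operator and leaves the Laplacian.

  Of a character this needs little more than symmetry, the leading term and the Casimir identity. It
  can therefore be repeated for the explicit sum over the weights of the symmetric power, with the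
  traces written down by hand; cancelling the denominator identifies that sum with the character of
  \<open>L(n\<Lambda>\<^sub>1)\<close>.\<close>

abbreviation lk where "lk \<equiv> Poly_Mapping.lookup"
abbreviation monom1 :: "'b \<Rightarrow> 'b \<Rightarrow>\<^sub>0 'a::zero_neq_one" where "monom1 \<mu> \<equiv> Poly_Mapping.single \<mu> 1"

lemma poly_mapping_expand:
  fixes f :: "'b \<Rightarrow>\<^sub>0 'a::comm_monoid_add"
  shows "f = (\<Sum>\<mu>\<in>Poly_Mapping.keys f. Poly_Mapping.single \<mu> (lk f \<mu>))"
  by (rule poly_mapping_eqI) (auto simp: lookup_sum lookup_single when_def in_keys_iff sum.delta')

lemma poly_mapping_sum_induct [case_names zero add]:
  fixes f :: "'b \<Rightarrow>\<^sub>0 'a::comm_monoid_add"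
  assumes "P 0" and "\<And>f \<mu> c. P f \<Longrightarrow> P (f + Poly_Mapping.single \<mu> c)"
  shows "P f"
proof -
  have "P (\<Sum>\<mu>\<in>A. Poly_Mapping.single \<mu> (lk f \<mu>))" if "finite A" for A
    using that by (induction A) (auto simp: assms(1) add.commute[of "Poly_Mapping.single _ _"] intro!: assms(2))
  then show ?thesis
    using poly_mapping_expand[of f] by (metis finite_keys)
qed

subsection \<open>Linear functionals on integral group rings\<close>

text \<open>Linear extension of a map on basis elements. The Weyl group action, the Adams operation,
  \<open>qdim\<close>, the passage to complex coefficients and the Gaussian functional of the last
  step are all of this form.\<close>

definition lin :: "('b \<Rightarrow> 'a::comm_ring_1) \<Rightarrow> ('b \<Rightarrow>\<^sub>0 int) \<Rightarrow> 'a" where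
  "lin \<phi> f = (\<Sum>\<mu>\<in>Poly_Mapping.keys f. of_int (lk f \<mu>) * \<phi> \<mu>)"

lemma lin_superset:
  "finite A \<Longrightarrow> Poly_Mapping.keys f \<subseteq> A \<Longrightarrow> lin \<phi> f = (\<Sum>\<mu>\<in>A. of_int (lk f \<mu>) * \<phi> \<mu>)"
  unfolding lin_def by (rule sum.mono_neutral_left) (auto simp: in_keys_iff)

lemma lin_0 [simp]: "lin \<phi> 0 = 0"
  by (simp add: lin_def)

lemma lin_add: "lin \<phi> (f + g) = lin \<phi> f + lin \<phi> g"
proof -
  let ?A = "Poly_Mapping.keys f \<union> Poly_Mapping.keys g"
  have "Poly_Mapping.keys (f + g) \<subseteq> ?A" by (rule keys_add)
  then show ?thesis
    by (subst (1 2 3) lin_superset[where A = ?A]) (auto simp: lookup_add sum.distrib algebra_simps)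
qed

lemma lin_single [simp]: "lin \<phi> (Poly_Mapping.single \<mu> c) = of_int c * \<phi> \<mu>"
  by (subst lin_superset[where A = "{\<mu>}"]) auto

lemma lin_sum: "lin \<phi> (sum f A) = (\<Sum>x\<in>A. lin \<phi> (f x))"
  by (induction A rule: infinite_finite_induct) (auto simp: lin_add)

lemma lookup_of_int_mult:
  fixes f :: "'b::comm_monoid_add \<Rightarrow>\<^sub>0 int"
  shows "lk (of_int c * f) \<mu> = c * lk f \<mu>"
proof (induction f rule: poly_mapping_sum_induct)
  case (add f \<nu> d)
  have "of_int c * Poly_Mapping.single \<nu> d = Poly_Mapping.single \<nu> (c * d)"
    by (simp add: single_of_int[symmetric] mult_single del: single_of_int)
  then show ?case
    using add by (simp add: algebra_simps lookup_add lookup_single when_def)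
qed simp

lemma lin_of_int_mult:
  fixes f :: "'b::comm_monoid_add \<Rightarrow>\<^sub>0 int"
  shows "lin \<phi> (of_int c * f) = of_int c * lin \<phi> f"
proof -
  have "lin \<phi> (of_int c * f) = (\<Sum>\<mu>\<in>Poly_Mapping.keys f. of_int (lk (of_int c * f) \<mu>) * \<phi> \<mu>)"
    by (rule lin_superset) (auto simp: in_keys_iff lookup_of_int_mult)
  then show ?thesis
    by (simp add: lookup_of_int_mult lin_def sum_distrib_left mult.assoc)
qed

lemma lin_uminus:
  fixes f :: "'b::comm_monoid_add \<Rightarrow>\<^sub>0 int"
  shows "lin \<phi> (- f) = - lin \<phi> f"
  using lin_of_int_mult[of \<phi> "-1" f] by simp

lemma lin_diff:
  fixes f :: "'b::comm_monoid_add \<Rightarrow>\<^sub>0 int"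
  shows "lin \<phi> (f - g) = lin \<phi> f - lin \<phi> g"
  using lin_add[of \<phi> f "- g"] by (simp add: lin_uminus)

text \<open>Applies to the Weyl action, \<open>qdim\<close> and \<open>cmap\<close>; the Gaussian
  functional has a quadratic exponent and is merely additive.\<close>

lemma lin_mult:
  fixes f g :: "'b::comm_monoid_add \<Rightarrow>\<^sub>0 int"
  assumes "\<And>\<mu> \<nu>. \<phi> (\<mu> + \<nu>) = \<phi> \<mu> * \<phi> \<nu>"
  shows "lin \<phi> (f * g) = lin \<phi> f * lin \<phi> g"
proof -
  have *: "lin \<phi> (f * Poly_Mapping.single \<nu> d) = lin \<phi> f * (of_int d * \<phi> \<nu>)" for f \<nu> d
    by (induction f rule: poly_mapping_sum_induct)
       (simp_all add: algebra_simps lin_add mult_single assms)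
  show ?thesis
    by (induction g rule: poly_mapping_sum_induct) (auto simp: distrib_left lin_add *)
qed

lemma lin_prod:
  fixes f :: "'c \<Rightarrow> 'b::comm_monoid_add \<Rightarrow>\<^sub>0 int"
  assumes "\<And>\<mu> \<nu>. \<phi> (\<mu> + \<nu>) = \<phi> \<mu> * \<phi> \<nu>" and "\<phi> 0 = 1"
  shows "lin \<phi> (prod f A) = (\<Prod>x\<in>A. lin \<phi> (f x))"
proof (induction A rule: infinite_finite_induct)
  case (insert x F)
  then show ?case by (simp add: lin_mult[OF assms(1)])
qed (simp_all add: single_one[symmetric] assms(2) del: single_one)

lemma lookup_lin_inj:
  fixes g :: "'b \<Rightarrow> 'c::comm_monoid_add"
  assumes "inj g"
  shows "lk (lin (\<lambda>\<mu>. Poly_Mapping.single (g \<mu>) (1::'a::comm_ring_1)) f) (g \<nu>) = of_int (lk f \<nu>)"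
proof -
  have "of_int c * Poly_Mapping.single \<mu> (1::'a) = Poly_Mapping.single \<mu> (of_int c)" for c and \<mu> :: 'c
    by (simp add: single_of_int[symmetric] mult_single del: single_of_int)
  then show ?thesis
    using assms unfolding lin_def
    by (auto simp: lookup_sum lookup_single when_def inj_eq in_keys_iff sum.delta)
qed

text \<open>Traces of operators are complex numbers, so the differential identities are stated over
  the complex group algebra, while characters and alternating sums keep integer
  coefficients.\<close>

definition cmap :: "('b::comm_monoid_add \<Rightarrow>\<^sub>0 int) \<Rightarrow> ('b \<Rightarrow>\<^sub>0 complex)" where
  "cmap f = lin (\<lambda>\<mu>. Poly_Mapping.single \<mu> 1) f"

lemma lookup_cmap: "lk (cmap f) \<mu> = of_int (lk f \<mu>)"
  using lookup_lin_inj[of id f] by (simp add: cmap_def id_def)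

lemma cmap_mult: "cmap (f * g) = cmap f * cmap g"
  unfolding cmap_def by (rule lin_mult) (simp add: mult_single)

lemma cmap_single: "cmap (Poly_Mapping.single \<mu> 1) = Poly_Mapping.single \<mu> 1"
  by (simp add: cmap_def)

lemma cmap_prod: "cmap (prod f A) = (\<Prod>x\<in>A. cmap (f x))"
  unfolding cmap_def by (rule lin_prod) (auto simp: mult_single)

lemma cmap_diff: "cmap (f - g) = cmap f - cmap g"
  unfolding cmap_def by (rule lin_diff)

subsection \<open>Derivations of the group algebra\<close>

text \<open>The derivation belonging to the k-th coordinate; the sum of its squares over k is the
  Laplacian, which multiplies \<open>x^\<mu>\<close> by the squared norm of \<mu>.\<close>

definition weight_deriv :: "nat \<Rightarrow> (weight \<Rightarrow>\<^sub>0 complex) \<Rightarrow> (weight \<Rightarrow>\<^sub>0 complex)" where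
  "weight_deriv k f = Poly_Mapping.mapp (\<lambda>\<mu> c. of_rat (\<mu> k) * c) f"

lemma lookup_D: "lk (weight_deriv k f) \<mu> = of_rat (\<mu> k) * lk f \<mu>"
  by (simp add: weight_deriv_def lookup_mapp when_def in_keys_iff)

lemma D_add: "weight_deriv k (f + g) = weight_deriv k f + weight_deriv k g"
  by (rule poly_mapping_eqI) (simp add: lookup_D lookup_add algebra_simps)

lemma D_diff: "weight_deriv k (f - g) = weight_deriv k f - weight_deriv k g"
  by (rule poly_mapping_eqI) (simp add: lookup_D lookup_minus algebra_simps)

lemma D_0 [simp]: "weight_deriv k 0 = 0"
  by (rule poly_mapping_eqI) (simp add: lookup_D)

lemma D_single: "weight_deriv k (Poly_Mapping.single \<mu> c) = Poly_Mapping.single \<mu> (of_rat (\<mu> k) * c)"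
  by (rule poly_mapping_eqI) (auto simp: lookup_D lookup_single when_def)

lemma D_mult: "weight_deriv k (f * g) = weight_deriv k f * g + f * weight_deriv k g"
proof -
  have *: "weight_deriv k (f * Poly_Mapping.single \<nu> d) = weight_deriv k f * Poly_Mapping.single \<nu> d + f * weight_deriv k (Poly_Mapping.single \<nu> d)" for f \<nu> d
    by (induction f rule: poly_mapping_sum_induct)
       (auto simp: algebra_simps D_add mult_single D_single of_rat_add single_add)
  show ?thesis
    by (induction g rule: poly_mapping_sum_induct) (auto simp: algebra_simps D_add *)
qed

lemma D_prod:
  assumes "finite A"
  shows "weight_deriv k (prod f A) = (\<Sum>x\<in>A. weight_deriv k (f x) * prod f (A - {x}))"
  using assms
proof (induction A)
  case empty
  then show ?case by (simp add: single_one[symmetric] D_single del: single_one)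
next
  case (insert a A)
  have "(\<Sum>x\<in>A. weight_deriv k (f x) * prod f (insert a A - {x})) = (\<Sum>x\<in>A. f a * (weight_deriv k (f x) * prod f (A - {x})))"
    using insert by (intro sum.cong refl) (auto simp: insert_Diff_if)
  then show ?case
    using insert by (simp add: D_mult sum_distrib_left)
qed

subsection \<open>The Weyl denominator as a product\<close>

definition pairs :: "nat \<Rightarrow> (nat \<times> nat) set" where
  "pairs r = {(i, j). 1 \<le> i \<and> i < j \<and> j \<le> r}"

lemma finite_pairs [simp]: "finite (pairs r)"
  by (rule finite_subset[of _ "{1..r} \<times> {1..r}"]) (auto simp: pairs_def)

text \<open>Each index lies in exactly \<open>r - 1\<close> pairs.\<close>

lemma sum_pairs_add:
  fixes g :: "nat \<Rightarrow> 'a::comm_ring_1"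
  shows "(\<Sum>(i, j)\<in>pairs r. g i + g j) = (of_nat r - 1) * (\<Sum>i=1..r. g i)"
proof (induction r)
  case 0
  have "pairs 0 = {}" by (auto simp: pairs_def)
  then show ?case by simp
next
  case (Suc r)
  have "pairs (Suc r) = pairs r \<union> (\<lambda>i. (i, Suc r)) ` {1..r}"
    by (auto simp: pairs_def)
  moreover have "pairs r \<inter> (\<lambda>i. (i, Suc r)) ` {1..r} = {}"
    by (auto simp: pairs_def)
  ultimately have "(\<Sum>(i, j)\<in>pairs (Suc r). g i + g j) = (\<Sum>(i, j)\<in>pairs r. g i + g j) + (\<Sum>i=1..r. g i + g (Suc r))"
    by (simp add: sum.union_disjoint sum.reindex inj_on_def)
  then show ?case
    by (simp add: Suc sum.distrib algebra_simps)
qed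

definition vandermonde :: "nat \<Rightarrow> (weight \<Rightarrow>\<^sub>0 'a::comm_ring_1)" where
  "vandermonde r = (\<Prod>(i, j)\<in>pairs r. Poly_Mapping.single (eps i) 1 - Poly_Mapping.single (eps j) 1)"

text \<open>The vector \<open>shift r\<close> moves the exponent \<open>(r-1, \<dots>, 1, 0)\<close> of the leading Vandermonde term to \<open>\<delta>\<close>.\<close>

definition shift :: "nat \<Rightarrow> weight" where
  "shift r = (\<lambda>k. if k \<in> {1..r} then - (of_nat r - 1) / 2 else 0)"

text \<open>Weyl's product of \<open>x^\<delta>\<close> with all \<open>1 - x^(-\<alpha>)\<close>,
  arranged so that only the shift has fractional exponents. The coefficient ring is left open
  because the product is needed over the integers and over the complex numbers.\<close>

definition weyl_product :: "nat \<Rightarrow> (weight \<Rightarrow>\<^sub>0 'a::comm_ring_1)" where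
  "weyl_product r = Poly_Mapping.single (shift r) 1 * vandermonde r"

lemma cmap_dn: "cmap (weyl_product r) = weyl_product r"
  by (simp add: weyl_product_def vandermonde_def cmap_mult cmap_prod cmap_single cmap_diff split_def)

definition Cst :: "complex \<Rightarrow> (weight \<Rightarrow>\<^sub>0 complex)" where
  "Cst c = Poly_Mapping.single 0 c"

lemma Cst_simps: "Cst (a + b) = Cst a + Cst b" "Cst (a * b) = Cst a * Cst b" "Cst (- a) = - Cst a"
  "Cst 1 = 1" "Cst (of_nat n) = of_nat n" "Cst (numeral w) = numeral w" "Cst 0 = 0"
  by (auto simp: Cst_def single_add mult_single single_uminus)

lemma lookup_Cst_mult: "lk (Cst c * f) \<mu> = c * lk f \<mu>"
  by (induction f rule: poly_mapping_sum_induct)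
     (auto simp: Cst_def distrib_left lookup_add mult_single lookup_single when_def)

text \<open>The hypothesis on \<open>T i j\<close> is \<open>(x\<^bsup>\<alpha>\<^esup> - 1) T i j = \<partial>\<^sub>\<alpha> f\<close> for \<open>\<alpha> = \<epsilon>\<^sub>i - \<epsilon>\<^sub>j\<close>, cleared of denominators.
  For a character \<open>f\<close>, the coefficient of \<open>x\<^sup>\<mu>\<close> in \<open>T i j\<close> is the trace of \<open>e\<^bsub>-\<alpha>\<^esub> e\<^sub>\<alpha>\<close> on the \<open>\<mu>\<close> weight space.\<close>

lemma D_vand_pairing:
  assumes T: "\<And>i j. (i, j) \<in> pairs r \<Longrightarrow>
      (Poly_Mapping.single (eps i) 1 - Poly_Mapping.single (eps j) 1) * T i j =
      Poly_Mapping.single (eps j) 1 * (weight_deriv i f - weight_deriv j f)"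
  shows "(\<Sum>k=1..r. weight_deriv k f * weight_deriv k (vandermonde r)) = vandermonde r * (\<Sum>(i, j)\<in>pairs r. weight_deriv i f + T i j)"
proof -
  define fac :: "nat \<times> nat \<Rightarrow> (weight \<Rightarrow>\<^sub>0 complex)" where
    "fac = (\<lambda>(i, j). Poly_Mapping.single (eps i) 1 - Poly_Mapping.single (eps j) 1)"
  have V: "vandermonde r = prod fac (pairs r)"
    by (simp add: vandermonde_def fac_def)
  have "(\<Sum>k=1..r. weight_deriv k f * weight_deriv k (vandermonde r))
      = (\<Sum>q\<in>pairs r. (\<Sum>k=1..r. weight_deriv k f * weight_deriv k (fac q)) * prod fac (pairs r - {q}))"
    unfolding V D_prod[OF finite_pairs] sum_distrib_left sum_distrib_right
    by (subst sum.swap) (simp add: mult.assoc)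
  also have "\<dots> = (\<Sum>q\<in>pairs r. vandermonde r * (case q of (i, j) \<Rightarrow> weight_deriv i f + T i j))"
  proof (rule sum.cong[OF refl])
    fix q assume q: "q \<in> pairs r"
    obtain i j where ij: "q = (i, j)" by force
    have r: "i \<in> {1..r}" "j \<in> {1..r}" using q ij by (auto simp: pairs_def)
    have "weight_deriv k (fac q) = (if k = i then Poly_Mapping.single (eps i) 1 else 0) - (if k = j then Poly_Mapping.single (eps j) 1 else 0)" for k
      by (auto simp: fac_def ij D_diff D_single eps_def)
    then have "(\<Sum>k=1..r. weight_deriv k f * weight_deriv k (fac q)) = weight_deriv i f * Poly_Mapping.single (eps i) 1 - weight_deriv j f * Poly_Mapping.single (eps j) 1"
      using r by (simp add: right_diff_distrib sum_subtractf if_distrib[of "\<lambda>x. weight_deriv _ f * x"] sum.delta' cong: if_cong)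
    \<comment> \<open>The hypothesis on \<open>T i j\<close> makes the pairing of f with one factor
      divisible by that factor, so the full product can be restored.\<close>
    also have "\<dots> = fac q * (weight_deriv i f + T i j)"
      using T[of i j] q ij by (simp add: fac_def algebra_simps)
    finally have "(\<Sum>k=1..r. weight_deriv k f * weight_deriv k (fac q)) * prod fac (pairs r - {q}) = (fac q * prod fac (pairs r - {q})) * (weight_deriv i f + T i j)"
      by (simp add: mult_ac)
    then show "(\<Sum>k=1..r. weight_deriv k f * weight_deriv k (fac q)) * prod fac (pairs r - {q}) = vandermonde r * (case q of (i, j) \<Rightarrow> weight_deriv i f + T i j)"
      using prod.remove[OF finite_pairs q, of fac] by (simp add: V ij)
  qed
  finally show ?thesis by (simp add: sum_distrib_left)
qed

text \<open>All exponents of f have coordinate sum zero, so its derivatives along the coordinates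
  add up to 0. This removes the contribution of the shift and lets
  \<open>2 * weight_deriv i f\<close> be traded for
  \<open>weight_deriv i f - weight_deriv j f\<close> in the sum over pairs.\<close>

lemma D_dn_pairing:
  assumes T: "\<And>i j. (i, j) \<in> pairs r \<Longrightarrow>
      (Poly_Mapping.single (eps i) 1 - Poly_Mapping.single (eps j) 1) * T i j =
      Poly_Mapping.single (eps j) 1 * (weight_deriv i f - weight_deriv j f)"
    and 0: "\<And>\<mu>. \<mu> \<in> Poly_Mapping.keys f \<Longrightarrow> (\<Sum>i=1..r. \<mu> i) = 0"
  shows "2 * (\<Sum>k=1..r. weight_deriv k f * weight_deriv k (weyl_product r)) = weyl_product r * (\<Sum>(i, j)\<in>pairs r. weight_deriv i f - weight_deriv j f + 2 * T i j)"
proof -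
  have s0: "(\<Sum>k=1..r. weight_deriv k f) = 0"
  proof (rule poly_mapping_eqI)
    fix \<mu>
    show "lk (\<Sum>k=1..r. weight_deriv k f) \<mu> = lk 0 \<mu>"
      using 0[of \<mu>] by (cases "\<mu> \<in> Poly_Mapping.keys f")
        (auto simp: lookup_sum lookup_D sum_distrib_right[symmetric] of_rat_sum[symmetric] in_keys_iff)
  qed
  have Dk: "weight_deriv k (weyl_product r) = Poly_Mapping.single (shift r) 1 * weight_deriv k (vandermonde r) + Cst (of_rat (- (of_nat r - 1) / 2)) * weyl_product r"
    if "k \<in> {1..r}" for k
    using that by (simp add: weyl_product_def D_mult D_single shift_def Cst_def mult.assoc[symmetric] mult_single add.commute)
  have "(\<Sum>k=1..r. weight_deriv k f * weight_deriv k (weyl_product r)) = Poly_Mapping.single (shift r) 1 * (\<Sum>k=1..r. weight_deriv k f * weight_deriv k (vandermonde r))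
      + Cst (of_rat (- (of_nat r - 1) / 2)) * weyl_product r * (\<Sum>k=1..r. weight_deriv k f)"
    unfolding sum_distrib_left sum.distrib[symmetric]
    by (rule sum.cong[OF refl]) (subst Dk, auto simp: algebra_simps)
  also have "\<dots> = weyl_product r * (\<Sum>(i, j)\<in>pairs r. weight_deriv i f + T i j)"
    by (simp add: s0 D_vand_pairing[OF T] weyl_product_def mult.assoc del: One_nat_def)
  finally have 1: "2 * (\<Sum>k=1..r. weight_deriv k f * weight_deriv k (weyl_product r)) = weyl_product r * (\<Sum>(i, j)\<in>pairs r. 2 * weight_deriv i f + 2 * T i j)"
    by (simp add: sum_distrib_left split_def distrib_left mult_ac del: One_nat_def)
  have "(\<Sum>(i, j)\<in>pairs r. weight_deriv i f + weight_deriv j f) = 0"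
    by (simp add: sum_pairs_add[of "\<lambda>i. weight_deriv i f"] s0 del: One_nat_def)
  then have "(\<Sum>(i, j)\<in>pairs r. 2 * weight_deriv i f + 2 * T i j) = (\<Sum>(i, j)\<in>pairs r. weight_deriv i f - weight_deriv j f + 2 * T i j)"
    by (simp add: split_def sum.distrib sum_subtractf algebra_simps sum_distrib_left[symmetric])
  then show ?thesis using 1 by (simp only:)
qed

text \<open>By \<open>D_dn_pairing\<close> the cross term of the product rule is the part of the
  Casimir operator other than the Laplacian. What remains is the Casimir eigenvalue c plus the
  Laplacian eigenvalue d of the denominator.\<close>

lemma laplacian_mult_dn:
  assumes T: "\<And>i j. (i, j) \<in> pairs r \<Longrightarrow>
      (Poly_Mapping.single (eps i) 1 - Poly_Mapping.single (eps j) 1) * T i j =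
      Poly_Mapping.single (eps j) 1 * (weight_deriv i f - weight_deriv j f)"
    and 0: "\<And>\<mu>. \<mu> \<in> Poly_Mapping.keys f \<Longrightarrow> (\<Sum>i=1..r. \<mu> i) = 0"
    and cas: "Cst c * f = (\<Sum>k=1..r. weight_deriv k (weight_deriv k f)) + (\<Sum>(i, j)\<in>pairs r. weight_deriv i f - weight_deriv j f + 2 * T i j)"
    and weyl_product: "(\<Sum>k=1..r. weight_deriv k (weight_deriv k (weyl_product r))) = Cst d * weyl_product r"
  shows "(\<Sum>k=1..r. weight_deriv k (weight_deriv k (f * weyl_product r))) = Cst (c + d) * (f * weyl_product r)"
proof -
  have "(\<Sum>k=1..r. weight_deriv k (weight_deriv k (f * weyl_product r))) = (\<Sum>k=1..r. weight_deriv k (weight_deriv k f)) * weyl_product r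
      + 2 * (\<Sum>k=1..r. weight_deriv k f * weight_deriv k (weyl_product r)) + f * (\<Sum>k=1..r. weight_deriv k (weight_deriv k (weyl_product r)))"
    by (simp add: D_mult D_add sum.distrib sum_distrib_left sum_distrib_right algebra_simps)
  also have "2 * (\<Sum>k=1..r. weight_deriv k f * weight_deriv k (weyl_product r)) = weyl_product r * (\<Sum>(i, j)\<in>pairs r. weight_deriv i f - weight_deriv j f + 2 * T i j)"
    by (rule D_dn_pairing) (use T 0 in auto)
  also have "(\<Sum>k=1..r. weight_deriv k (weight_deriv k f)) * weyl_product r + weyl_product r * (\<Sum>(i, j)\<in>pairs r. weight_deriv i f - weight_deriv j f + 2 * T i j)
      + f * (\<Sum>k=1..r. weight_deriv k (weight_deriv k (weyl_product r))) = Cst c * f * weyl_product r + Cst d * f * weyl_product r"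
    unfolding weyl_product cas by (simp add: algebra_simps)
  finally show ?thesis by (simp add: Cst_simps algebra_simps)
qed

declare One_nat_def [simp del]

subsection \<open>The symmetric group\<close>

abbreviation adj :: "nat \<Rightarrow> nat \<Rightarrow> nat" where "adj k \<equiv> Transposition.transpose k (k + 1)"

definition word :: "nat list \<Rightarrow> nat \<Rightarrow> nat" where
  "word is = foldr (\<lambda>i u. Transposition.transpose i (i + 1) \<circ> u) is id"

lemma word_Nil [simp]: "word [] = id" and word_Cons [simp]: "word (i # is) = adj i \<circ> word is"
  by (simp_all add: word_def)

lemma word_append: "word (is @ js) = word is \<circ> word js"
  by (induction "is") (auto simp: o_assoc)

lemma adj_permutes: "k \<in> {1..<r} \<Longrightarrow> adj k permutes {1..r}"
  by (rule permutes_swap_id) auto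

lemma word_permutes: "set is \<subseteq> {1..<r} \<Longrightarrow> word is permutes {1..r}"
  by (induction "is") (auto intro!: permutes_compose adj_permutes simp: permutes_id simp del: One_nat_def)

lemma transpose_word:
  assumes "1 \<le> a" "a < b" "b \<le> r"
  shows "\<exists>is. set is \<subseteq> {1..<r} \<and> Transposition.transpose a b = word is"
  using assms
proof (induction "b - a" arbitrary: b)
  case (Suc d)
  show ?case
  proof (cases "b = a + 1")
    case True
    then show ?thesis using Suc by (intro exI[of _ "[a]"]) (auto simp: fun_eq_iff)
  next
    case False
    then obtain c where b: "b = c + 1" "a < c" using Suc by (cases b) auto
    then obtain js where js: "set js \<subseteq> {1..<r}" "Transposition.transpose a c = word js"
      using Suc by force
    have "Transposition.transpose a b = adj c \<circ> Transposition.transpose a c \<circ> adj c"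
      using b by (auto simp: fun_eq_iff transpose_def)
    also have "\<dots> = word ([c] @ js @ [c])"
      by (simp add: word_append js o_assoc)
    finally show ?thesis using js b Suc by (intro exI[of _ "[c] @ js @ [c]"]) auto
  qed
qed simp

lemma permutes_word:
  assumes "w permutes {1..r}"
  shows "\<exists>is. set is \<subseteq> {1..<r} \<and> w = word is"
  using assms finite_atLeastAtMost
proof (induction rule: permutes_induct)
  case id
  show ?case by (intro exI[of _ "[]"]) auto
next
  case (swap a b p)
  from swap obtain js where js: "set js \<subseteq> {1..<r}" "p = word js" by auto
  obtain ks where "set ks \<subseteq> {1..<r}" "Transposition.transpose a b = word ks"
  proof (cases "a < b")
    case True
    then show ?thesis using transpose_word[of a b r] swap that by auto
  next
    case False
    then show ?thesis using transpose_word[of b a r] swap that by (auto simp: transpose_commute)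
  qed
  with js show ?case by (intro exI[of _ "ks @ js"]) (auto simp: word_append)
qed

lemma weyl_induct [consumes 1, case_names id adj]:
  assumes "w permutes {1..r}" and "Q id"
    and "\<And>k w. k \<in> {1..<r} \<Longrightarrow> w permutes {1..r} \<Longrightarrow> Q w \<Longrightarrow> Q (adj k \<circ> w)"
  shows "Q w"
proof -
  obtain js where js: "set js \<subseteq> {1..<r}" "w = word js"
    using permutes_word[OF assms(1)] by auto
  have "set js \<subseteq> {1..<r} \<Longrightarrow> Q (word js)" for js
    by (induction js) (auto intro!: assms(2,3) word_permutes simp del: One_nat_def)
  then show ?thesis using js by auto
qed

lemma sign_comp_adj: "k \<in> {1..<r} \<Longrightarrow> w permutes {1..r} \<Longrightarrow> sign (adj k \<circ> w) = - sign w"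
  by (subst sign_compose) (auto simp: sign_swap_id permutation_swap_id intro: permutation_permutes[THEN iffD2] simp del: One_nat_def)

lemma sign_word: "set is \<subseteq> {1..<r} \<Longrightarrow> sign (word is) = (-1) ^ length is"
  by (induction "is") (auto simp: sign_comp_adj[OF _ word_permutes] simp del: One_nat_def)

text \<open>The sign fixes the parity of the length of every word for w, in particular of a shortest
  one, which exists by \<open>permutes_word\<close>. Here the Coxeter length of the definitions is
  traded for the sign.\<close>

lemma minus_one_power_coxeter_length:
  assumes "w permutes {1..r}"
  shows "(-1) ^ coxeter_length r w = (of_int (sign w) :: 'a::ring_1)"
proof -
  obtain js where js: "set js \<subseteq> {1..<r}" "w = word js"
    using permutes_word[OF assms] by auto
  have "\<exists>is. length is = coxeter_length r w \<and> set is \<subseteq> {1..<r} \<and> w = foldr (\<lambda>i u. Transposition.transpose i (i + 1) \<circ> u) is id"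
    unfolding coxeter_length_def
    by (rule LeastI[of "\<lambda>k. \<exists>is. length is = k \<and> set is \<subseteq> {1..<r} \<and> w = foldr (\<lambda>i u. Transposition.transpose i (i + 1) \<circ> u) is id" "length js"])
      (use js in \<open>auto simp: word_def\<close>)
  then show ?thesis
    using sign_word[of _ r] by (fold word_def) (metis of_int_1 of_int_minus of_int_power)
qed

section \<open>The Weyl action on weights, the invariant form and the open chamber\<close>

lemma weyl_act_add: "weyl_act w (u + v) = weyl_act w u + weyl_act w v"
  by (simp add: weyl_act_def fun_eq_iff)

lemma weyl_act_wscale: "weyl_act w (wscale c u) = wscale c (weyl_act w u)"
  by (simp add: weyl_act_def wscale_def fun_eq_iff)

lemma weyl_act_id [simp]: "weyl_act id u = u" "weyl_act (\<lambda>a. a) u = u"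
  by (simp_all add: weyl_act_def id_def[symmetric] del: id_apply)

lemma weyl_act_comp:
  "bij u \<Longrightarrow> bij w \<Longrightarrow> weyl_act (u \<circ> w) v = weyl_act u (weyl_act w v)"
  by (simp add: weyl_act_def o_inv_distrib o_assoc)

lemma weyl_act_inv_cancel: "bij w \<Longrightarrow> weyl_act (Hilbert_Choice.inv w) (weyl_act w v) = v"
  using weyl_act_comp[of "Hilbert_Choice.inv w" w v] by (simp add: bij_imp_bij_inv bij_is_inj)

lemma weyl_act_cancel_inv: "bij w \<Longrightarrow> weyl_act w (weyl_act (Hilbert_Choice.inv w) v) = v"
  using weyl_act_comp[of w "Hilbert_Choice.inv w" v] by (simp add: bij_imp_bij_inv bij_is_surj surj_iff[THEN iffD1])

lemma weyl_act_inj: "bij w \<Longrightarrow> inj (weyl_act w)"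
  by (metis injI weyl_act_inv_cancel)

lemma weyl_act_eps: "bij w \<Longrightarrow> weyl_act w (eps i) = eps (w i)"
  by (auto simp: weyl_act_def eps_def fun_eq_iff bij_inv_eq_iff[symmetric] bij_is_inj inv_f_f) (metis bij_inv_eq_iff)+

lemma weyl_act_transpose: "weyl_act (Transposition.transpose a b) v j = v (Transposition.transpose a b j)"
  by (simp add: weyl_act_def)

lemma sum_weyl_act:
  assumes "w permutes {1..r}"
  shows "(\<Sum>i=1..r. h (weyl_act w u i) (weyl_act w v i)) = (\<Sum>i=1..r. h (u i) (v i))"
proof -
  have "(\<Sum>i=1..r. h (u i) (v i)) = (\<Sum>i=1..r. ((\<lambda>i. h (u i) (v i)) \<circ> Hilbert_Choice.inv w) i)"
    by (rule sum.permute) (rule permutes_inv[OF assms])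
  then show ?thesis by (simp add: weyl_act_def)
qed

lemma wform_weyl_act: "w permutes {1..r} \<Longrightarrow> wform r (weyl_act w u) (weyl_act w v) = wform r u v"
  unfolding wform_def by (rule sum_weyl_act)

lemma wnormsq_weyl_act: "w permutes {1..r} \<Longrightarrow> wnormsq r (weyl_act w u) = wnormsq r u"
  unfolding wnormsq_def by (rule wform_weyl_act)

lemma wform_add_left: "wform r (u + v) w = wform r u w + wform r v w"
  and wform_add_right: "wform r w (u + v) = wform r w u + wform r w v"
  and wform_diff_left: "wform r (u - v) w = wform r u w - wform r v w"
  and wform_diff_right: "wform r w (u - v) = wform r w u - wform r w v"
  and wform_wscale_left: "wform r (wscale c u) w = c * wform r u w"
  and wform_wscale_right: "wform r w (wscale c u) = c * wform r w u"
  and wform_zero_left [simp]: "wform r 0 w = 0"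
  by (simp_all add: wform_def wscale_def algebra_simps sum.distrib sum_subtractf sum_distrib_left)

lemma wform_commute: "wform r u v = wform r v u"
  by (simp add: wform_def mult.commute)

text \<open>Weights are functions on all natural numbers, whereas \<open>wform\<close> and the
  diagonal operators see only the indices \<open>1..r\<close>; equality of weights follows from such
  data only under this condition.\<close>

definition supported :: "nat \<Rightarrow> weight \<Rightarrow> bool" where
  "supported r \<mu> \<longleftrightarrow> (\<forall>i. i \<notin> {1..r} \<longrightarrow> \<mu> i = 0)"

lemma supported_add: "supported r u \<Longrightarrow> supported r v \<Longrightarrow> supported r (u + v)"
  and supported_diff: "supported r u \<Longrightarrow> supported r v \<Longrightarrow> supported r (u - v)"
  and supported_wscale: "supported r u \<Longrightarrow> supported r (wscale c u)"
  and supported_eps: "i \<in> {1..r} \<Longrightarrow> supported r (eps i)"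
  by (auto simp: supported_def wscale_def eps_def)

lemma supported_weyl_act: "w permutes {1..r} \<Longrightarrow> supported r u \<Longrightarrow> supported r (weyl_act w u)"
  unfolding supported_def weyl_act_def by (metis comp_apply permutes_inv permutes_not_in)

lemma wform_self_pos:
  assumes "supported r u" "u \<noteq> 0" shows "wform r u u > 0"
proof -
  obtain i where i: "u i \<noteq> 0" using assms(2) by (auto simp: fun_eq_iff)
  then have "i \<in> {1..r}" using assms(1) by (auto simp: supported_def)
  then show ?thesis unfolding wform_def
    by (intro sum_pos2[of _ i]) (use i in \<open>auto simp: less_le\<close>)
qed

text \<open>The open dominant chamber, with no integrality condition:
  \<open>strictdom_below_weyl_vector\<close> tests positivity at an arbitrary rational point of
  it.\<close>

definition strictdom :: "nat \<Rightarrow> weight \<Rightarrow> bool" where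
  "strictdom r \<kappa> \<longleftrightarrow> (\<forall>k\<in>{1..<r}. \<kappa> (k + 1) < \<kappa> k)"

lemma strictdomD:
  assumes "strictdom r \<kappa>" "1 \<le> i" "i < j" "j \<le> r"
  shows "\<kappa> j < \<kappa> i"
  using assms(3,4)
proof (induction j)
  case (Suc j)
  have "j \<in> {1..<r}" using assms(2) Suc by auto
  then have "\<kappa> (Suc j) < \<kappa> j" using assms(1) unfolding strictdom_def by (metis Suc_eq_plus1)
  then show ?case using Suc by (cases "i = j") (auto intro: less_trans)
qed simp

text \<open>The inverse u of w has to be strictly increasing on \<open>{1..r}\<close>, hence
  \<open>i \<le> u i\<close> throughout, which leaves only the identity.\<close>

lemma strictdom_weyl_act_unique:
  assumes w: "w permutes {1..r}" and "strictdom r \<kappa>" "strictdom r (weyl_act w \<kappa>)"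
  shows "w = id"
proof -
  let ?u = "Hilbert_Choice.inv w"
  have u: "?u permutes {1..r}" by (rule permutes_inv[OF w])
  have mono: "?u i < ?u j" if "1 \<le> i" "i < j" "j \<le> r" for i j
  proof (rule ccontr)
    assume "\<not> ?u i < ?u j"
    moreover have "?u i \<noteq> ?u j" using permutes_inj[OF u] that by (auto simp: inj_eq)
    ultimately have "?u j < ?u i" by simp
    moreover have "?u i \<in> {1..r}" "?u j \<in> {1..r}" using u that by (simp_all add: permutes_in_image del: atLeastAtMost_iff) auto
    ultimately have "\<kappa> (?u i) < \<kappa> (?u j)" using strictdomD[OF assms(2)] by simp
    moreover have "\<kappa> (?u j) < \<kappa> (?u i)" using strictdomD[OF assms(3) that] by (simp add: weyl_act_def)
    ultimately show False by simp
  qed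
  have "i \<in> {1..r} \<longrightarrow> i \<le> ?u i" for i
  proof (induction i)
    case (Suc i)
    show ?case
    proof
      assume *: "Suc i \<in> {1..r}"
      then have "?u (Suc i) \<in> {1..r}" using u by (simp add: permutes_in_image del: atLeastAtMost_iff)
      then show "Suc i \<le> ?u (Suc i)"
        using Suc mono[of i "Suc i"] * by (cases "i = 0") auto
    qed
  qed simp
  then have "?u = id" using permutes_natset_ge[OF u] by blast
  then show ?thesis using permutes_inv_inv[OF w] by simp
qed

subsection \<open>Symmetric and antisymmetric elements\<close>

definition act :: "(nat \<Rightarrow> nat) \<Rightarrow> (weight \<Rightarrow>\<^sub>0 int) \<Rightarrow> (weight \<Rightarrow>\<^sub>0 int)" where
  "act w f = lin (\<lambda>\<mu>. monom1 (weyl_act w \<mu>)) f"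

lemma act_mult: "act w (f * g) = act w f * act w g"
  unfolding act_def by (rule lin_mult) (simp add: weyl_act_add mult_single)

lemma lookup_act: "bij w \<Longrightarrow> lk (act w f) (weyl_act w \<mu>) = lk f \<mu>"
  unfolding act_def by (subst lookup_lin_inj) (auto intro: weyl_act_inj)

lemma lookup_act': "bij w \<Longrightarrow> lk (act w f) \<mu> = lk f (weyl_act (Hilbert_Choice.inv w) \<mu>)"
  using lookup_act[of w f "weyl_act (Hilbert_Choice.inv w) \<mu>"] by (simp add: weyl_act_cancel_inv)

definition weyl_antisymmetric :: "nat \<Rightarrow> (weight \<Rightarrow>\<^sub>0 int) \<Rightarrow> bool" where
  "weyl_antisymmetric r f \<longleftrightarrow> (\<forall>w \<mu>. w permutes {1..r} \<longrightarrow> lk f (weyl_act w \<mu>) = sign w * lk f \<mu>)"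

definition weyl_symmetric :: "nat \<Rightarrow> (weight \<Rightarrow>\<^sub>0 int) \<Rightarrow> bool" where
  "weyl_symmetric r f \<longleftrightarrow> (\<forall>w \<mu>. w permutes {1..r} \<longrightarrow> lk f (weyl_act w \<mu>) = lk f \<mu>)"

lemma antisymI_adj:
  assumes "\<And>k. k \<in> {1..<r} \<Longrightarrow> act (adj k) f = - f"
  shows "weyl_antisymmetric r f"
  unfolding weyl_antisymmetric_def
proof (intro allI impI)
  fix w \<mu> assume "w permutes {1..r}"
  then show "lk f (weyl_act w \<mu>) = sign w * lk f \<mu>"
  proof (induction rule: weyl_induct)
    case (adj k w)
    have "weyl_act (adj k \<circ> w) \<mu> = weyl_act (adj k) (weyl_act w \<mu>)"
      by (rule weyl_act_comp) (use adj in \<open>auto simp: permutes_bij\<close>)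
    moreover have "lk f (weyl_act (adj k) (weyl_act w \<mu>)) = - lk (act (adj k) f) (weyl_act (adj k) (weyl_act w \<mu>))"
      using assms[OF adj(1)] by simp
    ultimately show ?case
      using adj(3) by (simp only: lookup_act[OF bij_transpose] sign_comp_adj[OF adj(1,2)])
  qed simp
qed

lemma symI_adj:
  assumes "\<And>k \<mu>. k \<in> {1..<r} \<Longrightarrow> lk f (weyl_act (adj k) \<mu>) = lk f \<mu>"
  shows "weyl_symmetric r f"
  unfolding weyl_symmetric_def
proof (intro allI impI)
  fix w \<mu> assume "w permutes {1..r}"
  then show "lk f (weyl_act w \<mu>) = lk f \<mu>"
  proof (induction rule: weyl_induct)
    case (adj k w)
    have "weyl_act (adj k \<circ> w) \<mu> = weyl_act (adj k) (weyl_act w \<mu>)"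
      by (rule weyl_act_comp) (use adj in \<open>auto simp: permutes_bij\<close>)
    then show ?case using assms[OF adj(1)] adj(3) by (simp only:)
  qed simp
qed

lemma antisym_act: "weyl_antisymmetric r f \<Longrightarrow> w permutes {1..r} \<Longrightarrow> act w f = of_int (sign w) * f"
  by (rule poly_mapping_eqI)
    (simp add: lookup_act' permutes_bij lookup_of_int_mult weyl_antisymmetric_def permutes_inv sign_inverse[OF permutes_imp_permutation[OF finite_atLeastAtMost]])

lemma sym_act: "weyl_symmetric r f \<Longrightarrow> w permutes {1..r} \<Longrightarrow> act w f = f"
  by (rule poly_mapping_eqI) (simp add: lookup_act' permutes_bij weyl_symmetric_def permutes_inv)

lemma antisym_sym_mult: "weyl_symmetric r f \<Longrightarrow> weyl_antisymmetric r g \<Longrightarrow> weyl_antisymmetric r (f * g)"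
  by (rule antisymI_adj) (simp add: act_mult sym_act antisym_act adj_permutes sign_swap_id del: One_nat_def)

text \<open>The numerator of Weyl's formula when \<kappa> is a dominant weight plus
  \<delta>.\<close>

definition alt :: "nat \<Rightarrow> weight \<Rightarrow> (weight \<Rightarrow>\<^sub>0 int)" where
  "alt r \<kappa> = (\<Sum>w | w permutes {1..r}. Poly_Mapping.single (weyl_act w \<kappa>) (sign w))"

lemma finite_permutes [simp]: "finite {w. w permutes {1..r::nat}}"
  by (rule finite_permutations) simp

lemma antisym_alt: "weyl_antisymmetric r (alt r \<kappa>)"
  unfolding weyl_antisymmetric_def
proof (intro allI impI)
  fix w \<mu> assume w: "w permutes {1..r}"
  have "lk (alt r \<kappa>) (weyl_act w \<mu>) = (\<Sum>u | u permutes {1..r}. sign u when weyl_act u \<kappa> = weyl_act w \<mu>)"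
    by (simp add: alt_def lookup_sum lookup_single)
  also have "\<dots> = (\<Sum>u | u permutes {1..r}. sign (w \<circ> u) when weyl_act (w \<circ> u) \<kappa> = weyl_act w \<mu>)"
    by (rule setum_permutations_compose_left[OF w])
  also have "\<dots> = (\<Sum>u | u permutes {1..r}. sign w * (sign u when weyl_act u \<kappa> = \<mu>))"
  proof (rule sum.cong[OF refl])
    fix u assume "u \<in> {u. u permutes {1..r}}"
    then have u: "u permutes {1..r}" by simp
    have "weyl_act (w \<circ> u) \<kappa> = weyl_act w \<mu> \<longleftrightarrow> weyl_act u \<kappa> = \<mu>"
      using weyl_act_inj[of w] w u by (simp add: weyl_act_comp permutes_bij inj_eq)
    moreover have "sign (w \<circ> u) = sign w * sign u"
      using w u by (intro sign_compose) (auto intro: permutation_permutes[THEN iffD2])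
    ultimately show "(sign (w \<circ> u) when weyl_act (w \<circ> u) \<kappa> = weyl_act w \<mu>) = sign w * (sign u when weyl_act u \<kappa> = \<mu>)"
      by (simp add: when_def)
  qed
  also have "\<dots> = sign w * lk (alt r \<kappa>) \<mu>"
    by (simp add: alt_def lookup_sum lookup_single sum_distrib_left)
  finally show "lk (alt r \<kappa>) (weyl_act w \<mu>) = sign w * lk (alt r \<kappa>) \<mu>" .
qed

text \<open>The orbit of a strictly dominant weight meets the open chamber once, with trivial
  stabilizer, so alternating sums are told apart by one coefficient.\<close>

lemma lookup_alt_strictdom:
  assumes "strictdom r \<kappa>" "strictdom r \<kappa>'"
  shows "lk (alt r \<kappa>) \<kappa>' = (if \<kappa> = \<kappa>' then 1 else 0)"
proof -
  have "weyl_act w \<kappa> = \<kappa>' \<longleftrightarrow> w = id \<and> \<kappa> = \<kappa>'" if "w permutes {1..r}" for w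
    using strictdom_weyl_act_unique[OF that assms(1)] assms(2) by auto
  then have "lk (alt r \<kappa>) \<kappa>' = (\<Sum>w | w permutes {1..r}. if w = id then (if \<kappa> = \<kappa>' then 1 else 0) else 0)"
    unfolding alt_def lookup_sum lookup_single when_def by (intro sum.cong) auto
  then show ?thesis by (simp add: permutes_id)
qed

text \<open>Take w maximizing the pairing of \<open>weyl_act w \<mu>\<close> with
  \<open>(-1, ..., -r)\<close>, which is \<delta> up to a constant vector. Swapping two neighbours
  in the wrong order would increase it.\<close>

lemma exists_dominant_conjugate:
  obtains w where "w permutes {1..r}" "\<And>k. k \<in> {1..<r} \<Longrightarrow> weyl_act w \<mu> (k + 1) \<le> weyl_act w \<mu> k"
proof -
  let ?P = "{w. w permutes {1..r}}"
  let ?h = "\<lambda>w. \<Sum>i=1..r. weyl_act w \<mu> i * - of_nat i"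
  have ne: "?P \<noteq> {}" using permutes_id by blast
  obtain w where w: "w permutes {1..r}" "\<And>u. u permutes {1..r} \<Longrightarrow> ?h u \<le> ?h w"
  proof -
    have "Max (?h ` ?P) \<in> ?h ` ?P" using ne by (intro Max_in) auto
    then obtain w where "w permutes {1..r}" "?h w = Max (?h ` ?P)" by auto
    moreover have "?h u \<le> Max (?h ` ?P)" if "u permutes {1..r}" for u
      using that by (intro Max_ge) auto
    ultimately show ?thesis using that[of w] by auto
  qed
  have "weyl_act w \<mu> (k + 1) \<le> weyl_act w \<mu> k" if k: "k \<in> {1..<r}" for k
  proof -
    let ?v = "weyl_act w \<mu>"
    have "weyl_act (adj k \<circ> w) \<mu> = weyl_act (adj k) ?v"
      using w by (simp add: weyl_act_comp permutes_bij)
    moreover have "adj k \<circ> w permutes {1..r}"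
      by (intro permutes_compose w adj_permutes k)
    ultimately have le: "(\<Sum>i=1..r. weyl_act (adj k) ?v i * - of_nat i) \<le> ?h w"
      using w(2)[of "adj k \<circ> w"] by simp
    have "{1..r} = insert k (insert (k + 1) ({1..r} - {k, k + 1}))" using k by auto
    then have split: "sum g {1..r} = g k + (g (k + 1) + sum g ({1..r} - {k, k + 1}))" for g :: "nat \<Rightarrow> rat"
      by (metis (no_types, lifting) Diff_iff add_cancel_right_right finite_Diff finite_atLeastAtMost finite_insert insert_iff n_not_Suc_n Suc_eq_plus1 sum.insert)
    have "(\<Sum>i\<in>{1..r} - {k, k + 1}. weyl_act (adj k) ?v i * - of_nat i) = (\<Sum>i\<in>{1..r} - {k, k + 1}. ?v i * - of_nat i)"
      by (intro sum.cong refl) (auto simp: weyl_act_transpose)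
    then show ?thesis
      using le unfolding split by (simp add: weyl_act_transpose algebra_simps)
  qed
  then show ?thesis using that w(1) by blast
qed

text \<open>Every weight is conjugate to a dominant one. If that one lies on a wall, an adjacent
  transposition fixes it and antisymmetry makes its coefficient equal to its own negative; otherwise
  it is strictly dominant and the hypothesis applies.\<close>

lemma antisym_eqI:
  assumes "weyl_antisymmetric r f" "weyl_antisymmetric r g"
    and eq: "\<And>\<kappa>. strictdom r \<kappa> \<Longrightarrow> lk f \<kappa> = lk g \<kappa>"
  shows "f = g"
proof (rule poly_mapping_eqI)
  fix \<mu>
  obtain w where w: "w permutes {1..r}" and dom: "\<And>k. k \<in> {1..<r} \<Longrightarrow> weyl_act w \<mu> (k + 1) \<le> weyl_act w \<mu> k"
    using exists_dominant_conjugate by blast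
  have "lk f (weyl_act w \<mu>) = lk g (weyl_act w \<mu>)"
  proof (cases "strictdom r (weyl_act w \<mu>)")
    case False
    then obtain k where k: "k \<in> {1..<r}" "weyl_act w \<mu> (k + 1) = weyl_act w \<mu> k"
      using dom unfolding strictdom_def by (metis order_le_imp_less_or_eq)
    have "weyl_act (adj k) (weyl_act w \<mu>) = weyl_act w \<mu>"
      using k(2) by (auto simp: fun_eq_iff weyl_act_transpose transpose_def)
    then have "lk h (weyl_act w \<mu>) = 0" if "weyl_antisymmetric r h" for h
      using that adj_permutes[OF k(1)] unfolding weyl_antisymmetric_def
      by (metis equal_neg_zero mult_minus_left mult_1 n_not_Suc_n Suc_eq_plus1 sign_swap_id)
    then show ?thesis using assms by simp
  qed (rule eq)
  then show "lk f \<mu> = lk g \<mu>"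
    using assms(1,2) w unfolding weyl_antisymmetric_def by simp
qed

lemma antisym_sum: "(\<And>x. x \<in> A \<Longrightarrow> weyl_antisymmetric r (f x)) \<Longrightarrow> weyl_antisymmetric r (sum f A)"
  by (simp add: weyl_antisymmetric_def lookup_sum sum_distrib_left)

lemma antisym_of_int_mult: "weyl_antisymmetric r f \<Longrightarrow> weyl_antisymmetric r (of_int c * f)"
  by (simp add: weyl_antisymmetric_def lookup_of_int_mult)

lemma antisym_expand:
  assumes "weyl_antisymmetric r f"
  shows "f = (\<Sum>\<kappa> | \<kappa> \<in> Poly_Mapping.keys f \<and> strictdom r \<kappa>. of_int (lk f \<kappa>) * alt r \<kappa>)"
proof (rule antisym_eqI[OF assms])
  show "weyl_antisymmetric r (\<Sum>\<kappa> | \<kappa> \<in> Poly_Mapping.keys f \<and> strictdom r \<kappa>. of_int (lk f \<kappa>) * alt r \<kappa>)"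
    by (intro antisym_sum antisym_of_int_mult antisym_alt)
  fix \<kappa>' assume k': "strictdom r \<kappa>'"
  let ?K = "{\<kappa>. \<kappa> \<in> Poly_Mapping.keys f \<and> strictdom r \<kappa>}"
  have "lk (\<Sum>\<kappa>\<in>?K. of_int (lk f \<kappa>) * alt r \<kappa>) \<kappa>' = (\<Sum>\<kappa>\<in>?K. if \<kappa> = \<kappa>' then lk f \<kappa>' else 0)"
    unfolding lookup_sum by (rule sum.cong) (auto simp: lookup_of_int_mult lookup_alt_strictdom k')
  then show "lk f \<kappa>' = lk (\<Sum>\<kappa>\<in>?K. of_int (lk f \<kappa>) * alt r \<kappa>) \<kappa>'"
    using k' by (simp add: in_keys_iff)
qed

subsection \<open>The dominance order\<close>

lemma sum_fun_apply: "(\<Sum>a\<in>A. f a) x = (\<Sum>a\<in>A. f a x)"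
  by (induction A rule: infinite_finite_induct) auto

lemma weyl_vector_apply:
  "weyl_vector r k = (if k \<in> {1..r} then (of_nat r + 1 - 2 * of_nat k) / 2 else 0)"
proof -
  have "weyl_vector r k = (\<Sum>i=1..r. if i = k then (of_nat r + 1 - 2 * of_nat i) / 2 else 0)"
    unfolding weyl_vector_def sum_fun_apply by (rule sum.cong) (auto simp: wscale_def eps_def)
  then show ?thesis by (simp add: sum.delta)
qed

lemma supported_weyl_vector: "supported r (weyl_vector r)"
  by (auto simp: supported_def weyl_vector_apply)

lemma strictdom_weyl_vector: "strictdom r (weyl_vector r)"
  by (auto simp: strictdom_def weyl_vector_apply field_simps)

text \<open>Membership in the positive root cone enters only through the pairing with strictly dominant weights.\<close>

definition root_positive :: "nat \<Rightarrow> weight \<Rightarrow> bool" where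
  "root_positive r d \<longleftrightarrow> d = 0 \<or> (\<forall>\<eta>. strictdom r \<eta> \<longrightarrow> wform r d \<eta> > 0)"

lemma pos_0: "root_positive r 0"
  by (simp add: root_positive_def)

lemma pos_add: "root_positive r u \<Longrightarrow> root_positive r v \<Longrightarrow> root_positive r (u + v)"
  unfolding root_positive_def by (auto simp: wform_add_left intro: add_pos_pos)

lemma pos_strict: "root_positive r u \<Longrightarrow> u \<noteq> 0 \<Longrightarrow> strictdom r \<eta> \<Longrightarrow> wform r u \<eta> > 0"
  by (simp add: root_positive_def)

lemma pos_nonneg: "root_positive r u \<Longrightarrow> strictdom r \<eta> \<Longrightarrow> wform r u \<eta> \<ge> 0"
  by (auto simp: root_positive_def order_less_imp_le)

text \<open>\<delta> is strictly dominant, so it pairs positively with every nonzero positive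
  element.\<close>

lemma pos_add_eq_0:
  assumes "root_positive r u" "root_positive r v" "u + v = 0" shows "u = 0 \<and> v = 0"
proof -
  have "wform r u (weyl_vector r) + wform r v (weyl_vector r) = 0"
    using assms(3) by (simp add: wform_add_left[symmetric])
  then show ?thesis
    using pos_strict[OF assms(1) _ strictdom_weyl_vector] pos_strict[OF assms(2) _ strictdom_weyl_vector]
      pos_nonneg[OF assms(1) strictdom_weyl_vector] pos_nonneg[OF assms(2) strictdom_weyl_vector] by force
qed

lemma wform_eps: "i \<in> {1..r} \<Longrightarrow> wform r (eps i) v = v i"
  by (simp add: wform_def eps_def if_distrib[of "\<lambda>x. x * _"] sum.delta cong: if_cong)

lemma pos_root: "(i, j) \<in> pairs r \<Longrightarrow> root_positive r (eps i - eps j)"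
  unfolding root_positive_def using strictdomD[of r _ i j] by (auto simp: wform_diff_left wform_eps pairs_def)

lemma wnormsq_diff: "wnormsq r a - wnormsq r b = wform r (a - b) (a + b)"
  by (simp add: wnormsq_def wform_diff_left wform_add_right wform_commute[of r a b])

definition leading :: "nat \<Rightarrow> (weight \<Rightarrow>\<^sub>0 int) \<Rightarrow> weight \<Rightarrow> bool" where
  "leading r f \<kappa> \<longleftrightarrow> lk f \<kappa> = 1 \<and> (\<forall>\<mu>\<in>Poly_Mapping.keys f. root_positive r (\<kappa> - \<mu>))"

lemma lookup_mult_expand:
  fixes f g :: "'b::comm_monoid_add \<Rightarrow>\<^sub>0 int"
  shows "lk (f * g) \<mu> = (\<Sum>a\<in>Poly_Mapping.keys f. \<Sum>b\<in>Poly_Mapping.keys g. lk f a * lk g b when a + b = \<mu>)"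
proof -
  have "f * g = (\<Sum>a\<in>Poly_Mapping.keys f. \<Sum>b\<in>Poly_Mapping.keys g. Poly_Mapping.single (a + b) (lk f a * lk g b))"
    using arg_cong2[OF poly_mapping_expand[of f] poly_mapping_expand[of g], of "(*)"]
    by (simp only: sum_product mult_single)
  then show ?thesis by (simp add: lookup_sum lookup_single)
qed

lemma keys_multE:
  fixes f g :: "'b::comm_monoid_add \<Rightarrow>\<^sub>0 'a::semiring_0"
  assumes "\<mu> \<in> Poly_Mapping.keys (f * g)"
  obtains a b where "\<mu> = a + b" "a \<in> Poly_Mapping.keys f" "b \<in> Poly_Mapping.keys g"
  using keys_mult[of f g] assms by blast

text \<open>Used at extremal exponents, where positivity excludes every other decomposition.\<close>

lemma lookup_mult_unique:
  fixes f g :: "'b::comm_monoid_add \<Rightarrow>\<^sub>0 int"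
  assumes "\<And>a b. a \<in> Poly_Mapping.keys f \<Longrightarrow> b \<in> Poly_Mapping.keys g \<Longrightarrow> a + b = \<kappa> + \<kappa>' \<Longrightarrow> a = \<kappa> \<and> b = \<kappa>'"
  shows "lk (f * g) (\<kappa> + \<kappa>') = lk f \<kappa> * lk g \<kappa>'"
proof -
  have "lk (f * g) (\<kappa> + \<kappa>') = (\<Sum>a\<in>Poly_Mapping.keys f. \<Sum>b\<in>Poly_Mapping.keys g. if a = \<kappa> then (if b = \<kappa>' then lk f \<kappa> * lk g \<kappa>' else 0) else 0)"
    unfolding lookup_mult_expand using assms by (intro sum.cong refl) (auto simp: when_def)
  also have "\<dots> = (\<Sum>a\<in>Poly_Mapping.keys f. if a = \<kappa> then (if \<kappa>' \<in> Poly_Mapping.keys g then lk f \<kappa> * lk g \<kappa>' else 0) else 0)"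
    by (intro sum.cong refl) (auto simp: sum.delta)
  also have "\<dots> = lk f \<kappa> * lk g \<kappa>'"
    by (auto simp: sum.delta in_keys_iff)
  finally show ?thesis .
qed

lemma leading_mult:
  assumes "leading r f \<kappa>" "leading r g \<kappa>'"
  shows "leading r (f * g) (\<kappa> + \<kappa>')"
  unfolding leading_def
proof (intro conjI ballI)
  have "lk (f * g) (\<kappa> + \<kappa>') = lk f \<kappa> * lk g \<kappa>'"
  proof (rule lookup_mult_unique)
    fix a b assume *: "a \<in> Poly_Mapping.keys f" "b \<in> Poly_Mapping.keys g" "a + b = \<kappa> + \<kappa>'"
    then have "(\<kappa> - a) + (\<kappa>' - b) = 0" by (simp add: algebra_simps)
    then have "\<kappa> - a = 0 \<and> \<kappa>' - b = 0"
      using * assms by (intro pos_add_eq_0[of r]) (auto simp: leading_def)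
    then show "a = \<kappa> \<and> b = \<kappa>'" by auto
  qed
  then show "lk (f * g) (\<kappa> + \<kappa>') = 1" using assms by (simp add: leading_def)
  fix \<mu> assume "\<mu> \<in> Poly_Mapping.keys (f * g)"
  then obtain a b where "\<mu> = a + b" "a \<in> Poly_Mapping.keys f" "b \<in> Poly_Mapping.keys g"
    by (rule keys_multE)
  then have "root_positive r ((\<kappa> - a) + (\<kappa>' - b))" using assms by (intro pos_add) (auto simp: leading_def)
  then show "root_positive r (\<kappa> + \<kappa>' - \<mu>)" using \<open>\<mu> = a + b\<close> by (simp add: algebra_simps)
qed

lemma leading_single: "leading r (monom1 \<kappa>) \<kappa>"
  by (auto simp: leading_def pos_0 lookup_single)

section \<open>Leading term, antisymmetry and the Weyl denominator identity\<close>

lemma leading_prod: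
  assumes "finite A" "\<And>x. x \<in> A \<Longrightarrow> leading r (f x) (k x)"
  shows "leading r (prod f A) (sum k A)"
  using assms
proof (induction A)
  case empty
  show ?case using leading_single[of r 0] by (simp only: single_one prod.empty sum.empty)
qed (simp add: leading_mult)

lemma leading_root_factor:
  assumes "(i, j) \<in> pairs r"
  shows "leading r (monom1 (eps i) - monom1 (eps j)) (eps i)"
proof -
  have "eps i \<noteq> eps j" using assms by (auto simp: eps_def fun_eq_iff pairs_def)
  then show ?thesis
    using keys_diff[of "monom1 (eps i) :: weight \<Rightarrow>\<^sub>0 int" "monom1 (eps j)"] pos_root[OF assms]
    by (auto simp: leading_def lookup_minus lookup_single pos_0)
qed

lemma leading_dn: "leading r (weyl_product r) (weyl_vector r)"
proof -
  have "leading r (vandermonde r) (\<Sum>(i, j)\<in>pairs r. eps i)"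
    unfolding vandermonde_def by (rule leading_prod) (auto intro: leading_root_factor)
  then have "leading r (weyl_product r) (shift r + (\<Sum>(i, j)\<in>pairs r. eps i))"
    unfolding weyl_product_def by (intro leading_mult leading_single)
  moreover have "shift r + (\<Sum>(i, j)\<in>pairs r. eps i) = weyl_vector r"
  proof
    fix k
    have "(\<Sum>(i, j)\<in>pairs r. eps i) k = (\<Sum>q\<in>pairs r. if fst q = k then 1 else 0)"
      unfolding sum_fun_apply by (rule sum.cong) (auto simp: eps_def)
    also have "\<dots> = of_nat (card {q \<in> pairs r. fst q = k})"
      by (simp add: sum.If_cases Int_def)
    \<comment> \<open>The index k is the first entry of \<open>r - k\<close> pairs; together with
      the shift \<open>-(r - 1)/2\<close> this is the k-th coordinate of \<delta>.\<close>
    also have "{q \<in> pairs r. fst q = k} = (if k \<in> {1..r} then Pair k ` {k<..r} else {})"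
      by (auto simp: pairs_def)
    also have "card \<dots> = (if k \<in> {1..r} then r - k else 0)"
      by (simp add: card_image inj_on_def)
    finally show "(shift r + (\<Sum>(i, j)\<in>pairs r. eps i)) k = weyl_vector r k"
      by (auto simp: shift_def weyl_vector_apply of_nat_diff field_simps)
  qed
  ultimately show ?thesis by simp
qed

lemma keys_prod_closed:
  fixes f :: "'c \<Rightarrow> 'b::comm_monoid_add \<Rightarrow>\<^sub>0 'a::comm_ring_1"
  assumes "0 \<in> S" "\<And>a b. a \<in> S \<Longrightarrow> b \<in> S \<Longrightarrow> a + b \<in> S"
    and "finite A" "\<And>x. x \<in> A \<Longrightarrow> Poly_Mapping.keys (f x) \<subseteq> S"
  shows "Poly_Mapping.keys (prod f A) \<subseteq> S"
  using assms(3,4)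
proof (induction A)
  case (insert x F)
  then have *: "Poly_Mapping.keys (f x) \<subseteq> S" "Poly_Mapping.keys (prod f F) \<subseteq> S" by auto
  have "Poly_Mapping.keys (f x * prod f F) \<subseteq> S"
  proof
    fix \<mu> assume "\<mu> \<in> Poly_Mapping.keys (f x * prod f F)"
    then obtain a b where "\<mu> = a + b" "a \<in> Poly_Mapping.keys (f x)" "b \<in> Poly_Mapping.keys (prod f F)"
      by (rule keys_multE)
    then show "\<mu> \<in> S" using * assms(2) by auto
  qed
  then show ?case using insert.hyps by simp
qed (use assms(1) in auto)

text \<open>Vandermonde exponents are integral and the shift is constant on \<open>{1..r}\<close>.
  For even r the shift is half-integral, so integrality is claimed for differences of coordinates
  only.\<close>

lemma keys_dn:
  assumes "\<nu> \<in> Poly_Mapping.keys (weyl_product r :: weight \<Rightarrow>\<^sub>0 int)"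
  shows "supported r \<nu>" and "i \<in> {1..r} \<Longrightarrow> j \<in> {1..r} \<Longrightarrow> \<nu> i - \<nu> j \<in> \<int>"
proof -
  let ?S = "{\<mu>. supported r \<mu> \<and> (\<forall>i. \<mu> i \<in> \<int>)}"
  have "Poly_Mapping.keys (vandermonde r :: weight \<Rightarrow>\<^sub>0 int) \<subseteq> ?S"
    unfolding vandermonde_def
  proof (rule keys_prod_closed)
    fix q assume q: "q \<in> pairs r"
    obtain i j where ij: "q = (i, j)" by force
    have "Poly_Mapping.keys (monom1 (eps i) - monom1 (eps j) :: weight \<Rightarrow>\<^sub>0 int) \<subseteq> {eps i, eps j}"
      using keys_diff[of "monom1 (eps i) :: weight \<Rightarrow>\<^sub>0 int" "monom1 (eps j)"] by auto
    then show "Poly_Mapping.keys ((case q of (i, j) \<Rightarrow> monom1 (eps i) - monom1 (eps j)) :: weight \<Rightarrow>\<^sub>0 int) \<subseteq> ?S"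
      using q unfolding ij by (auto simp: pairs_def supported_def eps_def split: if_splits)
  qed (auto simp: supported_def)
  moreover obtain a b where ab: "\<nu> = a + b" "a \<in> Poly_Mapping.keys (monom1 (shift r) :: weight \<Rightarrow>\<^sub>0 int)"
    "b \<in> Poly_Mapping.keys (vandermonde r :: weight \<Rightarrow>\<^sub>0 int)"
    using assms unfolding weyl_product_def by (rule keys_multE)
  ultimately have "b \<in> ?S" "a = shift r" by auto
  then show "supported r \<nu>" and "i \<in> {1..r} \<Longrightarrow> j \<in> {1..r} \<Longrightarrow> \<nu> i - \<nu> j \<in> \<int>"
    using ab(1) by (auto simp: supported_def shift_def)
qed

lemma act_single: "act w (Poly_Mapping.single \<mu> c) = Poly_Mapping.single (weyl_act w \<mu>) c"
  by (rule poly_mapping_eqI)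
    (simp add: act_def single_of_int[symmetric] mult_single lookup_single del: single_of_int)

lemma act_diff: "act w (f - g) = act w f - act w g"
  by (simp add: act_def lin_diff)

lemma act_prod: "act w (prod f A) = (\<Prod>x\<in>A. act w (f x))"
proof -
  have "weyl_act w 0 = 0" by (simp add: weyl_act_def fun_eq_iff)
  then show ?thesis unfolding act_def by (intro lin_prod) (simp_all add: weyl_act_add mult_single)
qed

text \<open>The transposition of k and \<open>k + 1\<close> permutes the positive roots other than
  \<open>\<alpha>\<^sub>k\<close>, reverses the factor of \<open>\<alpha>\<^sub>k\<close> and fixes
  the shift.\<close>

lemma antisym_dn: "weyl_antisymmetric r (weyl_product r)"
proof (rule antisymI_adj)
  fix k assume k: "k \<in> {1..<r}"
  let ?s = "adj k"
  define fac :: "nat \<times> nat \<Rightarrow> (weight \<Rightarrow>\<^sub>0 int)" where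
    "fac = (\<lambda>(i, j). monom1 (eps i) - monom1 (eps j))"
  let ?R = "pairs r - {(k, k + 1)}"
  have kk: "(k, k + 1) \<in> pairs r" using k by (auto simp: pairs_def)
  have actf: "act ?s (fac (i, j)) = fac (?s i, ?s j)" for i j
    by (simp add: fac_def act_diff act_single weyl_act_eps)
  have bij: "bij_betw (map_prod ?s ?s) ?R ?R"
  proof (rule bij_betw_byWitness[where f' = "map_prod ?s ?s"])
    show "map_prod ?s ?s ` ?R \<subseteq> ?R" "map_prod ?s ?s ` ?R \<subseteq> ?R"
      using k by (auto simp: pairs_def transpose_def split: if_splits)
  qed auto
  have "act ?s (prod fac (pairs r)) = (\<Prod>q\<in>pairs r. fac (map_prod ?s ?s q))"
    unfolding act_prod by (rule prod.cong) (auto simp: actf)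
  also have "\<dots> = fac (k + 1, k) * (\<Prod>q\<in>?R. fac (map_prod ?s ?s q))"
    by (subst prod.remove[OF finite_pairs kk]) simp
  also have "(\<Prod>q\<in>?R. fac (map_prod ?s ?s q)) = prod fac ?R"
    by (rule prod.reindex_bij_betw[OF bij])
  also have "fac (k + 1, k) * prod fac ?R = - prod fac (pairs r)"
    by (subst prod.remove[OF finite_pairs kk]) (simp add: fac_def left_diff_distrib)
  finally have "act ?s (vandermonde r) = - vandermonde r"
    by (simp add: vandermonde_def fac_def)
  moreover have "weyl_act ?s (shift r) = shift r"
    using k by (auto simp: fun_eq_iff weyl_act_transpose shift_def transpose_def)
  ultimately show "act ?s (weyl_product r) = - weyl_product r"
    by (simp add: weyl_product_def act_mult act_single)
qed

text \<open>Otherwise \<open>d = \<delta> - \<kappa> \<noteq> 0\<close>, while \<open>\<delta> - s d\<close> is strictly dominant for every \<open>s \<ge> 0\<close>; the \<open>s\<close> that makes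
  it orthogonal to \<open>d\<close> contradicts positivity.\<close>

lemma strictdom_below_weyl_vector:
  assumes "strictdom r \<kappa>" "supported r \<kappa>" "root_positive r (weyl_vector r - \<kappa>)"
    and int: "\<And>k. k \<in> {1..<r} \<Longrightarrow> \<kappa> k - \<kappa> (k + 1) \<in> \<int>"
  shows "\<kappa> = weyl_vector r"
proof (rule ccontr)
  let ?\<delta> = "weyl_vector r" let ?d = "weyl_vector r - \<kappa>"
  assume "\<kappa> \<noteq> ?\<delta>"
  then have d: "?d \<noteq> 0" by auto
  have dd: "wform r ?d ?d > 0"
    by (rule wform_self_pos) (use d assms supported_diff supported_weyl_vector in auto)
  define s where "s = wform r ?d ?\<delta> / wform r ?d ?d"
  have s: "s > 0" using pos_strict[OF assms(3) d strictdom_weyl_vector] dd by (simp add: s_def)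
  define \<eta> where "\<eta> = ?\<delta> - wscale s ?d"
  have "strictdom r \<eta>"
    unfolding strictdom_def
  proof
    fix k assume k: "k \<in> {1..<r}"
    have "\<kappa> k - \<kappa> (k + 1) > 0" using assms(1) k by (simp add: strictdom_def)
    then have "\<kappa> k - \<kappa> (k + 1) \<ge> 1"
      using int[OF k] by (metis Ints_cases of_int_0_less_iff of_int_1_le_iff zless_imp_add1_zle add_0)
    moreover have "?\<delta> k - ?\<delta> (k + 1) = 1"
      using k by (simp add: weyl_vector_apply field_simps)
    \<comment> \<open>All gaps of \<delta> are 1 and those of \<kappa> are positive integers, so
      moving from \<delta> in the direction of \<kappa>, however far, never shrinks a gap.\<close>
    ultimately have "s * (?\<delta> k - ?\<delta> (k + 1) - (\<kappa> k - \<kappa> (k + 1))) \<le> 0"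
      using s by (intro mult_nonneg_nonpos) auto
    then show "\<eta> (k + 1) < \<eta> k"
      using \<open>?\<delta> k - ?\<delta> (k + 1) = 1\<close> by (simp add: \<eta>_def wscale_def algebra_simps)
  qed
  from pos_strict[OF assms(3) d this] have "wform r ?d \<eta> > 0" .
  moreover have "wform r ?d \<eta> = wform r ?d ?\<delta> - s * wform r ?d ?d"
    unfolding \<eta>_def by (simp only: wform_diff_right[of r ?d ?\<delta> "wscale s ?d"] wform_wscale_right[of r ?d s ?d])
  moreover have "\<dots> = 0" using dd by (simp add: s_def)
  ultimately show False by linarith
qed

text \<open>Both sides are antisymmetric, and by \<open>strictdom_below_weyl_vector\<close> the
  product has \<delta> as its only strictly dominant exponent.\<close>

lemma dn_eq_alt: "weyl_product r = alt r (weyl_vector r)"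
proof (rule antisym_eqI[OF antisym_dn antisym_alt])
  fix \<kappa> assume k: "strictdom r \<kappa>"
  have "lk (weyl_product r) \<kappa> = (0::int)" if "\<kappa> \<noteq> weyl_vector r"
  proof (rule ccontr)
    assume "lk (weyl_product r) \<kappa> \<noteq> (0::int)"
    then have "\<kappa> \<in> Poly_Mapping.keys (weyl_product r :: weight \<Rightarrow>\<^sub>0 int)" by (simp add: in_keys_iff)
    then have "\<kappa> = weyl_vector r"
      using keys_dn[of \<kappa> r] leading_dn[of r] k
      by (intro strictdom_below_weyl_vector) (auto simp: leading_def)
    then show False using that by simp
  qed
  then show "lk (weyl_product r) \<kappa> = lk (alt r (weyl_vector r)) \<kappa>"
    using leading_dn[of r] by (auto simp: lookup_alt_strictdom[OF strictdom_weyl_vector k] leading_def)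
qed

lemma weyl_denominator_eq_alt: "weyl_denominator r = alt r (weyl_vector r)"
  unfolding weyl_denominator_def alt_def
  by (rule sum.cong) (auto simp: minus_one_power_coxeter_length)

lemma keys_alt:
  assumes "\<mu> \<in> Poly_Mapping.keys (alt r \<kappa>)"
  obtains w where "w permutes {1..r}" "\<mu> = weyl_act w \<kappa>"
  using assms keys_sum[of "\<lambda>w. Poly_Mapping.single (weyl_act w \<kappa>) (sign w)" "{w. w permutes {1..r}}"]
  unfolding alt_def by auto

text \<open>Expanded as an alternating sum, the product has only exponents conjugate to \<delta>,
  all of the same norm.\<close>

lemma laplacian_dn:
  "(\<Sum>k=1..r. weight_deriv k (weight_deriv k (weyl_product r))) = Cst (of_rat (wnormsq r (weyl_vector r))) * weyl_product r"
proof (rule poly_mapping_eqI)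
  fix \<mu>
  have lkd: "lk (weyl_product r :: weight \<Rightarrow>\<^sub>0 complex) \<mu> = of_int (lk (weyl_product r) \<mu>)"
    using lookup_cmap[of "weyl_product r" \<mu>] by (simp add: cmap_dn)
  have "lk (\<Sum>k=1..r. weight_deriv k (weight_deriv k (weyl_product r))) \<mu> = of_rat (wnormsq r \<mu>) * lk (weyl_product r) \<mu>"
    by (simp add: lookup_sum lookup_D wnormsq_def wform_def of_rat_sum of_rat_mult sum_distrib_right mult.assoc)
  also have "\<dots> = of_rat (wnormsq r (weyl_vector r)) * lk (weyl_product r) \<mu>"
  proof (cases "\<mu> \<in> Poly_Mapping.keys (weyl_product r :: weight \<Rightarrow>\<^sub>0 int)")
    case True
    then obtain w where "w permutes {1..r}" "\<mu> = weyl_act w (weyl_vector r)"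
      unfolding dn_eq_alt by (rule keys_alt)
    then show ?thesis by (simp add: wnormsq_weyl_act)
  qed (simp add: lkd in_keys_iff)
  finally show "lk (\<Sum>k=1..r. weight_deriv k (weight_deriv k (weyl_product r))) \<mu> = lk (Cst (of_rat (wnormsq r (weyl_vector r))) * weyl_product r) \<mu>"
    by (simp add: lookup_Cst_mult)
qed

section \<open>Weyl's formula from a Casimir identity\<close>

text \<open>Stated for any group algebra element with the listed properties, so that it serves
  characters of modules, where \<open>T\<close> collects traces, as well as the explicit weight sum
  of the symmetric power. The scalar c may be arbitrary: comparison with the exponent
  \<open>\<nu> + \<delta>\<close> eliminates it.\<close>

theorem character_times_denominator:
  fixes f :: "weight \<Rightarrow>\<^sub>0 int"
  assumes T: "\<And>i j. (i, j) \<in> pairs r \<Longrightarrow>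
      (monom1 (eps i) - monom1 (eps j)) * T i j = monom1 (eps j) * (weight_deriv i (cmap f) - weight_deriv j (cmap f))"
    and cas: "Cst c * cmap f = (\<Sum>k=1..r. weight_deriv k (weight_deriv k (cmap f)))
       + (\<Sum>(i, j)\<in>pairs r. weight_deriv i (cmap f) - weight_deriv j (cmap f) + 2 * T i j)"
    and 0: "\<And>\<mu>. \<mu> \<in> Poly_Mapping.keys f \<Longrightarrow> (\<Sum>i=1..r. \<mu> i) = 0"
    and supp: "\<And>\<mu>. \<mu> \<in> Poly_Mapping.keys f \<Longrightarrow> supported r \<mu>"
    and sym: "weyl_symmetric r f" and lead: "leading r f \<nu>"
    and dom: "strictdom r (\<nu> + weyl_vector r)"
  shows "f * weyl_product r = alt r (\<nu> + weyl_vector r)"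
proof -
  let ?G = "f * weyl_product r" let ?\<kappa>0 = "\<nu> + weyl_vector r"
  have keysf: "\<mu> \<in> Poly_Mapping.keys (cmap f) \<longleftrightarrow> \<mu> \<in> Poly_Mapping.keys f" for \<mu>
    by (simp add: in_keys_iff lookup_cmap)
  have lapl: "(\<Sum>k=1..r. weight_deriv k (weight_deriv k (cmap f * weyl_product r))) = Cst (c + of_rat (wnormsq r (weyl_vector r))) * (cmap f * weyl_product r)"
    by (rule laplacian_mult_dn[where T = T]) (use T cas 0 keysf laplacian_dn in auto)
  have G: "cmap f * weyl_product r = cmap ?G" by (simp add: cmap_mult cmap_dn)
  have norm: "(of_rat (wnormsq r \<mu>) :: complex) = c + of_rat (wnormsq r (weyl_vector r))"
    if "\<mu> \<in> Poly_Mapping.keys ?G" for \<mu>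
  proof -
    have "lk (\<Sum>k=1..r. weight_deriv k (weight_deriv k (cmap ?G))) \<mu> = of_rat (wnormsq r \<mu>) * lk (cmap ?G) \<mu>"
      by (simp add: lookup_sum lookup_D wnormsq_def wform_def of_rat_sum of_rat_mult sum_distrib_right mult.assoc)
    then show ?thesis
      using lapl that unfolding G by (simp add: lookup_Cst_mult lookup_cmap in_keys_iff)
  qed
  have leadG: "leading r ?G ?\<kappa>0" by (rule leading_mult[OF lead leading_dn])
  then have k0: "?\<kappa>0 \<in> Poly_Mapping.keys ?G" by (simp add: leading_def in_keys_iff)
  have anti: "weyl_antisymmetric r ?G" by (rule antisym_sym_mult[OF sym antisym_dn])
  show ?thesis
  proof (rule antisym_eqI[OF anti antisym_alt])
    fix \<kappa> assume k: "strictdom r \<kappa>"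
    have "lk ?G \<kappa> = 0" if ne: "\<kappa> \<noteq> ?\<kappa>0"
    proof (rule ccontr)
      assume "lk ?G \<kappa> \<noteq> 0"
      then have kk: "\<kappa> \<in> Poly_Mapping.keys ?G" by (simp add: in_keys_iff)
      have "(of_rat (wnormsq r \<kappa>) :: complex) = of_rat (wnormsq r ?\<kappa>0)"
        using norm[OF kk] norm[OF k0] by simp
      then have "wnormsq r \<kappa> = wnormsq r ?\<kappa>0" by simp
      \<comment> \<open>The difference of the two squared norms is this pairing of a nonzero
        positive element with a sum of two strictly dominant weights.\<close>
      moreover have "wform r (?\<kappa>0 - \<kappa>) (?\<kappa>0 + \<kappa>) > 0"
      proof (rule pos_strict)
        show "root_positive r (?\<kappa>0 - \<kappa>)" using leadG kk by (simp add: leading_def)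
        show "strictdom r (?\<kappa>0 + \<kappa>)" using dom k by (auto simp: strictdom_def intro: add_strict_mono)
      qed (use ne in auto)
      then have "wnormsq r ?\<kappa>0 - wnormsq r \<kappa> > 0"
        unfolding wnormsq_diff .
      ultimately show False by simp
    qed
    then show "lk ?G \<kappa> = lk (alt r ?\<kappa>0) \<kappa>"
      using leadG by (auto simp: lookup_alt_strictdom[OF dom k] leading_def)
  qed
qed

section \<open>Cancelling the denominator and its quantum dimension\<close>

text \<open>Among the exponents of \<open>f - g\<close> choose one with maximal pairing with
  \<delta>. Its sum with \<delta> arises in the product from this pair only, and the leading
  coefficient of the denominator is 1.\<close>

lemma mult_dn_cancel:
  assumes "f * weyl_product r = (g :: weight \<Rightarrow>\<^sub>0 int) * weyl_product r"
  shows "f = g"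
proof (rule ccontr)
  assume "f \<noteq> g"
  define h where "h = f - g"
  have h: "h * weyl_product r = 0" "h \<noteq> 0" using assms \<open>f \<noteq> g\<close> by (auto simp: h_def left_diff_distrib)
  let ?l = "\<lambda>\<mu>. wform r \<mu> (weyl_vector r)"
  have ne: "Poly_Mapping.keys h \<noteq> {}" using h(2) by simp
  obtain \<mu> where m: "\<mu> \<in> Poly_Mapping.keys h" "\<And>a. a \<in> Poly_Mapping.keys h \<Longrightarrow> ?l a \<le> ?l \<mu>"
  proof -
    have "Max (?l ` Poly_Mapping.keys h) \<in> ?l ` Poly_Mapping.keys h" using ne by (intro Max_in) auto
    then obtain \<mu> where "\<mu> \<in> Poly_Mapping.keys h" "?l \<mu> = Max (?l ` Poly_Mapping.keys h)" by auto
    then show ?thesis using that[of \<mu>] by auto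
  qed
  have "lk (h * weyl_product r) (\<mu> + weyl_vector r) = lk h \<mu> * lk (weyl_product r) (weyl_vector r)"
  proof (rule lookup_mult_unique)
    fix a b assume *: "a \<in> Poly_Mapping.keys h" "b \<in> Poly_Mapping.keys (weyl_product r :: weight \<Rightarrow>\<^sub>0 int)"
      "a + b = \<mu> + weyl_vector r"
    have "root_positive r (weyl_vector r - b)" using leading_dn[of r] *(2) by (simp add: leading_def)
    moreover have "?l (weyl_vector r - b) = ?l a - ?l \<mu>"
      using arg_cong[OF *(3), of ?l] by (simp add: wform_add_left wform_diff_left)
    then have "\<not> ?l (weyl_vector r - b) > 0" using m(2)[OF *(1)] by simp
    ultimately have "weyl_vector r - b = 0"
      using pos_strict[OF _ _ strictdom_weyl_vector[of r], of "weyl_vector r - b"] by metis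
    then have "b = weyl_vector r" by (simp only: eq_iff_diff_eq_0[symmetric])
    then show "a = \<mu> \<and> b = weyl_vector r" using *(3) by (simp only: add_right_cancel)
  qed
  then show False using h(1) m(1) leading_dn[of r] by (simp add: leading_def in_keys_iff)
qed

lemma qdim_eq_lin: "qdim r f = lin (\<lambda>\<mu>. qpow (wform r \<mu> (weyl_vector r))) f"
  by (simp add: qdim_def lin_def)

lemma qpow_add: "qpow (a + b) = qpow a * qpow b"
  by (simp add: qpow_def mult_single)

lemma qdim_mult: "qdim r (f * g) = qdim r f * qdim r g"
  unfolding qdim_eq_lin by (rule lin_mult) (simp add: wform_add_left qpow_add)

text \<open>\<delta> alone maximizes the pairing with \<delta> among the exponents of the
  denominator, so the top power of q survives. This is what permits division by the quantum
  dimension.\<close>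

lemma qdim_dn_nonzero: "qdim r (weyl_product r) \<noteq> 0"
proof -
  let ?l = "\<lambda>\<mu>. wform r \<mu> (weyl_vector r)"
  have oi: "lk (of_int c * qpow a) b = (c when a = b)" for c a b
    by (simp add: lookup_of_int_mult qpow_def lookup_single when_def)
  have w: "weyl_vector r \<in> Poly_Mapping.keys (weyl_product r :: weight \<Rightarrow>\<^sub>0 int)"
    using leading_dn[of r] by (simp add: leading_def in_keys_iff)
  have "?l b \<noteq> ?l (weyl_vector r)" if "b \<in> Poly_Mapping.keys (weyl_product r :: weight \<Rightarrow>\<^sub>0 int)" "b \<noteq> weyl_vector r" for b
  proof -
    have "weyl_vector r - b \<noteq> 0" using that(2) by (metis eq_iff_diff_eq_0)
    moreover have "root_positive r (weyl_vector r - b)" using leading_dn[of r] that(1) by (simp add: leading_def)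
    ultimately have "?l (weyl_vector r - b) > 0" by (intro pos_strict[OF _ _ strictdom_weyl_vector])
    then show ?thesis by (simp add: wform_diff_left)
  qed
  then have "lk (qdim r (weyl_product r)) (?l (weyl_vector r)) =
     (\<Sum>\<mu>\<in>Poly_Mapping.keys (weyl_product r :: weight \<Rightarrow>\<^sub>0 int). if \<mu> = weyl_vector r then lk (weyl_product r) \<mu> else 0)"
    unfolding qdim_def lookup_sum by (intro sum.cong refl) (auto simp: oi when_def)
  also have "\<dots> = 1" using w leading_dn[of r] by (simp add: leading_def sum.delta)
  finally show ?thesis by auto
qed

subsection \<open>Linear algebra in sequence space\<close>

global_interpretation csmap: vector_space_pair cscale cscale
  by unfold_locales

abbreviation clinear :: "(cseq \<Rightarrow> cseq) \<Rightarrow> bool" where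
  "clinear \<equiv> Vector_Spaces.linear cscale cscale"

lemma clinear_simps:
  assumes "clinear f"
  shows "f (u + v) = f u + f v" "f (u - v) = f u - f v" "f (cscale c u) = cscale c (f u)" "f 0 = 0"
    "f (sum h A) = (\<Sum>x\<in>A. f (h x))" "f (- u) = - f u"
  using csmap.linear_add[OF assms] csmap.linear_diff[OF assms] csmap.linear_scale[OF assms]
    csmap.linear_0[OF assms] csmap.linear_sum[OF assms] csmap.linear_neg[OF assms] by auto

lemma clinearI:
  "(\<And>u v. f (u + v) = f u + f v) \<Longrightarrow> (\<And>c u. f (cscale c u) = cscale c (f u)) \<Longrightarrow> clinear f"
  by unfold_locales auto

text \<open>A trace on the span of B, meaningful when f carries B into that span; f itself is a map
  of the whole sequence space.\<close>

definition tr :: "cseq set \<Rightarrow> (cseq \<Rightarrow> cseq) \<Rightarrow> complex" where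
  "tr B f = (\<Sum>b\<in>B. cseq.representation B (f b) b)"

lemma tr_cong: "(\<And>b. b \<in> B \<Longrightarrow> f b = g b) \<Longrightarrow> tr B f = tr B g"
  by (simp add: tr_def)

lemma tr_add:
  assumes "cseq.independent B" "\<And>b. b \<in> B \<Longrightarrow> f b \<in> cseq.span B" "\<And>b. b \<in> B \<Longrightarrow> g b \<in> cseq.span B"
  shows "tr B (\<lambda>v. f v + g v) = tr B f + tr B g"
  using assms by (simp add: tr_def cseq.representation_add sum.distrib)

lemma tr_sum:
  assumes "cseq.independent B" "\<And>x b. x \<in> A \<Longrightarrow> b \<in> B \<Longrightarrow> f x b \<in> cseq.span B"
  shows "tr B (\<lambda>v. \<Sum>x\<in>A. f x v) = (\<Sum>x\<in>A. tr B (f x))"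
proof -
  have "tr B (\<lambda>v. \<Sum>x\<in>A. f x v) = (\<Sum>b\<in>B. \<Sum>x\<in>A. cseq.representation B (f x b) b)"
    unfolding tr_def using assms by (intro sum.cong refl) (simp add: cseq.representation_sum)
  then show ?thesis unfolding tr_def by (subst sum.swap) simp
qed

lemma tr_scale:
  assumes "cseq.independent B" "\<And>b. b \<in> B \<Longrightarrow> f b \<in> cseq.span B"
  shows "tr B (\<lambda>v. cscale c (f v)) = c * tr B f"
  using assms by (simp add: tr_def cseq.representation_scale sum_distrib_left)

lemma tr_ident:
  assumes "cseq.independent B"
  shows "tr B (\<lambda>v. v) = of_nat (card B)"
  using assms by (simp add: tr_def cseq.representation_basis)

text \<open>The two spans may be different spaces: the application is to a root operator between two
  weight spaces and the opposite operator back.\<close>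

lemma tr_cyclic:
  assumes B: "cseq.independent B" "finite B" and B': "cseq.independent B'" "finite B'"
    and f: "clinear f" "\<And>b. b \<in> B \<Longrightarrow> f b \<in> cseq.span B'"
    and g: "clinear g" "\<And>b. b \<in> B' \<Longrightarrow> g b \<in> cseq.span B"
  shows "tr B (\<lambda>v. g (f v)) = tr B' (\<lambda>v. f (g v))"
proof -
  have expand: "tr C (\<lambda>v. k (h v)) = (\<Sum>b\<in>C. \<Sum>b'\<in>C'. cseq.representation C' (h b) b' * cseq.representation C (k b') b)"
    if C: "cseq.independent C" "finite C" "cseq.independent C'" "finite C'"
      "\<And>b. b \<in> C \<Longrightarrow> h b \<in> cseq.span C'" "clinear k" "\<And>b. b \<in> C' \<Longrightarrow> k b \<in> cseq.span C"
    for C C' k h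
    unfolding tr_def
  proof (rule sum.cong[OF refl])
    fix b assume b: "b \<in> C"
    have "h b = (\<Sum>b'\<in>C'. cscale (cseq.representation C' (h b) b') b')"
      using C b by (intro cseq.sum_representation_eq[symmetric]) auto
    then have "k (h b) = (\<Sum>b'\<in>C'. cscale (cseq.representation C' (h b) b') (k b'))"
      by (metis (no_types, lifting) clinear_simps(3,5)[OF C(6)] sum.cong)
    then have "cseq.representation C (k (h b)) b
        = (\<Sum>b'\<in>C'. cseq.representation C (cscale (cseq.representation C' (h b) b') (k b')) b)"
      using C by (simp add: cseq.representation_sum cseq.span_scale)
    then show "cseq.representation C (k (h b)) b
        = (\<Sum>b'\<in>C'. cseq.representation C' (h b) b' * cseq.representation C (k b') b)"
      using C by (simp add: cseq.representation_scale)
  qed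
  show ?thesis
    using expand[OF B B' f(2) g] expand[OF B' B g(2) f] by (simp add: sum.swap[of _ B B'] mult.commute)
qed

lemma finite_basis_exists:
  assumes "cseq.subspace W" "W \<subseteq> cseq.span T" "finite T"
  shows "\<exists>B. finite B \<and> cseq.independent B \<and> cseq.span B = W \<and> card B = cseq.dim W"
proof -
  obtain B where B: "B \<subseteq> W" "cseq.independent B" "W \<subseteq> cseq.span B" "card B = cseq.dim W"
    using cseq.basis_exists[of W] by blast
  moreover have "finite B" using cseq.independent_span_bound[OF assms(3) B(2)] B(1) assms(2) by auto
  moreover have "cseq.span B = W" using B assms(1) by (metis cseq.span_minimal subset_antisym)
  ultimately show ?thesis by blast
qed

lemma dim_le_injective:
  assumes W: "cseq.subspace W" "W \<subseteq> cseq.span T" and W': "cseq.subspace W'" "W' \<subseteq> cseq.span T" "finite T"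
    and f: "clinear f" "\<And>v. v \<in> W \<Longrightarrow> f v \<in> W'" "\<And>v. v \<in> W \<Longrightarrow> f v = 0 \<Longrightarrow> v = 0"
  shows "cseq.dim W \<le> cseq.dim W'"
proof -
  obtain B where B: "finite B" "cseq.independent B" "cseq.span B = W" "card B = cseq.dim W"
    using finite_basis_exists[OF W W'(3)] by blast
  obtain B' where B': "finite B'" "cseq.independent B'" "cseq.span B' = W'" "card B' = cseq.dim W'"
    using finite_basis_exists[OF W'] by blast
  have inj: "inj_on f (cseq.span B)"
  proof (rule inj_onI)
    fix u v assume "u \<in> cseq.span B" "v \<in> cseq.span B" "f u = f v"
    then show "u = v"
      using f(3)[of "u - v"] cseq.span_diff[of u B v] B(3) by (simp add: clinear_simps[OF f(1)])
  qed
  then have "cseq.independent (f ` B)"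
    by (rule csmap.linear_independent_injective_image[OF f(1) B(2)])
  moreover have "f ` B \<subseteq> cseq.span B'"
    using f(2) B(3) B'(3) cseq.span_superset[of B] by auto
  ultimately have "card (f ` B) \<le> card B'"
    using cseq.independent_span_bound[OF B'(1)] by blast
  moreover have "card (f ` B) = card B"
    by (rule card_image) (rule inj_on_subset[OF inj cseq.span_superset])
  ultimately show ?thesis using B(4) B'(4) by simp
qed

subsection \<open>Representations by matrix units\<close>

text \<open>Monomials in lowering operators applied to v, each recorded with its weight. A pair
  \<open>(j, i)\<close> has \<open>j < i\<close>, so \<open>F i j\<close> here is a lowering
  operator.\<close>

inductive hword for r :: nat and F :: "nat \<Rightarrow> nat \<Rightarrow> cseq \<Rightarrow> cseq" and \<nu> :: weight and v :: cseq where
  base: "hword r F \<nu> v \<nu> v"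
| step: "hword r F \<nu> v \<kappa> u \<Longrightarrow> (j, i) \<in> pairs r \<Longrightarrow> hword r F \<nu> v (\<kappa> + (eps i - eps j)) (F i j u)"

text \<open>\<open>F i j\<close> is the action of the matrix unit \<open>E\<^sub>i\<^sub>j\<close>, up to a scalar on the diagonal. It is required to be
  linear on the whole sequence space, whereas the bracket relation is required on \<open>V\<close> only.\<close>

locale gl_rep =
  fixes r :: nat and V :: "cseq set" and F :: "nat \<Rightarrow> nat \<Rightarrow> cseq \<Rightarrow> cseq"
  assumes subspace_V: "cseq.subspace V"
    and lin_F: "clinear (F i j)"
    and F_V: "i \<in> {1..r} \<Longrightarrow> j \<in> {1..r} \<Longrightarrow> v \<in> V \<Longrightarrow> F i j v \<in> V"
    and comm: "i \<in> {1..r} \<Longrightarrow> j \<in> {1..r} \<Longrightarrow> k \<in> {1..r} \<Longrightarrow> l \<in> {1..r} \<Longrightarrow> v \<in> V \<Longrightarrow>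
      F i j (F k l v) = F k l (F i j v) + ((if j = k then F i l v else 0) - (if i = l then F k j v else 0))"
begin

lemmas F_simps = clinear_simps[OF lin_F]

text \<open>Weights are taken with respect to all r diagonal operators, as for
  \<open>gl\<^sub>r\<close>. Only the coordinates in \<open>{1..r}\<close> are tested, hence the
  recurring condition \<open>supported\<close>.\<close>

definition wsp :: "weight \<Rightarrow> cseq set" where
  "wsp \<mu> = {v \<in> V. \<forall>i\<in>{1..r}. F i i v = cscale (of_rat (\<mu> i)) v}"

lemma wspD: "v \<in> wsp \<mu> \<Longrightarrow> v \<in> V" "v \<in> wsp \<mu> \<Longrightarrow> i \<in> {1..r} \<Longrightarrow> F i i v = cscale (of_rat (\<mu> i)) v"
  by (auto simp: wsp_def)

lemma subspace_wsp: "cseq.subspace (wsp \<mu>)"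
  unfolding wsp_def cseq.subspace_def
  using subspace_V by (auto simp: F_simps cseq.scale_right_distrib cseq.subspace_def cseq.scale_left_commute)

lemma F_wsp:
  assumes ij: "i \<in> {1..r}" "j \<in> {1..r}" and v: "v \<in> wsp \<mu>"
  shows "F i j v \<in> wsp (\<mu> + (eps i - eps j))"
proof -
  have "F k k (F i j v) = cscale (of_rat ((\<mu> + (eps i - eps j)) k)) (F i j v)" if k: "k \<in> {1..r}" for k
  proof -
    have "F k k (F i j v) = F i j (cscale (of_rat (\<mu> k)) v) + ((if k = i then F k j v else 0) - (if k = j then F i k v else 0))"
      using comm[OF k k ij] wspD[OF v] k by simp
    then show ?thesis
      by (auto simp: F_simps eps_def cseq.scale_left_distrib cseq.scale_left_diff_distrib of_rat_add of_rat_diff)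
  qed
  then show ?thesis using F_V[OF ij wspD(1)[OF v]] by (simp add: wsp_def)
qed

text \<open>The case \<open>U = {0}\<close> is the independence of weight spaces.\<close>

lemma weight_components:
  assumes U: "cseq.subspace U" "\<And>i v. i \<in> {1..r} \<Longrightarrow> v \<in> U \<Longrightarrow> F i i v \<in> U"
    and "finite K" "\<And>\<kappa>. \<kappa> \<in> K \<Longrightarrow> supported r \<kappa>" "\<And>\<kappa>. \<kappa> \<in> K \<Longrightarrow> u \<kappa> \<in> wsp \<kappa>" "(\<Sum>\<kappa>\<in>K. u \<kappa>) \<in> U"
    and "\<kappa> \<in> K"
  shows "u \<kappa> \<in> U"
  using assms(3-7)
proof (induction K arbitrary: u \<kappa>)
  case (insert \<kappa>0 K)
  have *: "u \<kappa>1 \<in> U" if k1: "\<kappa>1 \<in> K" for \<kappa>1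
  proof -
    have "\<kappa>1 \<noteq> \<kappa>0" using k1 insert by auto
    then obtain i where i: "\<kappa>1 i \<noteq> \<kappa>0 i" by (auto simp: fun_eq_iff)
    then have ir: "i \<in> {1..r}" using insert.prems(1)[of \<kappa>1] insert.prems(1)[of \<kappa>0] k1
      unfolding supported_def by (metis insertCI)
    let ?s = "\<Sum>\<kappa>\<in>insert \<kappa>0 K. u \<kappa>"
    let ?u = "\<lambda>\<kappa>. cscale (of_rat (\<kappa> i - \<kappa>0 i)) (u \<kappa>)"
    \<comment> \<open>Applying \<open>F i i\<close> minus its eigenvalue at \<open>\<kappa>0\<close>
      deletes that component and rescales the others; i is chosen so that the factor at
      \<open>\<kappa>1\<close> is nonzero.\<close>
    have "F i i ?s - cscale (of_rat (\<kappa>0 i)) ?s = (\<Sum>\<kappa>\<in>insert \<kappa>0 K. ?u \<kappa>)"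
      unfolding F_simps cseq.scale_sum_right sum_subtractf[symmetric]
      by (rule sum.cong[OF refl])
         (simp add: wspD(2)[OF insert.prems(2) ir] cseq.scale_left_diff_distrib of_rat_diff)
    also have "\<dots> = (\<Sum>\<kappa>\<in>K. ?u \<kappa>)"
      using insert.hyps by simp
    finally have "(\<Sum>\<kappa>\<in>K. ?u \<kappa>) \<in> U"
      using insert.prems(3) U by (metis (no_types, lifting) cseq.subspace_diff cseq.subspace_scale ir)
    moreover have "?u \<kappa> \<in> wsp \<kappa>" if "\<kappa> \<in> K" for \<kappa>
      using insert.prems(2) that by (intro cseq.subspace_scale[OF subspace_wsp]) auto
    ultimately have "?u \<kappa>1 \<in> U"
      using insert.IH[of ?u \<kappa>1] insert.prems(1) k1 by auto
    then have "cscale (inverse (of_rat (\<kappa>1 i - \<kappa>0 i))) (?u \<kappa>1) \<in> U"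
      by (rule cseq.subspace_scale[OF U(1)])
    then show ?thesis using i by simp
  qed
  show ?case
  proof (cases "\<kappa> = \<kappa>0")
    case True
    have "(\<Sum>\<kappa>\<in>K. u \<kappa>) \<in> U"
      by (rule cseq.subspace_sum[OF U(1)]) (rule *)
    then have "(\<Sum>\<kappa>\<in>insert \<kappa>0 K. u \<kappa>) - (\<Sum>\<kappa>\<in>K. u \<kappa>) \<in> U"
      by (rule cseq.subspace_diff[OF U(1) insert.prems(3)])
    moreover have "(\<Sum>\<kappa>\<in>insert \<kappa>0 K. u \<kappa>) - (\<Sum>\<kappa>\<in>K. u \<kappa>) = u \<kappa>0"
      unfolding sum.insert[OF insert.hyps] by (rule add_diff_cancel_right')
    ultimately show ?thesis using True by simp
  qed (use * insert.prems in auto)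
qed simp

lemma weight_independent:
  assumes "finite K" "\<And>\<kappa>. \<kappa> \<in> K \<Longrightarrow> supported r \<kappa>" "\<And>\<kappa>. \<kappa> \<in> K \<Longrightarrow> u \<kappa> \<in> wsp \<kappa>" "(\<Sum>\<kappa>\<in>K. u \<kappa>) = 0" "\<kappa> \<in> K"
  shows "u \<kappa> = 0"
  using weight_components[of "{0}" K u \<kappa>] assms by (auto simp: F_simps cseq.subspace_single_0)

end

subsection \<open>Highest weight representations\<close>

locale hw_vector = gl_rep +
  fixes \<nu> :: weight and v0 :: cseq
  assumes v0: "v0 \<in> wsp \<nu>" "v0 \<noteq> 0"
    and supp_\<nu>: "supported r \<nu>"
    and killed: "(i, j) \<in> pairs r \<Longrightarrow> F i j v0 = 0"
begin

abbreviation "hw \<equiv> hword r F \<nu> v0"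
definition "H = {u. \<exists>\<kappa>. hw \<kappa> u}"

lemma hw_wsp: "hw \<kappa> u \<Longrightarrow> u \<in> wsp \<kappa>"
proof (induction rule: hword.induct)
  case (step \<kappa> u j i)
  then show "F i j u \<in> wsp (\<kappa> + (eps i - eps j))" by (intro F_wsp) (auto simp: pairs_def)
qed (rule v0)

lemma hw_supported: "hw \<kappa> u \<Longrightarrow> supported r \<kappa>"
proof (induction rule: hword.induct)
  case (step \<kappa> u j i)
  then show "supported r (\<kappa> + (eps i - eps j))"
    by (intro supported_add supported_diff supported_eps) (auto simp: pairs_def)
qed (rule supp_\<nu>)

lemma hw_sum: "hw \<kappa> u \<Longrightarrow> (\<Sum>i=1..r. \<kappa> i) = (\<Sum>i=1..r. \<nu> i)"
  by (induction rule: hword.induct) (auto simp: sum.distrib sum_subtractf eps_def pairs_def)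

lemma hw_Ints: "hw \<kappa> u \<Longrightarrow> \<nu> k - \<kappa> k \<in> \<int>"
proof (induction rule: hword.induct)
  case (step \<kappa> u j i)
  have "eps i k - eps j k \<in> \<int>" by (auto simp: eps_def)
  then have "(\<nu> k - \<kappa> k) - (eps i k - eps j k) \<in> \<int>" using step.IH by (rule Ints_diff[rotated])
  then show ?case by (simp add: algebra_simps)
qed simp

text \<open>Every lowering step subtracts a positive root, so no word but the empty one returns to
  \<nu>. The second conjunct is the source of multiplicity one for the highest weight.\<close>

lemma hw_pos: "hw \<kappa> u \<Longrightarrow> root_positive r (\<nu> - \<kappa>) \<and> (\<kappa> = \<nu> \<longrightarrow> u = v0)"
proof (induction rule: hword.induct)
  case base
  show "root_positive r (\<nu> - \<nu>) \<and> (\<nu> = \<nu> \<longrightarrow> v0 = v0)" by (simp add: pos_0)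
next
  case (step \<kappa> u j i)
  have eq: "\<nu> - (\<kappa> + (eps i - eps j)) = (\<nu> - \<kappa>) + (eps j - eps i)" by simp
  have "eps j \<noteq> eps i" using step(2) by (auto simp: eps_def fun_eq_iff pairs_def)
  then have "\<nu> \<noteq> \<kappa> + (eps i - eps j)"
    using pos_add_eq_0[of r "\<nu> - \<kappa>" "eps j - eps i"] step pos_root[OF step(2)] eq by auto
  moreover have "root_positive r (\<nu> - (\<kappa> + (eps i - eps j)))"
    unfolding eq using conjunct1[OF step.IH] pos_root[OF step(2)] by (rule pos_add)
  ultimately show "root_positive r (\<nu> - (\<kappa> + (eps i - eps j))) \<and> (\<kappa> + (eps i - eps j) = \<nu> \<longrightarrow> F i j u = v0)"
    by auto
qed

lemma H_V: "H \<subseteq> V"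
  using hw_wsp wspD(1) by (auto simp: H_def)

lemma span_H_V: "cseq.span H \<subseteq> V"
  by (rule cseq.span_minimal[OF H_V subspace_V])

lemma F_span_lower:
  assumes "u \<in> cseq.span H" "(j, i) \<in> pairs r"
  shows "F i j u \<in> cseq.span H"
  using assms(1)
proof (induction rule: cseq.span_induct_alt)
  case base
  show "F i j 0 \<in> cseq.span H" by (simp add: F_simps cseq.span_zero)
next
  case (step c x y)
  obtain \<kappa> where "hw \<kappa> x" using step(1) unfolding H_def by blast
  then have "F i j x \<in> H" unfolding H_def by (blast intro: hword.step[OF _ assms(2)])
  then show "F i j (cscale c x + y) \<in> cseq.span H"
    unfolding F_simps by (intro cseq.span_add cseq.span_scale step(2) cseq.span_base)
qed

text \<open>\<open>F k l\<close> is moved past the outermost lowering operator of a word. The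
  commutator consists of other operators applied to the shorter word, which is why the induction
  runs over all k and l at once.\<close>

lemma F_hw:
  "hw \<kappa> u \<Longrightarrow> \<forall>k\<in>{1..r}. \<forall>l\<in>{1..r}. F k l u \<in> cseq.span H"
proof (induction rule: hword.induct)
  case base
  show ?case
  proof (intro ballI)
    fix k l assume kl: "k \<in> {1..r}" "l \<in> {1..r}"
    have "v0 \<in> H" unfolding H_def by (blast intro: hword.base)
    consider "k < l" | "k = l" | "l < k" by linarith
    then show "F k l v0 \<in> cseq.span H"
    proof cases
      case 1
      then show ?thesis using killed[of k l] kl by (simp add: pairs_def cseq.span_zero)
    next
      case 2
      then show ?thesis using wspD(2)[OF v0(1)] kl \<open>v0 \<in> H\<close> by (simp add: cseq.span_scale cseq.span_base)
    next
      case 3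
      then show ?thesis using F_span_lower[of v0 l k] kl \<open>v0 \<in> H\<close> by (simp add: pairs_def cseq.span_base)
    qed
  qed
next
  case (step \<kappa> u j i)
  show ?case
  proof (intro ballI)
    fix k l assume kl: "k \<in> {1..r}" "l \<in> {1..r}"
    have ij: "i \<in> {1..r}" "j \<in> {1..r}" using step(2) by (auto simp: pairs_def)
    have "u \<in> V" using step(1) hw_wsp wspD by blast
    then have "F k l (F i j u) = F i j (F k l u) + ((if l = i then F k j u else 0) - (if k = j then F i l u else 0))"
      by (rule comm[OF kl ij])
    moreover have "F i j (F k l u) \<in> cseq.span H"
      using step kl F_span_lower by blast
    ultimately show "F k l (F i j u) \<in> cseq.span H"
      using step.IH kl ij by (auto intro!: cseq.span_add cseq.span_diff cseq.span_zero)
  qed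
qed

lemma F_span:
  assumes "u \<in> cseq.span H" "k \<in> {1..r}" "l \<in> {1..r}"
  shows "F k l u \<in> cseq.span H"
  using assms(1)
proof (induction rule: cseq.span_induct_alt)
  case base
  show "F k l 0 \<in> cseq.span H" by (simp add: F_simps cseq.span_zero)
next
  case (step c x y)
  obtain \<kappa> where "hw \<kappa> x" using step(1) unfolding H_def by blast
  then have "F k l x \<in> cseq.span H" using F_hw assms(2,3) by blast
  then show "F k l (cscale c x + y) \<in> cseq.span H"
    unfolding F_simps by (intro cseq.span_add cseq.span_scale step(2))
qed

text \<open>The components are indexed by all weights and vanish off K, which lets the index set be
  enlarged in \<open>wsp_span_hw\<close>.\<close>

lemma weight_decomposition:
  assumes "u \<in> cseq.span H"
  shows "\<exists>K c. finite K \<and> (\<forall>\<kappa>\<in>K. supported r \<kappa>) \<and> (\<forall>\<kappa>. c \<kappa> \<in> cseq.span {x. hw \<kappa> x})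
     \<and> (\<forall>\<kappa>. \<kappa> \<notin> K \<longrightarrow> c \<kappa> = 0) \<and> u = (\<Sum>\<kappa>\<in>K. c \<kappa>)"
  using assms
proof (induction rule: cseq.span_induct_alt)
  case base
  show ?case by (intro exI[of _ "{}"] exI[of _ "\<lambda>_. 0::cseq"] conjI allI ballI impI)
     (simp_all only: cseq.span_zero sum.empty empty_iff finite.emptyI)
next
  case (step a x y)
  obtain \<kappa>0 where k0: "hw \<kappa>0 x" using step(1) by (auto simp: H_def)
  obtain K c where c: "finite K" "\<forall>\<kappa>\<in>K. supported r \<kappa>" "\<forall>\<kappa>. c \<kappa> \<in> cseq.span {x. hw \<kappa> x}"
     "\<forall>\<kappa>. \<kappa> \<notin> K \<longrightarrow> c \<kappa> = 0" "y = (\<Sum>\<kappa>\<in>K. c \<kappa>)" using step(2) by blast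
  let ?K = "insert \<kappa>0 K" and ?c = "\<lambda>\<kappa>. c \<kappa> + (if \<kappa> = \<kappa>0 then cscale a x else 0)"
  have "(\<Sum>\<kappa>\<in>?K. c \<kappa>) = (\<Sum>\<kappa>\<in>K. c \<kappa>)"
    using c by (intro sum.mono_neutral_right) auto
  then have "cscale a x + y = (\<Sum>\<kappa>\<in>?K. ?c \<kappa>)"
    using c(1,5) by (simp only: sum.distrib) (simp add: sum.delta add.commute)
  moreover have "\<forall>\<kappa>. ?c \<kappa> \<in> cseq.span {x. hw \<kappa> x}"
  proof
    fix \<kappa>
    have "cscale a x \<in> cseq.span {x. hw \<kappa>0 x}"
      using k0 by (intro cseq.span_scale cseq.span_base) simp
    then show "?c \<kappa> \<in> cseq.span {x. hw \<kappa> x}"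
      using c(3) by (cases "\<kappa> = \<kappa>0") (simp_all add: cseq.span_add)
  qed
  moreover have "finite ?K" "\<forall>\<kappa>\<in>?K. supported r \<kappa>" "\<forall>\<kappa>. \<kappa> \<notin> ?K \<longrightarrow> ?c \<kappa> = 0"
    using c(1,2,4) hw_supported[OF k0] by auto
  ultimately have "finite ?K \<and> (\<forall>\<kappa>\<in>?K. supported r \<kappa>) \<and> (\<forall>\<kappa>. ?c \<kappa> \<in> cseq.span {x. hw \<kappa> x})
     \<and> (\<forall>\<kappa>. \<kappa> \<notin> ?K \<longrightarrow> ?c \<kappa> = 0) \<and> cscale a x + y = (\<Sum>\<kappa>\<in>?K. ?c \<kappa>)" by blast
  then show ?case
    by (rule exI[where x = ?K, OF exI[where x = ?c]])
qed

lemma span_hw_wsp: "cseq.span {x. hw \<kappa> x} \<subseteq> wsp \<kappa>"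
  by (rule cseq.span_minimal) (auto intro: hw_wsp subspace_wsp)

text \<open>Subtracting u from its component of weight \<mu> leaves a vanishing sum of weight
  vectors, so by independence u equals that component, a combination of words.\<close>

lemma wsp_span_hw:
  assumes "u \<in> cseq.span H" "u \<in> wsp \<mu>" "supported r \<mu>"
  shows "u \<in> cseq.span {x. hw \<mu> x}"
proof -
  obtain K and c :: "weight \<Rightarrow> cseq" where c: "finite K" "\<forall>\<kappa>\<in>K. supported r \<kappa>" "\<forall>\<kappa>. c \<kappa> \<in> cseq.span {x. hw \<kappa> x}"
     "\<forall>\<kappa>. \<kappa> \<notin> K \<longrightarrow> c \<kappa> = 0" "u = (\<Sum>\<kappa>\<in>K. c \<kappa>)" using weight_decomposition[OF assms(1)] by blast
  let ?K = "insert \<mu> K" and ?d = "\<lambda>\<kappa>. c \<kappa> - (if \<kappa> = \<mu> then u else 0)"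
  have "(\<Sum>\<kappa>\<in>?K. c \<kappa>) = (\<Sum>\<kappa>\<in>K. c \<kappa>)"
    using c by (intro sum.mono_neutral_right) auto
  then have s: "(\<Sum>\<kappa>\<in>?K. ?d \<kappa>) = 0"
    using c(1,5) by (simp only: sum_subtractf) (simp add: sum.delta)
  have "?d \<mu> = 0"
  proof (rule weight_independent[where K = ?K and u = ?d and \<kappa> = \<mu>])
    fix \<kappa> assume "\<kappa> \<in> ?K"
    have "c \<kappa> \<in> wsp \<kappa>" using c(3) span_hw_wsp by blast
    then show "?d \<kappa> \<in> wsp \<kappa>"
      using assms(2) by (auto intro: cseq.subspace_diff[OF subspace_wsp])
  qed (use c s assms(3) in auto)
  then show ?thesis using c(3) by (metis eq_iff_diff_eq_0)
qed

lemma wsp_highest: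
  assumes "u \<in> cseq.span H" "u \<in> wsp \<nu>"
  obtains c where "u = cscale c v0"
proof -
  have "{x. hw \<nu> x} = {v0}" using hw_pos hword.base by auto
  then have "u \<in> cseq.span {v0}" using wsp_span_hw[OF assms supp_\<nu>] by simp
  then show ?thesis using that by (auto simp: cseq.span_singleton)
qed

lemma wsp_nonzero_hw:
  assumes "u \<in> cseq.span H" "u \<in> wsp \<mu>" "supported r \<mu>" "u \<noteq> 0"
  obtains x where "hw \<mu> x"
  using wsp_span_hw[OF assms(1-3)] assms(4) cseq.span_empty by (cases "{x. hw \<mu> x} = {}") auto

end

lemma lookup_single_mult:
  fixes g :: "weight \<Rightarrow>\<^sub>0 'a::comm_ring_1"
  shows "lk (monom1 a * g) \<mu> = lk g (\<mu> - a)"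
proof (induction g rule: poly_mapping_sum_induct)
  case (add g \<nu> c)
  have "a + \<nu> = \<mu> \<longleftrightarrow> \<nu> = \<mu> - a" by (auto simp: algebra_simps)
  then show ?case using add
    by (simp only: distrib_left lookup_add mult_single lookup_single mult_1)
qed simp

lemma sum_square_pairs:
  fixes g :: "nat \<Rightarrow> nat \<Rightarrow> 'a::comm_monoid_add"
  shows "(\<Sum>i=1..r. \<Sum>j=1..r. g i j) = (\<Sum>i=1..r. g i i) + (\<Sum>(i, j)\<in>pairs r. g i j + g j i)"
proof -
  let ?S = "{1..r} \<times> {1..r}" and ?weight_deriv = "(\<lambda>i. (i, i)) ` {1..r}" and ?Q = "prod.swap ` pairs r"
  have S: "?S = ?weight_deriv \<union> (pairs r \<union> ?Q)"
    by (auto simp: pairs_def image_iff)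
  have "(\<Sum>i=1..r. \<Sum>j=1..r. g i j) = (\<Sum>(i, j)\<in>?S. g i j)"
    by (simp add: sum.cartesian_product)
  also have "\<dots> = (\<Sum>(i, j)\<in>?weight_deriv. g i j) + ((\<Sum>(i, j)\<in>pairs r. g i j) + (\<Sum>(i, j)\<in>?Q. g i j))"
  proof -
    have "?weight_deriv \<inter> (pairs r \<union> ?Q) = {}" "pairs r \<inter> ?Q = {}" by (auto simp: pairs_def)
    then show ?thesis unfolding S by (simp add: sum.union_disjoint)
  qed
  also have "(\<Sum>(i, j)\<in>?weight_deriv. g i j) = (\<Sum>i=1..r. g i i)"
    by (simp add: sum.reindex inj_on_def)
  also have "(\<Sum>(i, j)\<in>?Q. g i j) = (\<Sum>(i, j)\<in>pairs r. g j i)"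
    by (simp add: sum.reindex split_def)
  finally show ?thesis by (simp add: split_def sum.distrib)
qed

section \<open>Finite-dimensional highest weight modules: weights, traces and the Casimir
  operator\<close>

locale hw_module = hw_vector +
  assumes V_eq: "V = cseq.span H"
    and fin: "\<exists>B. finite B \<and> cseq.span B = V"
    and int_\<nu>: "i \<in> {1..r} \<Longrightarrow> j \<in> {1..r} \<Longrightarrow> \<nu> i - \<nu> j \<in> \<int>"
begin

definition "wts = {\<mu>. supported r \<mu> \<and> wsp \<mu> \<noteq> {0}}"

lemma zero_wsp: "0 \<in> wsp \<mu>"
  by (rule cseq.subspace_0[OF subspace_wsp])

lemma wsp_V: "wsp \<mu> \<subseteq> V"
  using wspD by blast

lemma wsp_disjoint:
  assumes "u \<in> wsp \<mu>" "u \<in> wsp \<mu>'" "supported r \<mu>" "supported r \<mu>'" "u \<noteq> 0"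
  shows "\<mu> = \<mu>'"
proof
  fix i
  show "\<mu> i = \<mu>' i"
  proof (cases "i \<in> {1..r}")
    case True
    then have "cscale (of_rat (\<mu> i)) u = cscale (of_rat (\<mu>' i)) u"
      using wspD(2)[OF assms(1)] wspD(2)[OF assms(2)] by metis
    then show ?thesis using assms(5) by simp
  qed (use assms(3,4) in \<open>auto simp: supported_def\<close>)
qed

text \<open>One nonzero vector from each weight space gives an independent family, whose size is
  bounded by any finite spanning set.\<close>

lemma finite_wts: "finite wts"
proof -
  obtain T where T: "finite T" "cseq.span T = V" using fin by blast
  define g where "g = (\<lambda>\<mu>. SOME u. u \<in> wsp \<mu> \<and> u \<noteq> 0)"
  have g: "g \<mu> \<in> wsp \<mu> \<and> g \<mu> \<noteq> 0" if "\<mu> \<in> wts" for \<mu>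
  proof -
    have "\<exists>u. u \<in> wsp \<mu> \<and> u \<noteq> 0" using that zero_wsp[of \<mu>] by (auto simp: wts_def)
    then show ?thesis unfolding g_def by (rule someI_ex)
  qed
  have inj: "inj_on g wts"
  proof (rule inj_onI)
    fix \<mu> \<mu>' assume m: "\<mu> \<in> wts" "\<mu>' \<in> wts" "g \<mu> = g \<mu>'"
    show "\<mu> = \<mu>'"
      by (rule wsp_disjoint[of "g \<mu>"]) (use g[OF m(1)] g[OF m(2)] m in \<open>auto simp: wts_def\<close>)
  qed
  have "cseq.independent (g ` wts)"
    unfolding cseq.dependent_explicit
  proof (rule notI, elim exE conjE)
    fix t u assume t: "finite t" "t \<subseteq> g ` wts" "(\<Sum>v\<in>t. cscale (u v) v) = 0" "\<exists>v\<in>t. u v \<noteq> 0"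
    then obtain K where K: "K \<subseteq> wts" "t = g ` K" by (meson subset_imageE)
    have injK: "inj_on g K" using inj K(1) by (rule inj_on_subset)
    have "finite K" using t(1) K(2) injK by (simp add: finite_image_iff)
    obtain \<kappa> where k: "\<kappa> \<in> K" "u (g \<kappa>) \<noteq> 0" using t(4) K(2) by auto
    have "cscale (u (g \<kappa>)) (g \<kappa>) = 0"
    proof (rule weight_independent[where K = K and u = "\<lambda>\<kappa>. cscale (u (g \<kappa>)) (g \<kappa>)" and \<kappa> = \<kappa>])
      show "(\<Sum>\<kappa>\<in>K. cscale (u (g \<kappa>)) (g \<kappa>)) = 0"
        using t(3) unfolding K(2) by (simp add: sum.reindex[OF injK])
      show "\<kappa> \<in> K \<Longrightarrow> cscale (u (g \<kappa>)) (g \<kappa>) \<in> wsp \<kappa>" for \<kappa>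
        using g K(1) by (intro cseq.subspace_scale[OF subspace_wsp]) auto
    qed (use \<open>finite K\<close> K(1) k(1) in \<open>auto simp: wts_def\<close>)
    then show False using k g K(1) by auto
  qed
  moreover have "g ` wts \<subseteq> cseq.span T" using g wsp_V T(2) by blast
  ultimately have "finite (g ` wts)" using cseq.independent_span_bound[OF T(1)] by blast
  then show ?thesis using inj by (simp add: finite_image_iff)
qed

lemma wts_hw:
  assumes "\<mu> \<in> wts"
  obtains x where "hw \<mu> x"
proof -
  obtain u where "u \<in> wsp \<mu>" "u \<noteq> 0" using assms zero_wsp[of \<mu>] by (auto simp: wts_def)
  moreover have "u \<in> cseq.span H" using \<open>u \<in> wsp \<mu>\<close> wsp_V[of \<mu>] unfolding V_eq[symmetric] by blast
  moreover have "supported r \<mu>" using assms by (simp add: wts_def)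
  ultimately show ?thesis using that wsp_nonzero_hw by blast
qed

lemma wts_Ints:
  assumes "\<mu> \<in> wts" "i \<in> {1..r}" "j \<in> {1..r}"
  shows "\<mu> i - \<mu> j \<in> \<int>"
proof -
  obtain x where x: "hw \<mu> x" by (rule wts_hw[OF assms(1)])
  have "(\<nu> i - \<nu> j) - ((\<nu> i - \<mu> i) - (\<nu> j - \<mu> j)) \<in> \<int>"
    by (intro Ints_diff int_\<nu> hw_Ints[OF x] assms)
  then show ?thesis by simp
qed

definition bas :: "weight \<Rightarrow> cseq set" where
  "bas \<mu> = (SOME B. finite B \<and> cseq.independent B \<and> cseq.span B = wsp \<mu> \<and> card B = cseq.dim (wsp \<mu>))"

lemma bas: "finite (bas \<mu>)" "cseq.independent (bas \<mu>)" "cseq.span (bas \<mu>) = wsp \<mu>" "card (bas \<mu>) = cseq.dim (wsp \<mu>)"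
proof -
  obtain T where T: "finite T" "cseq.span T = V" using fin by blast
  have "\<exists>B. finite B \<and> cseq.independent B \<and> cseq.span B = wsp \<mu> \<and> card B = cseq.dim (wsp \<mu>)"
    by (rule finite_basis_exists[of _ T]) (use T subspace_wsp wsp_V in auto)
  from someI_ex[OF this]
  show "finite (bas \<mu>)" "cseq.independent (bas \<mu>)" "cseq.span (bas \<mu>) = wsp \<mu>" "card (bas \<mu>) = cseq.dim (wsp \<mu>)"
    by (auto simp: bas_def)
qed

lemma bas_wsp: "b \<in> bas \<mu> \<Longrightarrow> b \<in> wsp \<mu>"
  using bas(3) cseq.span_superset by blast

abbreviation mult :: "weight \<Rightarrow> nat" where "mult \<mu> \<equiv> cseq.dim (wsp \<mu>)"

definition t :: "nat \<Rightarrow> nat \<Rightarrow> weight \<Rightarrow> complex" where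
  "t i j \<mu> = tr (bas \<mu>) (\<lambda>v. F j i (F i j v))"

lemma F_F_wsp:
  assumes "i \<in> {1..r}" "j \<in> {1..r}" "v \<in> wsp \<mu>"
  shows "F j i (F i j v) \<in> wsp \<mu>"
proof -
  have "F j i (F i j v) \<in> wsp ((\<mu> + (eps i - eps j)) + (eps j - eps i))"
    by (intro F_wsp assms)
  moreover have "(\<mu> + (eps i - eps j)) + (eps j - eps i) = \<mu>" by (simp add: fun_eq_iff)
  ultimately show ?thesis by metis
qed

lemma wsp_scale_self: "v \<in> wsp \<mu> \<Longrightarrow> cscale c v \<in> wsp \<mu>"
  by (rule cseq.subspace_scale[OF subspace_wsp])

lemma F_swap_wsp:
  assumes ij: "i \<in> {1..r}" "j \<in> {1..r}" "i \<noteq> j" and v: "v \<in> wsp \<mu>"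
  shows "F i j (F j i v) = F j i (F i j v) + cscale (of_rat (\<mu> i - \<mu> j)) v"
  using comm[OF ij(1,2,2,1) wspD(1)[OF v]] ij wspD(2)[OF v]
  by (simp add: of_rat_diff cseq.scale_left_diff_distrib)

text \<open>Freudenthal's recursion: cyclicity moves the trace from weight
  \<open>\<mu> - \<alpha>\<close> to \<mu>, where the commutator of the two root operators is the
  scalar \<open>\<mu> i - \<mu> j\<close>. This is the coefficient form of the hypothesis on
  \<open>T\<close> in \<open>character_times_denominator\<close>.\<close>

lemma t_shift:
  assumes ij: "i \<in> {1..r}" "j \<in> {1..r}" "i \<noteq> j"
  shows "t i j (\<mu> + (eps j - eps i)) = t i j \<mu> + of_rat (\<mu> i - \<mu> j) * of_nat (mult \<mu>)"
proof -
  let ?\<mu>' = "\<mu> + (eps j - eps i)"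
  have eq: "?\<mu>' + (eps i - eps j) = \<mu>" by (simp add: fun_eq_iff)
  have "t i j ?\<mu>' = tr (bas \<mu>) (\<lambda>v. F i j (F j i v))"
    unfolding t_def
  proof (rule tr_cyclic)
    show "F i j b \<in> cseq.span (bas \<mu>)" if "b \<in> bas ?\<mu>'" for b
      using F_wsp[OF ij(1,2) bas_wsp[OF that]] unfolding eq bas(3) .
    show "F j i b \<in> cseq.span (bas ?\<mu>')" if "b \<in> bas \<mu>" for b
      using F_wsp[OF ij(2,1) bas_wsp[OF that]] unfolding bas(3) .
  qed (rule bas lin_F)+
  also have "\<dots> = tr (bas \<mu>) (\<lambda>v. F j i (F i j v) + cscale (of_rat (\<mu> i - \<mu> j)) v)"
    by (rule tr_cong) (rule F_swap_wsp[OF ij bas_wsp])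
  also have "\<dots> = t i j \<mu> + tr (bas \<mu>) (\<lambda>v. cscale (of_rat (\<mu> i - \<mu> j)) v)"
    unfolding t_def by (rule tr_add[OF bas(2)]; unfold bas(3)) (intro F_F_wsp ij wsp_scale_self bas_wsp; assumption)+
  also have "tr (bas \<mu>) (\<lambda>v. cscale (of_rat (\<mu> i - \<mu> j)) v) = of_rat (\<mu> i - \<mu> j) * of_nat (mult \<mu>)"
    by (subst tr_scale) (auto simp: bas(2,3,4) bas_wsp tr_ident)
  finally show ?thesis .
qed

text \<open>The quadratic Casimir operator of \<open>gl\<^sub>r\<close>.\<close>

definition cas :: "cseq \<Rightarrow> cseq" where
  "cas v = (\<Sum>i=1..r. \<Sum>j=1..r. F i j (F j i v))"

lemma lin_cas: "clinear cas"
  by (rule clinearI) (simp_all only: cas_def F_simps sum.distrib cseq.scale_sum_right)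

text \<open>Moving \<open>F k l\<close> past both factors leaves four sums over a single index, and
  these cancel in pairs.\<close>

lemma cas_commutes:
  assumes kl: "k \<in> {1..r}" "l \<in> {1..r}" and v: "v \<in> V"
  shows "F k l (cas v) = cas (F k l v)"
proof -
  have one: "F k l (F i j (F j i v)) = F i j (F j i (F k l v))
       + ((if l = j then F i l (F k i v) else 0) - (if k = i then F k j (F j l v) else 0))
       + ((if l = i then F k j (F j l v) else 0) - (if k = j then F i l (F k i v) else 0))"
    if ij: "i \<in> {1..r}" "j \<in> {1..r}" for i j
    using comm[OF kl ij F_V[OF ij(2,1) v]] comm[OF kl ij(2,1) v]
    by (auto simp: F_simps)
  have "F k l (cas v) = (\<Sum>i=1..r. \<Sum>j=1..r. F k l (F i j (F j i v)))"
    by (simp only: cas_def F_simps)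
  also have "\<dots> = (\<Sum>i=1..r. \<Sum>j=1..r. F i j (F j i (F k l v))
       + ((if l = j then F i l (F k i v) else 0) - (if k = i then F k j (F j l v) else 0))
       + ((if l = i then F k j (F j l v) else 0) - (if k = j then F i l (F k i v) else 0)))"
    by (intro sum.cong refl one)
  also have "\<dots> = cas (F k l v)
      + ((\<Sum>i=1..r. \<Sum>j=1..r. if l = j then F i l (F k i v) else 0) - (\<Sum>i=1..r. \<Sum>j=1..r. if k = i then F k j (F j l v) else 0))
      + ((\<Sum>i=1..r. \<Sum>j=1..r. if l = i then F k j (F j l v) else 0) - (\<Sum>i=1..r. \<Sum>j=1..r. if k = j then F i l (F k i v) else 0))"
    by (simp only: sum.distrib sum_subtractf cas_def)
  also have "(\<Sum>i=1..r. \<Sum>j=1..r. if l = j then F i l (F k i v) else 0) = (\<Sum>i=1..r. F i l (F k i v))"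
    using kl by (simp add: sum.delta)
  also have "(\<Sum>i=1..r. \<Sum>j=1..r. if k = j then F i l (F k i v) else 0) = (\<Sum>i=1..r. F i l (F k i v))"
    using kl by (simp add: sum.delta)
  also have "(\<Sum>i=1..r. \<Sum>j=1..r. if k = i then F k j (F j l v) else 0) = (\<Sum>j=1..r. F k j (F j l v))"
    using kl by (subst sum.swap) (simp add: sum.delta)
  also have "(\<Sum>i=1..r. \<Sum>j=1..r. if l = i then F k j (F j l v) else 0) = (\<Sum>j=1..r. F k j (F j l v))"
    using kl by (subst sum.swap) (simp add: sum.delta)
  finally show ?thesis by simp
qed

text \<open>Products that lower before they raise are reordered to raise before they lower. The
  commutators add up to \<open>(\<mu>, 2\<delta>)\<close>, the linear term of the Casimir
  eigenvalue.\<close>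

lemma cas_wsp:
  assumes v: "v \<in> wsp \<mu>"
  shows "cas v = cscale (of_rat (\<Sum>i=1..r. \<mu> i * \<mu> i)) v
     + (\<Sum>(i, j)\<in>pairs r. cscale (of_rat (\<mu> i - \<mu> j)) v + cscale 2 (F j i (F i j v)))"
proof -
  have "cas v = (\<Sum>i=1..r. F i i (F i i v)) + (\<Sum>(i, j)\<in>pairs r. F i j (F j i v) + F j i (F i j v))"
    unfolding cas_def by (rule sum_square_pairs)
  also have "(\<Sum>i=1..r. F i i (F i i v)) = (\<Sum>i=1..r. cscale (of_rat (\<mu> i * \<mu> i)) v)"
    by (rule sum.cong) (auto simp: wspD(2)[OF v] F_simps of_rat_mult)
  also have "\<dots> = cscale (of_rat (\<Sum>i=1..r. \<mu> i * \<mu> i)) v"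
    by (simp add: cseq.scale_sum_left of_rat_sum)
  also have "(\<Sum>(i, j)\<in>pairs r. F i j (F j i v) + F j i (F i j v))
     = (\<Sum>(i, j)\<in>pairs r. cscale (of_rat (\<mu> i - \<mu> j)) v + cscale 2 (F j i (F i j v)))"
  proof (rule sum.cong[OF refl])
    fix q assume q: "q \<in> pairs r"
    obtain i j where ij: "q = (i, j)" by force
    have two: "cscale 2 x = x + x" for x by (simp add: cscale_def fun_eq_iff)
    show "(case q of (i, j) \<Rightarrow> F i j (F j i v) + F j i (F i j v))
       = (case q of (i, j) \<Rightarrow> cscale (of_rat (\<mu> i - \<mu> j)) v + cscale 2 (F j i (F i j v)))"
    proof -
      have "F i j (F j i v) = F j i (F i j v) + cscale (of_rat (\<mu> i - \<mu> j)) v"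
        using q ij by (intro F_swap_wsp v) (auto simp: pairs_def)
      then show ?thesis unfolding ij prod.case two by (simp only: add_ac)
    qed
  qed
  finally show ?thesis .
qed

text \<open>The weight space of \<nu> is a line, so \<open>v0\<close> is an eigenvector; as
  \<open>cas\<close> commutes with all \<open>F i j\<close>, every lowering word has the same
  eigenvalue.\<close>

lemma cas_scalar:
  obtains c where "\<And>v. v \<in> V \<Longrightarrow> cas v = cscale c v"
proof -
  have "cas v0 \<in> wsp \<nu>"
    unfolding cas_def by (intro cseq.subspace_sum[OF subspace_wsp] F_F_wsp v0)
  then obtain c where c: "cas v0 = cscale c v0"
    using wsp_highest[of "cas v0"] wsp_V V_eq by blast
  have hc: "cas u = cscale c u" if "hw \<kappa> u" for \<kappa> u
    using that
  proof (induction rule: hword.induct)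
    case (step \<kappa> u j i)
    have "i \<in> {1..r}" "j \<in> {1..r}" "u \<in> V" using step hw_wsp wspD by (auto simp: pairs_def)
    then have "cas (F i j u) = F i j (cas u)" using cas_commutes by simp
    then show "cas (F i j u) = cscale c (F i j u)" using step.IH by (simp add: F_simps)
  qed (rule c)
  have "cas v = cscale c v" if "v \<in> V" for v
    using that unfolding V_eq
  proof (induction rule: cseq.span_induct_alt)
    case base
    show "cas 0 = cscale c 0" by (simp add: clinear_simps[OF lin_cas])
  next
    case (step a x y)
    have "cas x = cscale c x" using step(1) hc unfolding H_def by blast
    then show "cas (cscale a x + y) = cscale c (cscale a x + y)"
      using step(2) by (simp add: clinear_simps[OF lin_cas] cseq.scale_right_distrib mult.commute)
  qed
  then show ?thesis using that by blast
qed

text \<open>The coefficient at \<mu> of the Casimir hypothesis in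
  \<open>character_times_denominator\<close>.\<close>

lemma trace_cas:
  assumes "\<And>v. v \<in> V \<Longrightarrow> cas v = cscale c v"
  shows "c * of_nat (mult \<mu>) = of_rat (\<Sum>i=1..r. \<mu> i * \<mu> i) * of_nat (mult \<mu>)
     + (\<Sum>(i, j)\<in>pairs r. of_rat (\<mu> i - \<mu> j) * of_nat (mult \<mu>) + 2 * t i j \<mu>)"
proof -
  have FF: "F j i (F i j b) \<in> wsp \<mu>" if "(i, j) \<in> pairs r" "b \<in> bas \<mu>" for i j b
    using that by (intro F_F_wsp bas_wsp) (auto simp: pairs_def)
  have sc: "tr (bas \<mu>) (\<lambda>v. cscale a v) = a * of_nat (mult \<mu>)" for a
    by (subst tr_scale) (auto simp: bas(2,3,4) bas_wsp tr_ident)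
  have add: "x + y \<in> wsp \<mu>" if "x \<in> wsp \<mu>" "y \<in> wsp \<mu>" for x y
    using that by (rule cseq.subspace_add[OF subspace_wsp])
  let ?g = "\<lambda>(i, j) v. cscale (of_rat (\<mu> i - \<mu> j)) v + cscale 2 (F j i (F i j v))"
  have g: "?g q b \<in> wsp \<mu>" if "q \<in> pairs r" "b \<in> bas \<mu>" for q b
    using that by (cases q) (simp only: prod.case, intro add wsp_scale_self FF bas_wsp)
  have "c * of_nat (mult \<mu>) = tr (bas \<mu>) (\<lambda>v. cscale c v)" by (simp add: sc)
  also have "\<dots> = tr (bas \<mu>) (\<lambda>v. cscale (of_rat (\<Sum>i=1..r. \<mu> i * \<mu> i)) v + (\<Sum>q\<in>pairs r. ?g q v))"
  proof (rule tr_cong)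
    fix b assume "b \<in> bas \<mu>"
    then have b: "b \<in> wsp \<mu>" by (rule bas_wsp)
    have "cas b = cscale c b" by (rule assms) (use b wsp_V in blast)
    then show "cscale c b = cscale (of_rat (\<Sum>i=1..r. \<mu> i * \<mu> i)) b + (\<Sum>q\<in>pairs r. ?g q b)"
      using cas_wsp[OF b] by (simp add: split_def)
  qed
  also have "\<dots> = tr (bas \<mu>) (\<lambda>v. cscale (of_rat (\<Sum>i=1..r. \<mu> i * \<mu> i)) v) + tr (bas \<mu>) (\<lambda>v. \<Sum>q\<in>pairs r. ?g q v)"
    by (rule tr_add[OF bas(2)]; unfold bas(3))
      (intro wsp_scale_self bas_wsp cseq.subspace_sum[OF subspace_wsp] g; assumption)+
  also have "tr (bas \<mu>) (\<lambda>v. \<Sum>q\<in>pairs r. ?g q v) = (\<Sum>q\<in>pairs r. tr (bas \<mu>) (?g q))"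
    by (rule tr_sum[OF bas(2)]) (unfold bas(3), rule g)
  also have "\<dots> = (\<Sum>(i, j)\<in>pairs r. of_rat (\<mu> i - \<mu> j) * of_nat (mult \<mu>) + 2 * t i j \<mu>)"
  proof (rule sum.cong[OF refl])
    fix q assume q: "q \<in> pairs r"
    obtain i j where ij: "q = (i, j)" by force
    have "tr (bas \<mu>) (?g q) = tr (bas \<mu>) (\<lambda>v. cscale (of_rat (\<mu> i - \<mu> j)) v) + tr (bas \<mu>) (\<lambda>v. cscale 2 (F j i (F i j v)))"
      unfolding ij prod.case
      by (rule tr_add[OF bas(2)]; unfold bas(3)) (intro wsp_scale_self bas_wsp FF q[unfolded ij]; assumption)+
    also have "tr (bas \<mu>) (\<lambda>v. cscale 2 (F j i (F i j v))) = 2 * t i j \<mu>"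
      unfolding t_def by (rule tr_scale[OF bas(2)], unfold bas(3)) (rule FF[OF q[unfolded ij]])
    finally show "tr (bas \<mu>) (?g q) = (case q of (i, j) \<Rightarrow> of_rat (\<mu> i - \<mu> j) * of_nat (mult \<mu>) + 2 * t i j \<mu>)"
      unfolding ij prod.case sc .
  qed
  finally show ?thesis by (simp add: sc)
qed

subsection \<open>Symmetry of the weight multiplicities\<close>

text \<open>Applying \<open>F j i\<close> repeatedly would give nonzero vectors of infinitely many weights.\<close>

lemma lowering_eigenvalue:
  assumes ij: "i \<in> {1..r}" "j \<in> {1..r}" "i \<noteq> j"
    and v: "v \<in> wsp \<mu>" "supported r \<mu>" "\<mu> i \<le> \<mu> j"
    and eig: "F i j (F j i v) = cscale (- of_rat c) v" "c > 0"
  shows "v = 0"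
proof (rule ccontr)
  assume "v \<noteq> 0"
  let ?\<mu> = "\<lambda>n::nat. \<mu> + wscale (of_nat n) (eps j - eps i)"
  have chain: "\<exists>w c. w \<noteq> 0 \<and> w \<in> wsp (?\<mu> n) \<and> c > 0 \<and> F i j (F j i w) = cscale (- of_rat c) w" for n
  proof (induction n)
    case 0
    have "?\<mu> 0 = \<mu>" by (simp add: wscale_def fun_eq_iff)
    then show ?case using \<open>v \<noteq> 0\<close> v eig by metis
  next
    case (Suc n)
    then obtain w c where w: "w \<noteq> 0" "w \<in> wsp (?\<mu> n)" "c > 0" "F i j (F j i w) = cscale (- of_rat c) w"
      by blast
    let ?w = "F j i w"
    have "?w \<noteq> 0"
    proof
      assume "?w = 0"
      then have "cscale (- of_rat c) w = 0" using w(4) by (simp add: F_simps)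
      then show False using w by simp
    qed
    have "?\<mu> n + (eps j - eps i) = ?\<mu> (Suc n)" by (simp add: wscale_def fun_eq_iff algebra_simps)
    then have w': "?w \<in> wsp (?\<mu> (Suc n))" using F_wsp[OF ij(2,1) w(2)] by metis
    let ?d = "?\<mu> (Suc n) i - ?\<mu> (Suc n) j"
    have d: "?d \<le> 0" using v(3) ij(3) by (simp add: wscale_def eps_def)
    \<comment> \<open>Each lowering step replaces c by \<open>c - ?d\<close> with
      \<open>?d \<le> 0\<close>; the constant stays positive and the chain of nonzero vectors never
      ends.\<close>
    have "F i j (F j i ?w) = F j i (cscale (- of_rat c) w) + cscale (of_rat ?d) ?w"
      using F_swap_wsp[OF ij w'] w(4) by metis
    also have "\<dots> = cscale (- of_rat (c - ?d)) ?w"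
      unfolding F_simps cseq.scale_left_distrib[symmetric] by (simp only: of_rat_diff minus_diff_eq) (simp add: algebra_simps)
    finally have "F i j (F j i ?w) = cscale (- of_rat (c - ?d)) ?w" .
    moreover have "c - ?d > 0" using d w(3) by linarith
    ultimately have "?w \<noteq> 0 \<and> ?w \<in> wsp (?\<mu> (Suc n)) \<and> c - ?d > 0 \<and> F i j (F j i ?w) = cscale (- of_rat (c - ?d)) ?w"
      using \<open>?w \<noteq> 0\<close> w' by blast
    then show ?case by (rule exI[where x = ?w, OF exI[where x = "c - ?d"]])
  qed
  have "?\<mu> n \<in> wts" for n
    using chain[of n] v(2) ij by (auto simp: wts_def intro!: supported_add supported_wscale supported_diff supported_eps)
  then have "range ?\<mu> \<subseteq> wts" by blast
  moreover have "inj ?\<mu>"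
  proof (rule injI)
    fix m n assume "?\<mu> m = ?\<mu> n"
    then have "?\<mu> m j = ?\<mu> n j" by metis
    then show "m = n" using ij(3) by (simp add: wscale_def eps_def)
  qed
  ultimately show False using finite_wts finite_subset range_inj_infinite by blast
qed

lemma F_pow_wsp:
  assumes "i \<in> {1..r}" "j \<in> {1..r}" "v \<in> wsp \<mu>"
  shows "(F i j ^^ l) v \<in> wsp (\<mu> + wscale (of_nat l) (eps i - eps j))"
proof (induction l)
  case 0
  have "\<mu> + wscale (of_nat 0) (eps i - eps j) = \<mu>" by (simp add: wscale_def fun_eq_iff)
  then show ?case using assms(3) by (metis funpow_0)
next
  case (Suc l)
  have "(\<mu> + wscale (of_nat l) (eps i - eps j)) + (eps i - eps j) = \<mu> + wscale (of_nat (Suc l)) (eps i - eps j)"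
    by (simp add: wscale_def fun_eq_iff algebra_simps)
  then show ?case using F_wsp[OF assms(1,2) Suc.IH] by (simp only: funpow.simps o_apply)
qed

lemma lin_F_pow: "clinear (F i j ^^ l)"
proof (induction l)
  case (Suc l)
  show ?case
    by (rule clinearI) (simp_all only: funpow.simps o_apply clinear_simps[OF Suc] F_simps)
qed (simp add: clinearI)

text \<open>The \<open>sl\<^sub>2\<close> commutator of f with a power of e on weight
  \<open>-k\<close>. The coefficient \<open>(l + 1) * (k - l)\<close> is positive as long as
  \<open>l < k\<close>, which is the range \<open>raise_pow_injective\<close> needs.\<close>

lemma lower_raise_pow:
  assumes ij: "i \<in> {1..r}" "j \<in> {1..r}" "i \<noteq> j" and v: "v \<in> wsp \<mu>" "\<mu> i - \<mu> j = - of_nat k"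
  shows "F j i ((F i j ^^ Suc l) v) = (F i j ^^ Suc l) (F j i v)
     + cscale (of_rat (of_nat (l + 1) * (of_nat k - of_nat l))) ((F i j ^^ l) v)"
proof (induction l)
  case 0
  show ?case using F_swap_wsp[OF ij v(1)] v(2) by (simp add: of_rat_minus)
next
  case (Suc l)
  let ?x = "(F i j ^^ Suc l) v" let ?\<mu> = "\<mu> + wscale (of_nat (Suc l)) (eps i - eps j)"
  have x: "?x \<in> wsp ?\<mu>" by (rule F_pow_wsp[OF ij(1,2) v(1)])
  have d: "?\<mu> i - ?\<mu> j = - of_nat k + 2 * of_nat (Suc l)"
    using v(2) ij(3) by (simp add: wscale_def eps_def)
  have "F j i (F i j ?x) = F i j (F j i ?x) - cscale (of_rat (?\<mu> i - ?\<mu> j)) ?x"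
    using F_swap_wsp[OF ij x] by (simp add: eq_diff_eq)
  also have "F i j (F j i ?x) = (F i j ^^ Suc (Suc l)) (F j i v)
      + cscale (of_rat (of_nat (l + 1) * (of_nat k - of_nat l))) ?x"
    unfolding Suc.IH by (simp add: F_simps)
  also have "\<dots> - cscale (of_rat (?\<mu> i - ?\<mu> j)) ?x = (F i j ^^ Suc (Suc l)) (F j i v)
      + cscale (of_rat (of_nat (l + 1) * (of_nat k - of_nat l)) - of_rat (?\<mu> i - ?\<mu> j)) ?x"
    by (simp only: cseq.scale_left_diff_distrib add_diff_eq)
  also have "(of_rat (of_nat (l + 1) * (of_nat k - of_nat l)) - of_rat (?\<mu> i - ?\<mu> j) :: complex)
      = of_rat (of_nat (Suc l + 1) * (of_nat k - of_nat (Suc l)))"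
    unfolding d of_rat_diff[symmetric] by (simp add: algebra_simps)
  finally show ?case by simp
qed

text \<open>The \<open>k\<close>-th power of the raising operator is injective on weight \<open>-k\<close> of the \<open>sl\<^sub>2\<close> of the root: if it
  kills \<open>v\<close> at stage \<open>l + 1\<close>, then stage \<open>l\<close> kills \<open>(e f + c) v\<close> with \<open>c > 0\<close>, and \<open>e f + c\<close> is injective.\<close>

lemma raise_pow_injective:
  assumes ij: "i \<in> {1..r}" "j \<in> {1..r}" "i \<noteq> j" and \<mu>: "supported r \<mu>" "\<mu> i - \<mu> j = - of_nat k"
    and "l \<le> k" "v \<in> wsp \<mu>" "(F i j ^^ l) v = 0"
  shows "v = 0"
  using assms(6-8)
proof (induction l arbitrary: v)
  case (Suc l)
  let ?c = "of_nat (l + 1) * (of_nat k - of_nat l) :: rat"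
  let ?v = "F i j (F j i v) + cscale (of_rat ?c) v"
  have "(F i j ^^ l) ?v = (F i j ^^ Suc l) (F j i v) + cscale (of_rat ?c) ((F i j ^^ l) v)"
    unfolding clinear_simps[OF lin_F_pow] by (simp only: funpow_Suc_right o_apply)
  also have "\<dots> = F j i ((F i j ^^ Suc l) v)"
    by (rule lower_raise_pow[OF ij Suc.prems(2) \<mu>(2), symmetric])
  also have "\<dots> = 0" using Suc.prems(3) by (simp only: F_simps)
  finally have pow: "(F i j ^^ l) ?v = 0" .
  have vw: "?v \<in> wsp \<mu>"
    using Suc.prems(2) F_F_wsp[OF ij(2,1)] by (intro cseq.subspace_add[OF subspace_wsp] wsp_scale_self)
  have "l \<le> k" using Suc.prems(1) by simp
  from Suc.IH[OF this vw pow] have "?v = 0" .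
  then have eig: "F i j (F j i v) = cscale (- of_rat ?c) v"
    by (simp only: cseq.scale_minus_left eq_neg_iff_add_eq_0)
  show "v = 0"
  proof (rule lowering_eigenvalue[OF ij Suc.prems(2) \<mu>(1) _ eig])
    show "\<mu> i \<le> \<mu> j" using \<mu>(2) by (simp add: algebra_simps)
    show "?c > 0" using Suc.prems(1) by (intro mult_pos_pos) auto
  qed
qed simp

text \<open>The reflected weight is \<mu> plus k times the root, with
  \<open>k = \<mu> j - \<mu> i\<close>, so the k-th power of the raising operator leads into its
  weight space, and it does so injectively.\<close>

lemma mult_transpose_le:
  assumes ij: "i \<in> {1..r}" "j \<in> {1..r}" "i \<noteq> j" and \<mu>: "supported r \<mu>" "\<mu> i \<le> \<mu> j" "\<mu> i - \<mu> j \<in> \<int>"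
  shows "mult \<mu> \<le> mult (weyl_act (Transposition.transpose i j) \<mu>)"
proof -
  obtain k where k: "\<mu> i - \<mu> j = - of_nat k"
  proof -
    obtain z where z: "\<mu> i - \<mu> j = of_int z" using \<mu>(3) by (auto elim: Ints_cases)
    then have "z \<le> 0" using \<mu>(2) by (metis diff_le_0_iff_le of_int_le_0_iff)
    then show ?thesis using z that[of "nat (- z)"] by simp
  qed
  have eq: "\<mu> + wscale (of_nat k) (eps i - eps j) = weyl_act (Transposition.transpose i j) \<mu>"
  proof
    fix m
    have "of_nat k = \<mu> j - \<mu> i" using k by simp
    then show "(\<mu> + wscale (of_nat k) (eps i - eps j)) m = weyl_act (Transposition.transpose i j) \<mu> m"
      using ij(3) by (auto simp: weyl_act_transpose wscale_def eps_def transpose_def)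
  qed
  obtain T where T: "finite T" "cseq.span T = V" using fin by blast
  show ?thesis
  proof (rule dim_le_injective[where T = T and f = "F i j ^^ k"])
    show "(F i j ^^ k) v \<in> wsp (weyl_act (Transposition.transpose i j) \<mu>)" if "v \<in> wsp \<mu>" for v
      using F_pow_wsp[OF ij(1,2) that, of k] unfolding eq .
    show "v = 0" if "v \<in> wsp \<mu>" "(F i j ^^ k) v = 0" for v
      using raise_pow_injective[OF ij \<mu>(1) k order_refl that] .
  qed (use T wsp_V subspace_wsp lin_F_pow in auto)
qed

lemma mult_transpose:
  assumes ij: "i \<in> {1..r}" "j \<in> {1..r}" "i \<noteq> j" and \<mu>: "supported r \<mu>"
  shows "mult (weyl_act (Transposition.transpose i j) \<mu>) = mult \<mu>"
proof -
  let ?s = "\<lambda>\<mu>. weyl_act (Transposition.transpose i j) \<mu>"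
  have ss: "?s (?s \<mu>) = \<mu>" by (simp add: fun_eq_iff weyl_act_transpose)
  have supp: "supported r (?s \<mu>)"
    by (rule supported_weyl_act[OF permutes_swap_id \<mu>]) (use ij in auto)
  show ?thesis
  proof (cases "\<mu> \<in> wts \<or> ?s \<mu> \<in> wts")
    case False
    then have "wsp \<mu> = {0}" "wsp (?s \<mu>) = {0}" using \<mu> supp by (auto simp: wts_def)
    then show ?thesis by metis
  next
    case True
    \<comment> \<open>Integral differences are known for actual weights only, which is why the case
      of two zero weight spaces is split off.\<close>
    then have int: "\<mu> i - \<mu> j \<in> \<int>"
      using wts_Ints[of \<mu> i j] wts_Ints[of "?s \<mu>" j i] ij by (auto simp: weyl_act_transpose)
    then have int': "\<mu> j - \<mu> i \<in> \<int>" by (metis Ints_minus minus_diff_eq)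
    consider "\<mu> i \<le> \<mu> j" | "\<mu> j \<le> \<mu> i" by linarith
    then show ?thesis
    proof cases
      case 1
      have "mult (?s \<mu>) \<le> mult (weyl_act (Transposition.transpose j i) (?s \<mu>))"
        by (rule mult_transpose_le) (use 1 ij supp int in \<open>auto simp: weyl_act_transpose\<close>)
      then show ?thesis
        using mult_transpose_le[OF ij \<mu> 1 int] ss by (simp add: transpose_commute)
    next
      case 2
      have "mult (?s \<mu>) \<le> mult (weyl_act (Transposition.transpose i j) (?s \<mu>))"
        by (rule mult_transpose_le) (use 2 ij supp int' in \<open>auto simp: weyl_act_transpose\<close>)
      moreover have "mult \<mu> \<le> mult (weyl_act (Transposition.transpose j i) \<mu>)"
        by (rule mult_transpose_le) (use 2 ij \<mu> int' in auto)
      ultimately show ?thesis using ss by (simp add: transpose_commute)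
    qed
  qed
qed

subsection \<open>The character\<close>

definition chr :: "weight \<Rightarrow>\<^sub>0 int" where
  "chr = (\<Sum>\<mu>\<in>wts. Poly_Mapping.single \<mu> (int (mult \<mu>)))"

lemma mult_outside: "supported r \<mu> \<Longrightarrow> \<mu> \<notin> wts \<Longrightarrow> mult \<mu> = 0"
  using cseq.dim_eq_card[of "{}" "{0}"] by (simp add: wts_def cseq.span_empty cseq.independent_empty)

lemma lookup_chr: "lk chr \<mu> = (if supported r \<mu> then int (mult \<mu>) else 0)"
proof -
  have "lk chr \<mu> = (if \<mu> \<in> wts then int (mult \<mu>) else 0)"
    using finite_wts by (simp add: chr_def lookup_sum lookup_single when_def sum.delta)
  then show ?thesis using mult_outside[of \<mu>] by (auto simp: wts_def)
qed

lemma keys_chr: "\<mu> \<in> Poly_Mapping.keys chr \<Longrightarrow> \<mu> \<in> wts"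
  using mult_outside[of \<mu>] by (auto simp: in_keys_iff lookup_chr split: if_splits)

lemma sym_chr: "weyl_symmetric r chr"
proof (rule symI_adj)
  fix k \<mu> assume k: "k \<in> {1..<r}"
  have p: "adj k permutes {1..r}" by (rule adj_permutes[OF k])
  show "lk chr (weyl_act (adj k) \<mu>) = lk chr \<mu>"
  proof (cases "supported r \<mu>")
    case True
    then show ?thesis
      using mult_transpose[of k "k + 1" \<mu>] k supported_weyl_act[OF p True] by (simp add: lookup_chr)
  next
    case False
    then have "\<not> supported r (weyl_act (adj k) \<mu>)"
      using supported_weyl_act[OF p, of "weyl_act (adj k) \<mu>"]
      by (metis bij_transpose inv_transpose_eq weyl_act_inv_cancel)
    then show ?thesis using False by (simp add: lookup_chr)
  qed
qed

lemma mult_\<nu>: "mult \<nu> = 1"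
proof -
  have "wsp \<nu> = cseq.span {v0}"
  proof
    show "wsp \<nu> \<subseteq> cseq.span {v0}"
    proof
      fix u assume u: "u \<in> wsp \<nu>"
      then obtain c where "u = cscale c v0" using wsp_highest[of u] wsp_V V_eq by blast
      then show "u \<in> cseq.span {v0}" by (simp add: cseq.span_scale cseq.span_base)
    qed
    show "cseq.span {v0} \<subseteq> wsp \<nu>" by (rule cseq.span_minimal) (use v0 subspace_wsp in auto)
  qed
  moreover have "cseq.independent {v0}" using v0(2) by simp
  ultimately show ?thesis using cseq.dim_eq_card[of "{v0}" "wsp \<nu>"] cseq.span_span by simp
qed

lemma leading_chr: "leading r chr \<nu>"
  unfolding leading_def
proof (intro conjI ballI)
  show "lk chr \<nu> = 1" using supp_\<nu> mult_\<nu> by (simp add: lookup_chr)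
  fix \<mu> assume "\<mu> \<in> Poly_Mapping.keys chr"
  then obtain x where "hw \<mu> x" using wts_hw keys_chr by blast
  then show "root_positive r (\<nu> - \<mu>)" using hw_pos by blast
qed

text \<open>\<open>T i j\<close> has the traces \<open>t i j \<mu>\<close> as coefficients; the two
  identities demanded of it are \<open>t_shift\<close> and \<open>trace_cas\<close>, read at a
  single exponent.\<close>

theorem weyl_character_formula:
  assumes 0: "(\<Sum>i=1..r. \<nu> i) = 0" and dom: "strictdom r (\<nu> + weyl_vector r)"
  shows "chr * weyl_product r = alt r (\<nu> + weyl_vector r)"
proof -
  define T where "T = (\<lambda>i j. \<Sum>\<mu>\<in>wts. Poly_Mapping.single \<mu> (t i j \<mu>))"
  have t0: "t i j \<mu> = 0" if "supported r \<mu>" "\<mu> \<notin> wts" for i j \<mu>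
  proof -
    have "bas \<mu> = {}" using bas(1,4)[of \<mu>] mult_outside[OF that] by simp
    then show ?thesis by (simp add: t_def tr_def)
  qed
  have lT: "lk (T i j) \<mu> = (if supported r \<mu> then t i j \<mu> else 0)" for i j \<mu>
  proof -
    have "lk (T i j) \<mu> = (if \<mu> \<in> wts then t i j \<mu> else 0)"
      using finite_wts by (simp add: T_def lookup_sum lookup_single when_def sum.delta)
    then show ?thesis using t0[of \<mu>] by (auto simp: wts_def)
  qed
  have lc: "lk (cmap chr) \<mu> = (if supported r \<mu> then of_nat (mult \<mu>) else 0)" for \<mu>
    by (simp add: lookup_cmap lookup_chr)
  obtain c where c: "\<And>v. v \<in> V \<Longrightarrow> cas v = cscale c v" by (rule cas_scalar) blast
  show ?thesis
  proof (rule character_times_denominator[where T = T and c = c])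
    fix i j assume ij: "(i, j) \<in> pairs r"
    then have r: "i \<in> {1..r}" "j \<in> {1..r}" "i \<noteq> j" by (auto simp: pairs_def)
    show "(monom1 (eps i) - monom1 (eps j)) * T i j = monom1 (eps j) * (weight_deriv i (cmap chr) - weight_deriv j (cmap chr))"
    proof (rule poly_mapping_eqI)
      fix \<mu>0
      \<comment> \<open>The two monomials on the left look up \<open>T\<close> at exponents that
        differ by the root, as in \<open>t_shift\<close>.\<close>
      define \<mu> where "\<mu> = \<mu>0 - eps j"
      have e: "\<mu>0 - eps i = \<mu> + (eps j - eps i)" by (simp add: \<mu>_def)
      have s: "supported r (\<mu> + (eps j - eps i)) \<longleftrightarrow> supported r \<mu>"
        using r by (auto simp: supported_def eps_def)
      show "lk ((monom1 (eps i) - monom1 (eps j)) * T i j) \<mu>0 = lk (monom1 (eps j) * (weight_deriv i (cmap chr) - weight_deriv j (cmap chr))) \<mu>0"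
        unfolding left_diff_distrib lookup_minus lookup_single_mult e \<mu>_def[symmetric] lookup_D lT lc s
        using t_shift[OF r, of \<mu>] by (simp add: of_rat_diff algebra_simps)
    qed
  next
    show "Cst c * cmap chr = (\<Sum>k=1..r. weight_deriv k (weight_deriv k (cmap chr)))
       + (\<Sum>(i, j)\<in>pairs r. weight_deriv i (cmap chr) - weight_deriv j (cmap chr) + 2 * T i j)"
    proof (rule poly_mapping_eqI)
      fix \<mu>
      have two: "lk (2 * x) \<mu> = 2 * lk x \<mu>" for x :: "weight \<Rightarrow>\<^sub>0 complex"
        using lookup_Cst_mult[of 2 x \<mu>] by (simp add: Cst_simps)
      have "lk ((\<Sum>k=1..r. weight_deriv k (weight_deriv k (cmap chr))) + (\<Sum>(i, j)\<in>pairs r. weight_deriv i (cmap chr) - weight_deriv j (cmap chr) + 2 * T i j)) \<mu>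
        = (\<Sum>k=1..r. of_rat (\<mu> k) * (of_rat (\<mu> k) * lk (cmap chr) \<mu>))
          + (\<Sum>(i, j)\<in>pairs r. of_rat (\<mu> i) * lk (cmap chr) \<mu> - of_rat (\<mu> j) * lk (cmap chr) \<mu> + 2 * lk (T i j) \<mu>)"
        by (simp add: lookup_add lookup_sum lookup_D split_def lookup_minus two)
      also have "\<dots> = c * lk (cmap chr) \<mu>"
      proof (cases "supported r \<mu>")
        case True
        have "(\<Sum>k=1..r. of_rat (\<mu> k) * (of_rat (\<mu> k) * of_nat (mult \<mu>))) = (of_rat (\<Sum>i=1..r. \<mu> i * \<mu> i) * of_nat (mult \<mu>) :: complex)"
          by (simp add: of_rat_sum of_rat_mult sum_distrib_right mult.assoc)
        then show ?thesis
          using True trace_cas[OF c, of \<mu>] by (simp add: lT lc of_rat_diff left_diff_distrib)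
      next
        case False
        then show ?thesis by (simp add: lT lc split_def)
      qed
      finally show "lk (Cst c * cmap chr) \<mu> = lk ((\<Sum>k=1..r. weight_deriv k (weight_deriv k (cmap chr)))
       + (\<Sum>(i, j)\<in>pairs r. weight_deriv i (cmap chr) - weight_deriv j (cmap chr) + 2 * T i j)) \<mu>"
        by (simp add: lookup_Cst_mult)
    qed
  next
    fix \<mu> assume m: "\<mu> \<in> Poly_Mapping.keys chr"
    then obtain x where "hw \<mu> x" using wts_hw keys_chr by blast
    then show "(\<Sum>i=1..r. \<mu> i) = 0" using hw_sum 0 by simp
    show "supported r \<mu>" using keys_chr[OF m] by (simp add: wts_def)
  qed (rule sym_chr leading_chr dom)+
qed

end

subsection \<open>The weight lattice\<close>

lemma weight_eqI:
  assumes "supported r u" "supported r v" "(\<Sum>i=1..r. u i) = (\<Sum>i=1..r. v i)"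
    and d: "\<And>k. k \<in> {1..<r} \<Longrightarrow> u k - u (k + 1) = v k - v (k + 1)"
  shows "u = v"
proof
  fix i
  have const: "1 \<le> i \<longrightarrow> i \<le> r \<longrightarrow> u i - v i = u 1 - v 1" for i
  proof (induction i)
    case (Suc i)
    show ?case
    proof (intro impI)
      assume "1 \<le> Suc i" "Suc i \<le> r"
      then show "u (Suc i) - v (Suc i) = u 1 - v 1"
        using Suc.IH d[of i] by (cases "i = 0") (auto simp: One_nat_def)
    qed
  qed simp
  show "u i = v i"
  proof (cases "i \<in> {1..r}")
    case True
    have "0 = (\<Sum>i=1..r. u i - v i)" using assms(3) by (simp add: sum_subtractf)
    also have "\<dots> = (\<Sum>i=1..r. u 1 - v 1)" by (intro sum.cong refl const[rule_format]) auto
    finally have "u 1 - v 1 = 0" using True by simp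
    then show ?thesis using const[of i] True by auto
  qed (use assms(1,2) in \<open>auto simp: supported_def\<close>)
qed

lemma fund_weight_apply:
  assumes "i \<in> {1..<r}"
  shows "fund_weight r i k = (if k \<in> {1..i} then (of_nat r - of_nat i) / of_nat r
    else if k \<in> {i+1..r} then - of_nat i / of_nat r else 0)"
  by (simp add: fund_weight_def wscale_def sum_fun_apply eps_def sum.delta)

lemma sum_fund_weight:
  assumes "i \<in> {1..<r}"
  shows "(\<Sum>k=1..r. fund_weight r i k) = 0"
proof -
  have S: "{1..r} = {1..i} \<union> {i+1..r}" using assms by auto
  have "(\<Sum>k=1..r. fund_weight r i k) = (\<Sum>k=1..i. (of_nat r - of_nat i) / of_nat r) + (\<Sum>k=i+1..r. - of_nat i / of_nat r)"
    unfolding S by (subst sum.union_disjoint) (auto simp: fund_weight_apply[OF assms] intro!: arg_cong2[of _ _ _ _ "(+)"] sum.cong)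
  also have "\<dots> = 0" using assms by (simp add: of_nat_diff field_simps)
  finally show ?thesis .
qed

text \<open>Fundamental weights are dual to simple roots, so the gap between neighbouring
  coordinates recovers the coefficient; support and coordinate sum supply the rest of a
  characterization.\<close>

lemma fund_weight_combination:
  fixes c :: "nat \<Rightarrow> rat" and r :: nat
  defines "S \<equiv> \<Sum>i=1..r-1. wscale (c i) (fund_weight r i)"
  shows "supported r S" "(\<Sum>k=1..r. S k) = 0" "k \<in> {1..<r} \<Longrightarrow> S k - S (k + 1) = c k"
proof -
  have app: "S k = (\<Sum>i=1..r-1. c i * fund_weight r i k)" for k
    by (simp add: S_def sum_fun_apply wscale_def)
  have ir: "i \<in> {1..<r}" if "i \<in> {1..r-1}" for i using that by auto
  have "fund_weight r i k = 0" if "i \<in> {1..r-1}" "k \<notin> {1..r}" for i k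
    using that unfolding fund_weight_apply[OF ir[OF that(1)]] by auto
  then show "supported r S" unfolding supported_def app by (intro allI impI sum.neutral ballI) simp
  have "(\<Sum>k=1..r. S k) = (\<Sum>i=1..r-1. c i * (\<Sum>k=1..r. fund_weight r i k))"
    unfolding app sum_distrib_left by (rule sum.swap)
  also have "\<dots> = 0" by (intro sum.neutral ballI) (simp add: sum_fund_weight[OF ir])
  finally show "(\<Sum>k=1..r. S k) = 0" .
  assume k: "k \<in> {1..<r}"
  have "fund_weight r i k - fund_weight r i (k + 1) = (if i = k then 1 else 0)" if "i \<in> {1..r-1}" for i
    using that k unfolding fund_weight_apply[OF ir[OF that(1)]] by (auto simp: field_simps)
  then have "S k - S (k + 1) = (\<Sum>i=1..r-1. c i * (if i = k then 1 else 0))"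
    unfolding app sum_subtractf[symmetric] right_diff_distrib[symmetric] by (intro sum.cong) auto
  also have "\<dots> = c k" using k by (simp add: if_distrib[of "\<lambda>x. _ * x"] sum.delta' cong: if_cong) linarith
  finally show "S k - S (k + 1) = c k" .
qed

lemma weight_lattice_iff:
  "\<mu> \<in> weight_lattice r \<longleftrightarrow>
     supported r \<mu> \<and> (\<Sum>i=1..r. \<mu> i) = 0 \<and> (\<forall>k\<in>{1..<r}. \<mu> k - \<mu> (k + 1) \<in> \<int>)"
proof
  assume "\<mu> \<in> weight_lattice r"
  then obtain c where "\<mu> = (\<Sum>i=1..r-1. wscale (of_int (c i)) (fund_weight r i))"
    unfolding weight_lattice_def by blast
  then show "supported r \<mu> \<and> (\<Sum>i=1..r. \<mu> i) = 0 \<and> (\<forall>k\<in>{1..<r}. \<mu> k - \<mu> (k + 1) \<in> \<int>)"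
    using fund_weight_combination[where c = "\<lambda>i. of_int (c i)" and r = r] by simp
next
  assume *: "supported r \<mu> \<and> (\<Sum>i=1..r. \<mu> i) = 0 \<and> (\<forall>k\<in>{1..<r}. \<mu> k - \<mu> (k + 1) \<in> \<int>)"
  define c where "c = (\<lambda>k. \<lfloor>\<mu> k - \<mu> (k + 1)\<rfloor>)"
  have "\<mu> = (\<Sum>i=1..r-1. wscale (of_int (c i)) (fund_weight r i))"
  proof (rule weight_eqI)
    fix k assume k: "k \<in> {1..<r}"
    then have "\<mu> k - \<mu> (k + 1) = of_int (c k)" using * by (simp add: c_def)
    then show "\<mu> k - \<mu> (k + 1) = (\<Sum>i=1..r-1. wscale (of_int (c i)) (fund_weight r i)) k - (\<Sum>i=1..r-1. wscale (of_int (c i)) (fund_weight r i)) (k + 1)"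
      unfolding fund_weight_combination(3)[OF k] .
  qed (use * fund_weight_combination[where c = "\<lambda>i. of_int (c i)" and r = r] in auto)
  then show "\<mu> \<in> weight_lattice r" unfolding weight_lattice_def by blast
qed

lemma dominant_weights_iff:
  "\<mu> \<in> dominant_weights r \<longleftrightarrow>
     supported r \<mu> \<and> (\<Sum>i=1..r. \<mu> i) = 0 \<and> (\<forall>k\<in>{1..<r}. \<mu> k - \<mu> (k + 1) \<in> \<nat>)"
proof
  assume "\<mu> \<in> dominant_weights r"
  then obtain c where "\<mu> = (\<Sum>i=1..r-1. wscale (of_nat (c i)) (fund_weight r i))"
    unfolding dominant_weights_def by blast
  then show "supported r \<mu> \<and> (\<Sum>i=1..r. \<mu> i) = 0 \<and> (\<forall>k\<in>{1..<r}. \<mu> k - \<mu> (k + 1) \<in> \<nat>)"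
    using fund_weight_combination[where c = "\<lambda>i. of_nat (c i)" and r = r] by simp
next
  assume *: "supported r \<mu> \<and> (\<Sum>i=1..r. \<mu> i) = 0 \<and> (\<forall>k\<in>{1..<r}. \<mu> k - \<mu> (k + 1) \<in> \<nat>)"
  define c where "c = (\<lambda>k. nat \<lfloor>\<mu> k - \<mu> (k + 1)\<rfloor>)"
  have "\<mu> = (\<Sum>i=1..r-1. wscale (of_nat (c i)) (fund_weight r i))"
  proof (rule weight_eqI)
    fix k assume k: "k \<in> {1..<r}"
    then have "\<mu> k - \<mu> (k + 1) \<in> \<nat>" using * by blast
    then obtain n where "\<mu> k - \<mu> (k + 1) = of_nat n" by (rule Nats_cases)
    then have "\<mu> k - \<mu> (k + 1) = of_nat (c k)" by (simp add: c_def)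
    then show "\<mu> k - \<mu> (k + 1) = (\<Sum>i=1..r-1. wscale (of_nat (c i)) (fund_weight r i)) k - (\<Sum>i=1..r-1. wscale (of_nat (c i)) (fund_weight r i)) (k + 1)"
      unfolding fund_weight_combination(3)[OF k] .
  qed (use * fund_weight_combination[where c = "\<lambda>i. of_nat (c i)" and r = r] in auto)
  then show "\<mu> \<in> dominant_weights r" unfolding dominant_weights_def by blast
qed

lemma dominant_strictdom:
  assumes "\<nu> \<in> dominant_weights r"
  shows "strictdom r (\<nu> + weyl_vector r)"
  unfolding strictdom_def
proof
  fix k assume k: "k \<in> {1..<r}"
  then have "\<nu> k - \<nu> (k + 1) \<in> \<nat>" using assms unfolding dominant_weights_iff by blast
  then obtain n where "\<nu> k - \<nu> (k + 1) = of_nat n" by (rule Nats_cases)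
  moreover have "weyl_vector r (k + 1) < weyl_vector r k"
    using strictdom_weyl_vector k by (simp add: strictdom_def)
  moreover have "(0::rat) \<le> of_nat n" by simp
  ultimately show "(\<nu> + weyl_vector r) (k + 1) < (\<nu> + weyl_vector r) k" unfolding plus_fun_apply by linarith
qed

lemma differences_Ints:
  fixes \<mu> :: "nat \<Rightarrow> rat"
  assumes d: "\<forall>k\<in>{1..<r}. \<mu> k - \<mu> (k + 1) \<in> \<int>" and ij: "i \<in> {1..r}" "j \<in> {1..r}"
  shows "\<mu> i - \<mu> j \<in> \<int>"
proof -
  have *: "1 \<le> i \<longrightarrow> i \<le> r \<longrightarrow> \<mu> 1 - \<mu> i \<in> \<int>" for i
  proof (induction i)
    case (Suc i)
    show ?case
    proof (intro impI)
      assume "1 \<le> Suc i" "Suc i \<le> r"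
      show "\<mu> 1 - \<mu> (Suc i) \<in> \<int>"
      proof (cases "i = 0")
        case True
        then show ?thesis by (simp add: One_nat_def)
      next
        case False
        then have "\<mu> 1 - \<mu> i \<in> \<int>" "\<mu> i - \<mu> (i + 1) \<in> \<int>" using Suc d \<open>Suc i \<le> r\<close> by auto
        then have "(\<mu> 1 - \<mu> i) + (\<mu> i - \<mu> (i + 1)) \<in> \<int>" by (rule Ints_add)
        then show ?thesis by (simp add: Suc_eq_plus1 del: add_Suc_right)
      qed
    qed
  qed simp
  have "\<mu> 1 - \<mu> i \<in> \<int>" "\<mu> 1 - \<mu> j \<in> \<int>" using *[of i] *[of j] ij by simp_all
  then have "(\<mu> 1 - \<mu> j) - (\<mu> 1 - \<mu> i) \<in> \<int>" by (rule Ints_diff[rotated])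
  then show ?thesis by simp
qed

subsection \<open>Traceless matrix units\<close>

text \<open>Removing 1/r of the identity on the diagonal puts all matrix units into
  \<open>sl r\<close>, so a module over \<open>sl\<^sub>r\<close> can be handled with the symmetric
  index conventions of \<open>gl\<^sub>r\<close>. Subscripts start at 1, matrix indices at
  0.\<close>

definition E :: "nat \<Rightarrow> nat \<Rightarrow> nat \<Rightarrow> complex mat" where
  "E r i j = mat r r (\<lambda>(a, b). (if a + 1 = i \<and> b + 1 = j then 1 else 0) - (if a = b \<and> i = j then 1 / of_nat r else 0))"

lemma E_carrier [simp]: "E r i j \<in> carrier_mat r r"
  by (simp add: E_def)

lemma E_index: "a < r \<Longrightarrow> b < r \<Longrightarrow>
  E r i j $$ (a, b) = (if a + 1 = i \<and> b + 1 = j then 1 else 0) - (if a = b \<and> i = j then 1 / of_nat r else 0)"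
  by (simp add: E_def)

lemma slI: "X \<in> carrier_mat r r \<Longrightarrow> (\<Sum>i<r. X $$ (i, i)) = 0 \<Longrightarrow> X \<in> sl r"
  by (simp add: sl_def)

lemma E_sl:
  assumes "i \<in> {1..r}" "j \<in> {1..r}"
  shows "E r i j \<in> sl r"
proof (rule slI)
  have "(\<Sum>a<r. E r i j $$ (a, a)) = (\<Sum>a<r. (if a = i - 1 then (if i = j then 1 else 0) else 0) - (if i = j then 1 / of_nat r else 0))"
    using assms by (intro sum.cong refl) (auto simp: E_index)
  also have "\<dots> = 0"
    using assms by (simp add: sum_subtractf sum.delta) linarith
  finally show "(\<Sum>a<r. E r i j $$ (a, a)) = 0" .
qed simp

lemma E_mult_index:
  assumes ij: "i \<in> {1..r}" "j \<in> {1..r}" "k \<in> {1..r}" "l \<in> {1..r}" and ab: "a < r" "b < r"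
  shows "(E r i j * E r k l) $$ (a, b) =
     (if a + 1 = i \<and> b + 1 = l \<and> j = k then 1 else 0)
   - (if a + 1 = i \<and> b + 1 = j \<and> k = l then 1 / of_nat r else 0)
   - (if a + 1 = k \<and> b + 1 = l \<and> i = j then 1 / of_nat r else 0)
   + (if a = b \<and> i = j \<and> k = l then 1 / of_nat r * (1 / of_nat r) else 0)"
proof -
  define p q s t where "p = (if a + 1 = i then 1 else 0 :: complex)" and "q = (if b + 1 = l then 1 else 0 :: complex)"
    and "s = (if i = j then 1 / of_nat r else 0 :: complex)" and "t = (if k = l then 1 / of_nat r else 0 :: complex)"
  have "(E r i j * E r k l) $$ (a, b) = (\<Sum>c<r. E r i j $$ (a, c) * E r k l $$ (c, b))"
    using ab by (simp add: scalar_prod_def lessThan_atLeast0 E_def)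
  also have "\<dots> = (\<Sum>c<r. (if c = j - 1 then (if c = k - 1 then p * q else 0) else 0) - (if c = j - 1 then (if c = b then p * t else 0) else 0)
      - (if c = a then (if c = k - 1 then s * q else 0) else 0) + (if c = a then (if c = b then s * t else 0) else 0))"
  proof (rule sum.cong[OF refl])
    fix c assume c: "c \<in> {..<r}"
    have if_mult: "(if P then x else 0) * (if Q then y else 0) = (if P then (if Q then x * y else 0) else 0)"
      for P Q and x y :: complex by simp
    have distrib: "(x - y) * (z - w) = x * z - x * w - y * z + y * w" for x y z w :: complex
      by (simp add: algebra_simps)
    have "E r i j $$ (a, c) = (if c = j - 1 then p else 0) - (if c = a then s else 0)"
      using ij ab c by (auto simp: E_index p_def s_def)
    moreover have "E r k l $$ (c, b) = (if c = k - 1 then q else 0) - (if c = b then t else 0)"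
      using ij ab c by (auto simp: E_index q_def t_def)
    ultimately show "E r i j $$ (a, c) * E r k l $$ (c, b) = (if c = j - 1 then (if c = k - 1 then p * q else 0) else 0) - (if c = j - 1 then (if c = b then p * t else 0) else 0)
      - (if c = a then (if c = k - 1 then s * q else 0) else 0) + (if c = a then (if c = b then s * t else 0) else 0)"
      by (simp only: distrib if_mult)
  qed
  also have "\<dots> = (if j - 1 = k - 1 then p * q else 0) - (if j - 1 = b then p * t else 0) - (if a = k - 1 then s * q else 0) + (if a = b then s * t else 0)"
  proof -
    have "j - 1 < r" "k - 1 < r" using ij by auto
    then show ?thesis using ab by (simp add: sum.distrib sum_subtractf sum.delta del: if_split)
  qed
  also have "\<dots> = (if a + 1 = i \<and> b + 1 = l \<and> j = k then 1 else 0)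
   - (if a + 1 = i \<and> b + 1 = j \<and> k = l then 1 / of_nat r else 0)
   - (if a + 1 = k \<and> b + 1 = l \<and> i = j then 1 / of_nat r else 0)
   + (if a = b \<and> i = j \<and> k = l then 1 / of_nat r * (1 / of_nat r) else 0)"
  proof -
    have "(if j - 1 = k - 1 then p * q else 0) = (if a + 1 = i \<and> b + 1 = l \<and> j = k then 1 else 0)"
      using ij by (auto simp: p_def q_def)
    moreover have "(if j - 1 = b then p * t else 0) = (if a + 1 = i \<and> b + 1 = j \<and> k = l then 1 / of_nat r else 0)"
      using ij by (auto simp: p_def t_def)
    moreover have "(if a = k - 1 then s * q else 0) = (if a + 1 = k \<and> b + 1 = l \<and> i = j then 1 / of_nat r else 0)"
      using ij by (auto simp: s_def q_def)
    moreover have "(if a = b then s * t else 0) = (if a = b \<and> i = j \<and> k = l then 1 / of_nat r * (1 / of_nat r) else 0)"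
      by (auto simp: s_def t_def)
    ultimately show ?thesis by (simp only:)
  qed
  finally show ?thesis .
qed

text \<open>The identity is central, so the left side is the ordinary bracket of matrix units; on
  the right, corrections occur only when both terms are present, and cancel. The scalars 0, 1 and -1
  put the right side in a form for \<open>add_act\<close> and \<open>scale_act\<close>.\<close>

lemma E_bracket:
  assumes ij: "i \<in> {1..r}" "j \<in> {1..r}" "k \<in> {1..r}" "l \<in> {1..r}"
  shows "E r i j * E r k l - E r k l * E r i j =
     (if j = k then 1 else 0) \<cdot>\<^sub>m E r i l + (if i = l then - 1 else 0) \<cdot>\<^sub>m E r k j"
proof (rule eq_matI)
  fix a b assume "a < dim_row ((if j = k then 1 else 0) \<cdot>\<^sub>m E r i l + (if i = l then - 1 else 0) \<cdot>\<^sub>m E r k j)"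
    "b < dim_col ((if j = k then 1 else 0) \<cdot>\<^sub>m E r i l + (if i = l then - 1 else 0) \<cdot>\<^sub>m E r k j)"
  then have ab: "a < r" "b < r" by (simp_all add: E_def)
  have "(E r i j * E r k l - E r k l * E r i j) $$ (a, b) = (E r i j * E r k l) $$ (a, b) - (E r k l * E r i j) $$ (a, b)"
    using ab by (simp add: E_def)
  moreover have "((if j = k then 1 else 0) \<cdot>\<^sub>m E r i l + (if i = l then - 1 else 0) \<cdot>\<^sub>m E r k j) $$ (a, b)
     = (if j = k then 1 else 0) * E r i l $$ (a, b) + (if i = l then - 1 else 0) * E r k j $$ (a, b)"
    using ab by (simp add: E_def)
  ultimately show "(E r i j * E r k l - E r k l * E r i j) $$ (a, b) =
     ((if j = k then 1 else 0) \<cdot>\<^sub>m E r i l + (if i = l then - 1 else 0) \<cdot>\<^sub>m E r k j) $$ (a, b)"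
    unfolding E_mult_index[OF ij ab] E_mult_index[OF ij(3,4,1,2) ab] E_index[OF ab]
    by (cases "j = k"; cases "i = l"; cases "i = j"; cases "k = l"; simp del: if_split)
qed (simp_all add: E_def)

text \<open>A module acts on V only, while \<open>gl_rep\<close> asks for operators linear on all
  sequences; prescribing the values on a basis of V supplies them.\<close>

lemma clinear_extension:
  assumes "cseq.subspace V" "\<And>u v. u \<in> V \<Longrightarrow> v \<in> V \<Longrightarrow> f (u + v) = f u + f v"
    "\<And>c v. v \<in> V \<Longrightarrow> f (cscale c v) = cscale c (f v)"
  shows "\<exists>g. clinear g \<and> (\<forall>v\<in>V. g v = f v)"
proof -
  obtain B where B: "B \<subseteq> V" "cseq.independent B" "V \<subseteq> cseq.span B" "card B = cseq.dim V"
    by (rule cseq.basis_exists)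
  have span: "cseq.span B = V" using B assms(1) by (metis cseq.span_minimal subset_antisym)
  define g where "g = csmap.construct B f"
  have lin: "clinear g" unfolding g_def by (rule csmap.linear_construct[OF B(2)])
  have "g v = f v \<and> v \<in> V" if "v \<in> cseq.span B" for v
    using that
  proof (induction rule: cseq.span_induct_alt)
    case base
    have "0 \<in> V" by (rule cseq.subspace_0[OF assms(1)])
    then have "f 0 = 0" using assms(3)[of 0 0] by simp
    then show "g 0 = f 0 \<and> 0 \<in> V" using \<open>0 \<in> V\<close> by (simp add: clinear_simps[OF lin])
  next
    case (step c x y)
    have x: "x \<in> V" using step B by blast
    have y: "g y = f y" "y \<in> V" using step by auto
    have "g x = f x" unfolding g_def by (rule csmap.construct_basis[OF B(2) step(1)])
    moreover have cx: "cscale c x \<in> V" by (rule cseq.subspace_scale[OF assms(1) x])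
    moreover have "f (cscale c x + y) = cscale c (f x) + f y"
      unfolding assms(2)[OF cx y(2)] assms(3)[OF x] ..
    moreover have "cscale c x + y \<in> V" by (rule cseq.subspace_add[OF assms(1) cx y(2)])
    ultimately show "g (cscale c x + y) = f (cscale c x + y) \<and> cscale c x + y \<in> V"
      using y(1) by (simp add: clinear_simps[OF lin])
  qed
  then show ?thesis using lin span by blast
qed

subsection \<open>Irreducible modules and their characters\<close>

context sl_module
begin

lemma zero_matrix_act: "v \<in> V \<Longrightarrow> \<rho> (0\<^sub>m r r) v = 0"
proof -
  assume v: "v \<in> V"
  have 0: "0\<^sub>m r r \<in> sl r" by (rule slI) auto
  have "(0::complex) \<cdot>\<^sub>m 0\<^sub>m r r = (0\<^sub>m r r :: complex mat)" by (rule eq_matI) auto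
  then show ?thesis using scale_act[OF 0 v, of 0] by (metis cseq.scale_zero_left)
qed

text \<open>X is the combination of traceless units with its own entries as coefficients, because
  the diagonal corrections add up to the trace of X over r, which is 0. Partial sums are kept inside
  \<open>sl r\<close>, where additivity of the action is available.\<close>

lemma act_expand:
  assumes X: "X \<in> sl r" and v: "v \<in> V"
  shows "\<rho> X v = (\<Sum>i=1..r. \<Sum>j=1..r. cscale (X $$ (i - 1, j - 1)) (\<rho> (E r i j) v))"
proof -
  let ?M = "\<lambda>A. mat r r (\<lambda>ab. \<Sum>(i, j)\<in>A. X $$ (i - 1, j - 1) * E r i j $$ ab)"
  have *: "?M A \<in> sl r \<and> \<rho> (?M A) v = (\<Sum>(i, j)\<in>A. cscale (X $$ (i - 1, j - 1)) (\<rho> (E r i j) v))"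
    if "finite A" "A \<subseteq> {1..r} \<times> {1..r}" for A
    using that
  proof (induction A)
    case empty
    have "?M {} = 0\<^sub>m r r" by (rule eq_matI) auto
    then show ?case using zero_matrix_act[OF v] by (auto intro: slI)
  next
    case (insert q A)
    obtain i j where q: "q = (i, j)" by force
    have ij: "i \<in> {1..r}" "j \<in> {1..r}" using insert.prems q by auto
    let ?c = "X $$ (i - 1, j - 1)"
    have IH: "?M A \<in> sl r" "\<rho> (?M A) v = (\<Sum>(i, j)\<in>A. cscale (X $$ (i - 1, j - 1)) (\<rho> (E r i j) v))"
      using insert by auto
    have eq: "?M (insert q A) = ?c \<cdot>\<^sub>m E r i j + ?M A"
      using insert.hyps by (intro eq_matI) (auto simp: q E_def)
    have s1: "?c \<cdot>\<^sub>m E r i j \<in> sl r"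
    proof (rule slI)
      have "(\<Sum>a<r. (?c \<cdot>\<^sub>m E r i j) $$ (a, a)) = ?c * (\<Sum>a<r. E r i j $$ (a, a))"
        unfolding sum_distrib_left by (rule sum.cong) (auto simp: E_def)
      also have "\<dots> = 0" using E_sl[OF ij] by (simp add: sl_def)
      finally show "(\<Sum>a<r. (?c \<cdot>\<^sub>m E r i j) $$ (a, a)) = 0" .
    qed simp
    have s2: "?c \<cdot>\<^sub>m E r i j + ?M A \<in> sl r"
    proof (rule slI)
      have "(\<Sum>a<r. (?c \<cdot>\<^sub>m E r i j + ?M A) $$ (a, a)) = (\<Sum>a<r. (?c \<cdot>\<^sub>m E r i j) $$ (a, a)) + (\<Sum>a<r. ?M A $$ (a, a))"
        unfolding sum.distrib[symmetric] by (rule sum.cong) (auto simp: E_def)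
      also have "\<dots> = 0" using s1 IH(1) by (simp add: sl_def)
      finally show "(\<Sum>a<r. (?c \<cdot>\<^sub>m E r i j + ?M A) $$ (a, a)) = 0" .
    qed simp
    have "\<rho> (?M (insert q A)) v = \<rho> (?c \<cdot>\<^sub>m E r i j) v + \<rho> (?M A) v"
      unfolding eq by (rule add_act[OF s1 IH(1) v])
    also have "\<rho> (?c \<cdot>\<^sub>m E r i j) v = cscale ?c (\<rho> (E r i j) v)"
      by (rule scale_act[OF E_sl[OF ij] v])
    also have "cscale ?c (\<rho> (E r i j) v) + \<rho> (?M A) v = (\<Sum>(i, j)\<in>insert q A. cscale (X $$ (i - 1, j - 1)) (\<rho> (E r i j) v))"
      unfolding IH(2) by (subst sum.insert[OF insert.hyps]) (simp only: q prod.case)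
    finally show ?case using s2 eq by auto
  qed
  have "?M ({1..r} \<times> {1..r}) = X"
  proof (rule eq_matI)
    have Xc: "X \<in> carrier_mat r r" and X0: "(\<Sum>i<r. X $$ (i, i)) = 0" using X by (auto simp: sl_def)
    fix a b assume "a < dim_row X" "b < dim_col X"
    then have ab: "a < r" "b < r" using Xc by auto
    have "?M ({1..r} \<times> {1..r}) $$ (a, b) = (\<Sum>i=1..r. \<Sum>j=1..r. X $$ (i - 1, j - 1) * E r i j $$ (a, b))"
      using ab by (simp add: sum.cartesian_product)
    also have "\<dots> = (\<Sum>i<r. \<Sum>j<r. X $$ (i, j) * E r (Suc i) (Suc j) $$ (a, b))"
      by (simp add: One_nat_def sum.atLeast1_atMost_eq)
    also have "\<dots> = (\<Sum>i<r. \<Sum>j<r. (if j = b then (if i = a then X $$ (i, j) else 0) else 0)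
        - (if j = i then (if a = b then X $$ (i, j) / of_nat r else 0) else 0))"
      by (intro sum.cong refl) (auto simp: E_index[OF ab] right_diff_distrib)
    also have "\<dots> = (\<Sum>i<r. (if i = a then X $$ (i, b) else 0) - (if a = b then X $$ (i, i) / of_nat r else 0))"
      using ab by (intro sum.cong refl) (simp add: sum_subtractf sum.delta)
    also have "\<dots> = X $$ (a, b) - (if a = b then (\<Sum>i<r. X $$ (i, i)) / of_nat r else 0)"
      using ab by (simp add: sum_subtractf sum.delta sum_divide_distrib)
    finally show "?M ({1..r} \<times> {1..r}) $$ (a, b) = X $$ (a, b)" using X0 by simp
  qed (use X in \<open>auto simp: sl_def\<close>)
  then have "\<rho> X v = (\<Sum>(i, j)\<in>{1..r} \<times> {1..r}. cscale (X $$ (i - 1, j - 1)) (\<rho> (E r i j) v))"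
    using *[of "{1..r} \<times> {1..r}"] by simp
  then show ?thesis by (simp only: sum.cartesian_product)
qed

lemma E_commutator:
  assumes ij: "i \<in> {1..r}" "j \<in> {1..r}" "k \<in> {1..r}" "l \<in> {1..r}" and v: "v \<in> V"
  shows "\<rho> (E r i j) (\<rho> (E r k l) v) = \<rho> (E r k l) (\<rho> (E r i j) v)
     + ((if j = k then \<rho> (E r i l) v else 0) - (if i = l then \<rho> (E r k j) v else 0))"
proof -
  have sc: "c \<cdot>\<^sub>m E r a b \<in> sl r" if "a \<in> {1..r}" "b \<in> {1..r}" for a b c
  proof (rule slI)
    have "(\<Sum>x<r. (c \<cdot>\<^sub>m E r a b) $$ (x, x)) = c * (\<Sum>x<r. E r a b $$ (x, x))"
      unfolding sum_distrib_left by (rule sum.cong) (auto simp: E_def)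
    then show "(\<Sum>x<r. (c \<cdot>\<^sub>m E r a b) $$ (x, x)) = 0" using E_sl[OF that] by (simp add: sl_def)
  qed simp
  have "\<rho> (E r i j) (\<rho> (E r k l) v) - \<rho> (E r k l) (\<rho> (E r i j) v) = \<rho> (E r i j * E r k l - E r k l * E r i j) v"
    by (rule bracket[symmetric]) (use ij E_sl v in auto)
  also have "\<dots> = cscale (if j = k then 1 else 0) (\<rho> (E r i l) v) + cscale (if i = l then - 1 else 0) (\<rho> (E r k j) v)"
    unfolding E_bracket[OF ij] using ij v by (simp only: add_act[OF sc sc] scale_act[OF E_sl])
  also have "\<dots> = (if j = k then \<rho> (E r i l) v else 0) - (if i = l then \<rho> (E r k j) v else 0)"
    by (simp only: if_distrib[of "\<lambda>c. cscale c _"] if_distrib[of uminus] cseq.scale_zero_left cseq.scale_one cseq.scale_minus_left)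
       (simp split: if_splits)
  finally show ?thesis by (simp only: diff_eq_eq add.commute)
qed

text \<open>The diagonal correction contributes a multiple of the coordinate sum. On weights of sum
  zero the \<open>sl\<^sub>r\<close> weights therefore agree with the eigenvalues of the operators
  \<open>F i i\<close>.\<close>

lemma weight_eval_E:
  assumes "i \<in> {1..r}" "(\<Sum>k=1..r. \<mu> k) = 0"
  shows "weight_eval r \<mu> (E r i i) = of_rat (\<mu> i)"
proof -
  have "weight_eval r \<mu> (E r i i) = (\<Sum>k=1..r. (if k = i then of_rat (\<mu> k) else 0) - of_rat (\<mu> k) / of_nat r)"
    unfolding weight_eval_def by (intro sum.cong refl) (auto simp: E_index algebra_simps)
  also have "\<dots> = of_rat (\<mu> i) - of_rat (\<Sum>k=1..r. \<mu> k) / of_nat r"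
    using assms(1) by (simp add: sum_subtractf sum.delta of_rat_sum sum_divide_distrib)
  finally show ?thesis using assms(2) by simp
qed

end

text \<open>Stated for an arbitrary module, so that it applies to whichever one \<open>irrep\<close>
  selects. Irreducibility enters by forcing the span of the lowering words to be all of V.\<close>

lemma irreducible_module_character:
  assumes irr: "irreducible_sl_module r V \<rho>" and hw: "is_highest_weight r V \<rho> \<nu>"
    and dom: "\<nu> \<in> dominant_weights r"
  shows "module_character r V \<rho> * weyl_product r = alt r (\<nu> + weyl_vector r)"
proof -
  interpret irreducible_sl_module r V \<rho> by (rule irr)
  have \<nu>: "supported r \<nu>" "(\<Sum>i=1..r. \<nu> i) = 0" "\<forall>k\<in>{1..<r}. \<nu> k - \<nu> (k + 1) \<in> \<nat>"
    using dom by (auto simp: dominant_weights_iff)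
  have "\<forall>i j. \<exists>g. clinear g \<and> (i \<in> {1..r} \<longrightarrow> j \<in> {1..r} \<longrightarrow> (\<forall>v\<in>V. g v = \<rho> (E r i j) v))"
  proof (intro allI)
    fix i j
    show "\<exists>g. clinear g \<and> (i \<in> {1..r} \<longrightarrow> j \<in> {1..r} \<longrightarrow> (\<forall>v\<in>V. g v = \<rho> (E r i j) v))"
    proof (cases "i \<in> {1..r} \<and> j \<in> {1..r}")
      case True
      then show ?thesis
        using clinear_extension[OF subspace, of "\<rho> (E r i j)"] act_add[OF E_sl] act_scale[OF E_sl] by blast
    next
      case False
      have "clinear (\<lambda>v. v)" by (rule clinearI) auto
      then show ?thesis using False by blast
    qed
  qed
  then obtain F where F: "\<And>i j. clinear (F i j)"
    "\<And>i j v. i \<in> {1..r} \<Longrightarrow> j \<in> {1..r} \<Longrightarrow> v \<in> V \<Longrightarrow> F i j v = \<rho> (E r i j) v"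
    by metis
  interpret gl_rep r V F
  proof (rule gl_rep.intro)
    show "F i j v \<in> V" if "i \<in> {1..r}" "j \<in> {1..r}" "v \<in> V" for i j v
      using that closed[OF E_sl] by (simp add: F(2))
    show "F i j (F k l v) = F k l (F i j v) + ((if j = k then F i l v else 0) - (if i = l then F k j v else 0))"
      if "i \<in> {1..r}" "j \<in> {1..r}" "k \<in> {1..r}" "l \<in> {1..r}" "v \<in> V" for i j k l v
      using E_commutator[OF that] that closed[OF E_sl] by (simp only: F(2))
  qed (rule subspace F(1))+
  have diag: "diagonal_mat (E r i i)" for i
    by (auto simp: diagonal_mat_def E_def)
  have wsp_eq: "wsp \<mu> = weight_space r V \<rho> \<mu>" if 0: "(\<Sum>k=1..r. \<mu> k) = 0" for \<mu>
  proof
    show "weight_space r V \<rho> \<mu> \<subseteq> wsp \<mu>"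
      using weight_eval_E[OF _ 0] diag E_sl by (auto simp: weight_space_def wsp_def F(2))
    show "wsp \<mu> \<subseteq> weight_space r V \<rho> \<mu>"
    proof
      fix v assume v: "v \<in> wsp \<mu>"
      have "\<rho> X v = cscale (weight_eval r \<mu> X) v" if X: "X \<in> sl r" "diagonal_mat X" for X
      proof -
        have vV: "v \<in> V" using v by (rule wspD)
        have off: "X $$ (i - 1, j - 1) = 0" if "i \<in> {1..r}" "j \<in> {1..r}" "j \<noteq> i" for i j
        proof -
          have "i - 1 \<noteq> j - 1" "i - 1 < r" "j - 1 < r" using that by auto
          then show ?thesis using X unfolding diagonal_mat_def sl_def by auto
        qed
        have "\<rho> X v = (\<Sum>i=1..r. \<Sum>j=1..r. if j = i then cscale (X $$ (i - 1, i - 1)) (\<rho> (E r i i) v) else 0)"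
          unfolding act_expand[OF X(1) vV] by (intro sum.cong refl) (auto simp: off)
        also have "\<dots> = (\<Sum>i=1..r. cscale (X $$ (i - 1, i - 1)) (\<rho> (E r i i) v))"
          by (intro sum.cong refl) (simp add: sum.delta)
        also have "\<dots> = (\<Sum>i=1..r. cscale (of_rat (\<mu> i) * X $$ (i - 1, i - 1)) v)"
          by (intro sum.cong refl) (simp add: F(2)[symmetric] vV wspD(2)[OF v] mult.commute)
        also have "\<dots> = cscale (weight_eval r \<mu> X) v"
          by (simp only: weight_eval_def cseq.scale_sum_left)
        finally show ?thesis .
      qed
      then show "v \<in> weight_space r V \<rho> \<mu>" using wspD(1)[OF v] by (simp add: weight_space_def)
    qed
  qed
  obtain v0 where v0: "v0 \<in> weight_space r V \<rho> \<nu>" "v0 \<noteq> 0"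
     "\<And>X. X \<in> carrier_mat r r \<Longrightarrow> (\<forall>i<r. \<forall>j\<le>i. X $$ (i, j) = 0) \<Longrightarrow> \<rho> X v0 = 0"
    using hw unfolding is_highest_weight_def by blast
  have v0V: "v0 \<in> V" using v0(1) by (simp add: weight_space_def)
  interpret hw_vector r V F \<nu> v0
  proof
    show "v0 \<in> wsp \<nu>" using v0(1) wsp_eq[OF \<nu>(2)] by simp
    show "F i j v0 = 0" if "(i, j) \<in> pairs r" for i j
    proof -
      have "\<rho> (E r i j) v0 = 0" using that by (intro v0(3)) (auto simp: E_index pairs_def)
      then show ?thesis using that v0V by (auto simp: F(2) pairs_def)
    qed
  qed (rule v0 \<nu>)+
  have "v0 \<in> H" unfolding H_def by (blast intro: hword.base)
  then have "cseq.span H \<noteq> {0}" using v0(2) cseq.span_base by fastforce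
  moreover have "\<rho> X v \<in> cseq.span H" if "X \<in> sl r" "v \<in> cseq.span H" for X v
  proof -
    have vV: "v \<in> V" using that(2) span_H_V by blast
    have "\<rho> X v = (\<Sum>i=1..r. \<Sum>j=1..r. cscale (X $$ (i - 1, j - 1)) (F i j v))"
      unfolding act_expand[OF that(1) vV] by (intro sum.cong refl) (simp add: F(2) vV)
    then show ?thesis using F_span[OF that(2)] by (auto intro!: cseq.span_sum cseq.span_scale)
  qed
  ultimately have VH: "cseq.span H = V"
    using irreducible[OF cseq.subspace_span span_H_V] by blast
  interpret hw_module r V F \<nu> v0
  proof
    show "V = cseq.span H" using VH by simp
    show "\<exists>B. finite B \<and> cseq.span B = V" by (rule finite_dimensional)
    show "\<nu> i - \<nu> j \<in> \<int>" if "i \<in> {1..r}" "j \<in> {1..r}" for i j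
      by (rule differences_Ints[OF _ that]) (use \<nu>(3) Nats_subset_Ints in blast)
  qed
  \<comment> \<open>Lowering words keep the coordinate sum 0, so no weight escapes the lattice over
    which \<open>module_character\<close> sums.\<close>
  have lat: "\<mu> \<in> weight_lattice r" if m: "\<mu> \<in> wts" for \<mu>
  proof -
    obtain x where "hw \<mu> x" by (rule wts_hw[OF m])
    then have "(\<Sum>i=1..r. \<mu> i) = 0" using hw_sum \<nu>(2) by simp
    then show ?thesis using m wts_Ints[OF m] by (auto simp: weight_lattice_iff wts_def)
  qed
  have "module_character r V \<rho> = chr"
    unfolding module_character_def chr_def
  proof (rule sum.cong)
    have ws: "weight_space r V \<rho> \<mu> = wsp \<mu>" if "\<mu> \<in> weight_lattice r" for \<mu>
      by (rule wsp_eq[symmetric]) (use that in \<open>simp add: weight_lattice_iff\<close>)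
    show "{\<mu> \<in> weight_lattice r. weight_space r V \<rho> \<mu> \<noteq> {0}} = wts"
    proof (rule Set.set_eqI)
      fix \<mu>
      show "\<mu> \<in> {\<mu> \<in> weight_lattice r. weight_space r V \<rho> \<mu> \<noteq> {0}} \<longleftrightarrow> \<mu> \<in> wts"
      proof
        assume "\<mu> \<in> {\<mu> \<in> weight_lattice r. weight_space r V \<rho> \<mu> \<noteq> {0}}"
        then have "\<mu> \<in> weight_lattice r" "wsp \<mu> \<noteq> {0}" using ws by auto
        then show "\<mu> \<in> wts" by (simp add: wts_def weight_lattice_iff)
      next
        assume m: "\<mu> \<in> wts"
        then have "wsp \<mu> \<noteq> {0}" by (simp add: wts_def)
        then show "\<mu> \<in> {\<mu> \<in> weight_lattice r. weight_space r V \<rho> \<mu> \<noteq> {0}}"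
          using lat[OF m] ws[OF lat[OF m]] by simp
      qed
    qed
    show "Poly_Mapping.single \<mu> (int (cseq.dim (weight_space r V \<rho> \<mu>))) = Poly_Mapping.single \<mu> (int (mult \<mu>))"
      if "\<mu> \<in> wts" for \<mu>
      unfolding ws[OF lat[OF that]] ..
  qed
  then show ?thesis using weyl_character_formula[OF \<nu>(2) dominant_strictdom[OF dom]] by simp
qed

subsection \<open>Fermionic creation and annihilation operators\<close>

text \<open>The Jordan-Wigner sign, the parity of the occupied modes below k. A basis state is a
  natural number whose binary digits are the occupation numbers.\<close>

definition sg :: "nat \<Rightarrow> nat \<Rightarrow> complex" where
  "sg k n = (- 1) ^ card {l. l < k \<and> bit n l}"

text \<open>Operators act on coefficient functions: the value at a state n comes from the state with
  bit k switched, so removing a particle reads v at \<open>set_bit k n\<close>.\<close>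

definition ann :: "nat \<Rightarrow> cseq \<Rightarrow> cseq" where
  "ann k v = (\<lambda>n. if bit n k then 0 else sg k n * v (set_bit k n))"

definition cre :: "nat \<Rightarrow> cseq \<Rightarrow> cseq" where
  "cre k v = (\<lambda>n. if bit n k then sg k n * v (unset_bit k n) else 0)"

lemma clinear_ann: "clinear (ann k)"
  by (rule clinearI) (auto simp: ann_def cscale_def fun_eq_iff algebra_simps)

lemma clinear_cre: "clinear (cre k)"
  by (rule clinearI) (auto simp: cre_def cscale_def fun_eq_iff algebra_simps)

lemma sg_square [simp]: "sg k n * sg k n = 1" "sg k n * (sg k n * x) = x"
  by (simp_all add: sg_def power_mult_distrib[symmetric] mult.assoc[symmetric])

lemma cnj_sg [simp]: "cnj (sg k n) = sg k n"
  by (simp add: sg_def)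

lemma sg_set_bit:
  assumes "\<not> bit n k"
  shows "sg l (set_bit k n) = (if k < l then - sg l n else sg l n)"
proof (cases "k < l")
  case True
  have "{m. m < l \<and> bit (set_bit k n) m} = insert k {m. m < l \<and> bit n m}"
    using True by (auto simp: bit_set_bit_iff)
  then show ?thesis using True assms by (simp add: sg_def)
next
  case False
  then have "{m. m < l \<and> bit (set_bit k n) m} = {m. m < l \<and> bit n m}"
    by (auto simp: bit_set_bit_iff)
  then show ?thesis using False by (simp add: sg_def)
qed

lemma sg_unset_bit:
  assumes "bit n k"
  shows "sg l (unset_bit k n) = (if k < l then - sg l n else sg l n)"
proof -
  have n: "set_bit k (unset_bit k n) = n"
    using assms by (intro bit_eqI) (auto simp: bit_set_bit_iff bit_unset_bit_iff)
  have "sg l n = (if k < l then - sg l (unset_bit k n) else sg l (unset_bit k n))"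
    using sg_set_bit[of "unset_bit k n" k l] by (simp add: n bit_unset_bit_iff)
  then show ?thesis by auto
qed

lemma set_unset_bit: "bit n k \<Longrightarrow> set_bit k (unset_bit k n) = (n::nat)"
  "\<not> bit n k \<Longrightarrow> unset_bit k (set_bit k n) = (n::nat)"
  by (intro bit_eqI; auto simp: bit_set_bit_iff bit_unset_bit_iff)+

lemma set_set_bit_commute: "set_bit k (set_bit l n) = set_bit l (set_bit k (n::nat))"
  and unset_unset_bit_commute: "unset_bit k (unset_bit l n) = unset_bit l (unset_bit k (n::nat))"
  and set_unset_bit_commute: "k \<noteq> l \<Longrightarrow> set_bit k (unset_bit l n) = unset_bit l (set_bit k (n::nat))"
  by (intro bit_eqI; auto simp: bit_set_bit_iff bit_unset_bit_iff)+

text \<open>With the next two lemmas, the canonical anticommutation relations.\<close>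

lemma ann_cre: "ann k (cre l v) = (if k = l then v else 0) - cre l (ann k v)"
proof
  fix n
  show "ann k (cre l v) n = ((if k = l then v else 0) - cre l (ann k v)) n"
  proof (cases "k = l")
    case True
    then show ?thesis
      by (cases "bit n k") (auto simp: ann_def cre_def bit_set_bit_iff bit_unset_bit_iff sg_set_bit sg_unset_bit set_unset_bit)
  next
    case False
    then show ?thesis
      by (cases "bit n k"; cases "bit n l"; cases "k < l")
        (auto simp: ann_def cre_def bit_set_bit_iff bit_unset_bit_iff sg_set_bit sg_unset_bit set_unset_bit_commute)
  qed
qed

lemma cre_cre: "cre k (cre l v) = - cre l (cre k v)"
proof
  fix n
  show "cre k (cre l v) n = (- cre l (cre k v)) n"
    by (cases "k = l"; cases "bit n k"; cases "bit n l"; cases "k < l")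
      (auto simp: cre_def bit_unset_bit_iff sg_unset_bit unset_unset_bit_commute[of k l])
qed

lemma ann_ann: "ann k (ann l v) = - ann l (ann k v)"
proof
  fix n
  show "ann k (ann l v) n = (- ann l (ann k v)) n"
    by (cases "k = l"; cases "bit n k"; cases "bit n l"; cases "k < l")
      (auto simp: ann_def bit_set_bit_iff sg_set_bit set_set_bit_commute[of k l])
qed

text \<open>Both products are brought to the order with creators on the left. The quartic parts
  agree after two anticommutations, and the contractions left over are the structure constants of
  \<open>gl\<^sub>r\<close>.\<close>

lemma cre_ann_commutator:
  "cre a (ann b (cre c (ann d v))) = cre c (ann d (cre a (ann b v)))
     + ((if b = c then cre a (ann d v) else 0) - (if a = d then cre c (ann b v) else 0))"
proof -
  have 1: "cre a (ann b (cre c (ann d v))) = (if b = c then cre a (ann d v) else 0) - cre a (cre c (ann b (ann d v)))"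
    for a b c d
    unfolding ann_cre[of b c] clinear_simps[OF clinear_cre] by (auto simp: clinear_simps[OF clinear_cre])
  have 2: "cre c (cre a (ann d (ann b v))) = cre a (cre c (ann b (ann d v)))"
    unfolding cre_cre[of c a] ann_ann[of d b] by (simp add: clinear_simps[OF clinear_cre])
  show ?thesis unfolding 1 2 by auto
qed

lemma cre_ann_same: "cre k (ann k v) n = (if bit n k then v n else 0)"
  by (auto simp: cre_def ann_def bit_unset_bit_iff sg_unset_bit set_unset_bit)

lemma exists_nat_bits:
  assumes "finite S"
  shows "\<exists>n::nat. \<forall>k. bit n k \<longleftrightarrow> k \<in> S"
  using assms
proof (induction S)
  case empty
  then show ?case by (intro exI[of _ 0]) auto
next
  case (insert x S)
  then obtain n :: nat where "\<forall>k. bit n k \<longleftrightarrow> k \<in> S" by blast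
  then show ?case by (intro exI[of _ "set_bit x n"]) (auto simp: bit_set_bit_iff)
qed

subsection \<open>Irreducible modules inside the fermionic Fock space\<close>

text \<open>Mode \<open>(m, i)\<close>, the basis vector \<open>i\<close> of the \<open>m\<close>-th tensor factor \<open>\<Lambda>(\<complex>\<^sup>r)\<close>, is encoded as bit
  \<open>m r + (i - 1)\<close>. The highest weight vector is the state whose occupied modes are the boxes of
  the Young diagram with row lengths \<open>lam\<close>.\<close>

locale fock =
  fixes r M :: nat and lam :: "nat \<Rightarrow> nat"
  assumes r_pos: "r > 0"
    and lam_mono: "(i, j) \<in> pairs r \<Longrightarrow> lam j \<le> lam i"
    and lam_le: "i \<in> {1..r} \<Longrightarrow> lam i \<le> M"
begin

definition md :: "nat \<Rightarrow> nat \<Rightarrow> nat" where "md m i = m * r + (i - 1)"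

lemma md_inj: "i \<in> {1..r} \<Longrightarrow> j \<in> {1..r} \<Longrightarrow> md m i = md m' j \<longleftrightarrow> m = m' \<and> i = j"
proof
  assume ij: "i \<in> {1..r}" "j \<in> {1..r}" and eq: "md m i = md m' j"
  have "md m i div r = m" "md m i mod r = i - 1" "md m' j div r = m'" "md m' j mod r = j - 1"
  proof -
    obtain a b where "i = Suc a" "a < r" "j = Suc b" "b < r"
      using ij by (cases i; cases j) auto
    then show "md m i div r = m" "md m i mod r = i - 1" "md m' j div r = m'" "md m' j mod r = j - 1"
      by (simp_all add: md_def)
  qed
  then have "m = m'" "i - 1 = j - 1" using eq by metis+
  then show "m = m' \<and> i = j" using ij by auto
qed simp

lemma md_less: "m < M \<Longrightarrow> i \<in> {1..r} \<Longrightarrow> md m i < M * r"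
proof -
  assume "m < M" "i \<in> {1..r}"
  obtain a where "i = Suc a" "a < r" using \<open>i \<in> {1..r}\<close> by (cases i) auto
  then have "md m i < (m + 1) * r" by (simp add: md_def add_mult_distrib)
  also have "\<dots> \<le> M * r" using \<open>m < M\<close> by (intro mult_right_mono) auto
  finally show ?thesis .
qed

text \<open>The matrix unit acting on the M exterior algebra factors at once.\<close>

definition F :: "nat \<Rightarrow> nat \<Rightarrow> cseq \<Rightarrow> cseq" where
  "F i j v = (\<Sum>m<M. cre (md m i) (ann (md m j) v))"

lemma clinear_F: "clinear (F i j)"
  by (rule clinearI)
    (simp_all only: F_def clinear_simps[OF clinear_ann] clinear_simps[OF clinear_cre] sum.distrib cseq.scale_sum_right)

lemma F_comm:
  assumes ij: "i \<in> {1..r}" "j \<in> {1..r}" "k \<in> {1..r}" "l \<in> {1..r}"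
  shows "F i j (F k l v) = F k l (F i j v) + ((if j = k then F i l v else 0) - (if i = l then F k j v else 0))"
proof -
  have exp: "F i j (F k l v) = (\<Sum>m<M. \<Sum>m'<M. cre (md m i) (ann (md m j) (cre (md m' k) (ann (md m' l) v))))" for i j k l
    by (simp only: F_def clinear_simps[OF clinear_ann] clinear_simps[OF clinear_cre])
  have d1: "(if md m j = md m' k then cre (md m i) (ann (md m' l) v) else 0)
      = (if m' = m then (if j = k then cre (md m i) (ann (md m l) v) else 0) else 0)" for m m'
    using md_inj[OF ij(2,3), of m m'] by auto
  have d2: "(if md m i = md m' l then cre (md m' k) (ann (md m j) v) else 0)
      = (if m' = m then (if i = l then cre (md m k) (ann (md m j) v) else 0) else 0)" for m m'
    using md_inj[OF ij(1,4), of m m'] by auto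
  have "F i j (F k l v) = (\<Sum>m<M. \<Sum>m'<M. cre (md m' k) (ann (md m' l) (cre (md m i) (ann (md m j) v)))
     + ((if m' = m then (if j = k then cre (md m i) (ann (md m l) v) else 0) else 0)
      - (if m' = m then (if i = l then cre (md m k) (ann (md m j) v) else 0) else 0)))"
    unfolding exp cre_ann_commutator[of "md _ i" "md _ j" "md _ k" "md _ l"] d1 d2 ..
  also have "\<dots> = F k l (F i j v) + ((\<Sum>m<M. if j = k then cre (md m i) (ann (md m l) v) else 0)
      - (\<Sum>m<M. if i = l then cre (md m k) (ann (md m j) v) else 0))"
    unfolding exp sum.distrib sum_subtractf by (subst sum.swap) (simp add: sum.delta)
  also have "(\<Sum>m<M. if j = k then cre (md m i) (ann (md m l) v) else 0) = (if j = k then F i l v else 0)"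
    by (simp add: F_def)
  also have "(\<Sum>m<M. if i = l then cre (md m k) (ann (md m j) v) else 0) = (if i = l then F k j v else 0)"
    by (simp add: F_def)
  finally show ?thesis .
qed

sublocale amb: gl_rep r UNIV F
  by (rule gl_rep.intro) (rule cseq.subspace_UNIV clinear_F UNIV_I F_comm; assumption)+

definition n0 :: nat where
  "n0 = (SOME n. \<forall>k. bit n k \<longleftrightarrow> k \<in> (\<lambda>(m, i). md m i) ` (SIGMA m:{..<M}. {i \<in> {1..r}. m < lam i}))"

lemma bit_n0: "bit n0 k \<longleftrightarrow> (\<exists>m i. i \<in> {1..r} \<and> m < lam i \<and> k = md m i)"
proof -
  let ?S = "(\<lambda>(m, i). md m i) ` (SIGMA m:{..<M}. {i \<in> {1..r}. m < lam i})"
  have "finite ?S" by auto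
  then have "\<forall>k. bit n0 k \<longleftrightarrow> k \<in> ?S"
    unfolding n0_def by (intro someI_ex[of "\<lambda>n. \<forall>k. bit n k \<longleftrightarrow> k \<in> ?S"] exists_nat_bits)
  moreover have "k \<in> ?S \<longleftrightarrow> (\<exists>m i. i \<in> {1..r} \<and> m < lam i \<and> k = md m i)"
  proof
    assume "\<exists>m i. i \<in> {1..r} \<and> m < lam i \<and> k = md m i"
    then obtain m i where mi: "i \<in> {1..r}" "m < lam i" "k = md m i" by blast
    then have "m < M" using lam_le[of i] by simp
    then have "(m, i) \<in> (SIGMA m:{..<M}. {i \<in> {1..r}. m < lam i})" using mi by simp
    then show "k \<in> ?S" using mi(3) by (intro image_eqI[of _ _ "(m, i)"]) simp_all
  qed auto
  ultimately show ?thesis by blast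
qed

lemma bit_n0_md: "i \<in> {1..r} \<Longrightarrow> bit n0 (md m i) \<longleftrightarrow> m < lam i"
  unfolding bit_n0 using md_inj by metis

definition v0 :: cseq where "v0 = (\<lambda>n. if n = n0 then 1 else 0)"

definition \<mu>0 :: weight where "\<mu>0 = (\<lambda>i. if i \<in> {1..r} then of_nat (lam i) else 0)"

lemma F_diag: "F i i v n = of_nat (card {m. m < M \<and> bit n (md m i)}) * v n"
proof -
  have "F i i v n = (\<Sum>m<M. if bit n (md m i) then v n else 0)"
    by (simp add: F_def sum_fun_apply cre_ann_same)
  also have "\<dots> = of_nat (card {m. m < M \<and> bit n (md m i)}) * v n"
    by (simp add: sum.If_cases Int_def)
  finally show ?thesis .
qed

lemma F_diag_n0: "i \<in> {1..r} \<Longrightarrow> F i i v n0 = of_nat (lam i) * v n0"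
proof -
  assume i: "i \<in> {1..r}"
  then have "{m. m < M \<and> bit n0 (md m i)} = {..<lam i}" using lam_le[OF i] by (auto simp: bit_n0_md)
  then show ?thesis by (simp add: F_diag)
qed

sublocale hwv: hw_vector r UNIV F \<mu>0 v0
proof
  have "F i i v0 = cscale (of_rat (\<mu>0 i)) v0" if i: "i \<in> {1..r}" for i
  proof
    fix n
    show "F i i v0 n = cscale (of_rat (\<mu>0 i)) v0 n"
    proof (cases "n = n0")
      case True
      then show ?thesis using F_diag_n0[OF i, of v0] i by (simp add: cscale_def \<mu>0_def)
    next
      case False
      then show ?thesis by (simp add: F_diag cscale_def v0_def)
    qed
  qed
  then show "v0 \<in> amb.wsp \<mu>0" by (simp add: amb.wsp_def)
  have "v0 n0 \<noteq> 0" by (simp add: v0_def)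
  then show "v0 \<noteq> 0" by auto
  show "supported r \<mu>0" by (auto simp: supported_def \<mu>0_def)
  show "F i j v0 = 0" if ij: "(i, j) \<in> pairs r" for i j
  proof -
    have r: "i \<in> {1..r}" "j \<in> {1..r}" "i \<noteq> j" using ij by (auto simp: pairs_def)
    have "cre (md m i) (ann (md m j) v0) = 0" for m
    proof
      fix n
      have ne: "md m i \<noteq> md m j" using md_inj[OF r(1,2)] r(3) by auto
      \<comment> \<open>Pauli exclusion: raising would move a particle of column m from row j to row
        i, but row i is at least as long, so that mode is already occupied.\<close>
      have "set_bit (md m j) (unset_bit (md m i) n) \<noteq> n0"
      proof
        assume eq: "set_bit (md m j) (unset_bit (md m i) n) = n0"
        have "bit n0 (md m j)" "\<not> bit n0 (md m i)"
          unfolding eq[symmetric] using ne by (simp_all add: bit_set_bit_iff bit_unset_bit_iff)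
        then show False using lam_mono[OF ij] r by (simp add: bit_n0_md)
      qed
      then show "cre (md m i) (ann (md m j) v0) n = 0 n"
        by (simp add: cre_def ann_def v0_def)
    qed
    then show ?thesis by (simp add: F_def)
  qed
qed

abbreviation "V \<equiv> cseq.span hwv.H"

text \<open>The states of the \<open>M * r\<close> available modes. Functions supported on them form
  a finite-dimensional space, on which \<open>ip\<close> is an inner product.\<close>

definition low :: "nat set" where "low = {n. \<forall>b. bit n b \<longrightarrow> b < M * r}"

lemma finite_low: "finite low"
proof -
  have "n < 2 ^ (M * r)" if "n \<in> low" for n
  proof -
    have "take_bit (M * r) n = n" using that by (intro bit_eqI) (auto simp: bit_take_bit_iff low_def)
    then show ?thesis by (metis take_bit_nat_less_exp)
  qed
  then show ?thesis by (intro finite_subset[of low "{..<2 ^ (M * r)}"]) auto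
qed

lemma set_bit_low: "k < M * r \<Longrightarrow> set_bit k n \<in> low \<longleftrightarrow> n \<in> low"
  and unset_bit_low: "k < M * r \<Longrightarrow> unset_bit k n \<in> low \<longleftrightarrow> n \<in> low"
  by (auto simp: low_def bit_set_bit_iff bit_unset_bit_iff)

definition W :: "cseq set" where "W = {v. \<forall>n. n \<notin> low \<longrightarrow> v n = 0}"

lemma subspace_W: "cseq.subspace W"
  by (auto simp: cseq.subspace_def W_def cscale_def)

lemma F_W: "i \<in> {1..r} \<Longrightarrow> j \<in> {1..r} \<Longrightarrow> v \<in> W \<Longrightarrow> F i j v \<in> W"
  unfolding F_def
proof (intro cseq.subspace_sum[OF subspace_W])
  fix m assume ij: "i \<in> {1..r}" "j \<in> {1..r}" "v \<in> W" and m: "m \<in> {..<M}"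
  then have "md m i < M * r" "md m j < M * r" by (auto intro!: md_less)
  then show "cre (md m i) (ann (md m j) v) \<in> W"
    using ij by (auto simp: W_def cre_def ann_def set_bit_low unset_bit_low)
qed

lemma v0_W: "v0 \<in> W"
proof -
  have "b < M * r" if b: "bit n0 b" for b
  proof -
    obtain m i where mi: "i \<in> {1..r}" "m < lam i" "b = md m i" using b unfolding bit_n0 by blast
    then have "m < M" using lam_le[of i] by simp
    then show ?thesis using md_less mi by simp
  qed
  then have "n0 \<in> low" by (simp add: low_def)
  then show ?thesis by (auto simp: W_def v0_def)
qed

lemma H_W: "hwv.H \<subseteq> W"
proof -
  have "u \<in> W" if "hwv.hw \<kappa> u" for \<kappa> u
    using that by (induction rule: hword.induct) (auto intro: v0_W F_W simp: pairs_def)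
  then show ?thesis by (auto simp: hwv.H_def)
qed

lemma V_W: "V \<subseteq> W"
  by (rule cseq.span_minimal[OF H_W subspace_W])

lemma finite_dim_V: "\<exists>B. finite B \<and> cseq.span B = V"
proof -
  let ?e = "\<lambda>n m. if m = n then 1 else 0 :: complex"
  have "W \<subseteq> cseq.span (?e ` low)"
  proof
    fix v assume v: "v \<in> W"
    have "v = (\<Sum>n\<in>low. cscale (v n) (?e n))"
    proof
      fix m
      have "(\<Sum>n\<in>low. cscale (v n) (?e n)) m = (\<Sum>n\<in>low. if m = n then v m else 0)"
        unfolding sum_fun_apply by (intro sum.cong) (auto simp: cscale_def)
      then show "v m = (\<Sum>n\<in>low. cscale (v n) (?e n)) m"
        using v finite_low by (auto simp: sum.delta' W_def)
    qed
    also have "\<dots> \<in> cseq.span (?e ` low)"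
      by (intro cseq.span_sum cseq.span_scale cseq.span_base) auto
    finally show "v \<in> cseq.span (?e ` low)" .
  qed
  then have "V \<subseteq> cseq.span (?e ` low)" using V_W by blast
  then show ?thesis
    using finite_basis_exists[OF cseq.subspace_span, of hwv.H "?e ` low"] finite_low by blast
qed

section \<open>The Hermitian form and irreducibility\<close>

definition ip :: "cseq \<Rightarrow> cseq \<Rightarrow> complex" where
  "ip u v = (\<Sum>n\<in>low. u n * cnj (v n))"

text \<open>Switching bit k matches the states with mode k occupied and those with it empty; the
  sign counts modes below k and is the same for both.\<close>

lemma ip_cre_ann:
  assumes k: "k < M * r"
  shows "ip (cre k u) v = ip u (ann k v)"
proof -
  have "ip (cre k u) v = (\<Sum>n\<in>{n\<in>low. bit n k}. sg k n * u (unset_bit k n) * cnj (v n))"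
    unfolding ip_def using finite_low by (intro sum.mono_neutral_cong_right) (auto simp: cre_def)
  also have "\<dots> = (\<Sum>n\<in>{n\<in>low. \<not> bit n k}. sg k n * u n * cnj (v (set_bit k n)))"
    by (rule sum.reindex_bij_witness[of _ "set_bit k" "unset_bit k"])
      (auto simp: set_bit_low[OF k] unset_bit_low[OF k] bit_set_bit_iff bit_unset_bit_iff set_unset_bit sg_unset_bit)
  also have "\<dots> = ip u (ann k v)"
    unfolding ip_def using finite_low by (intro sum.mono_neutral_cong_left) (auto simp: ann_def)
  finally show ?thesis .
qed

lemma cnj_ip: "cnj (ip u v) = ip v u"
  by (simp add: ip_def mult.commute)

text \<open>Creation and annihilation are adjoint, hence so are the root operators of opposite
  roots.\<close>

lemma ip_F:
  assumes "i \<in> {1..r}" "j \<in> {1..r}"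
  shows "ip (F i j u) v = ip u (F j i v)"
proof -
  have suml: "ip (sum g A) v = (\<Sum>x\<in>A. ip (g x) v)" for g :: "nat \<Rightarrow> cseq" and A v
    unfolding ip_def sum_fun_apply sum_distrib_right by (rule sum.swap)
  have sumr: "ip v (sum g A) = (\<Sum>x\<in>A. ip v (g x))" for g :: "nat \<Rightarrow> cseq" and A v
    using arg_cong[OF suml[of g A v], of cnj] by (simp add: cnj_ip)
  have "ip (cre (md m i) (ann (md m j) u)) v = ip u (cre (md m j) (ann (md m i) v))" if "m < M" for m
  proof -
    have "ip (cre (md m i) (ann (md m j) u)) v = ip (ann (md m j) u) (ann (md m i) v)"
      using assms that by (intro ip_cre_ann md_less)
    also have "\<dots> = cnj (ip (cre (md m j) (ann (md m i) v)) u)"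
      using assms that by (subst ip_cre_ann) (auto simp: cnj_ip intro!: md_less)
    finally show ?thesis by (simp add: cnj_ip)
  qed
  then show ?thesis unfolding F_def suml sumr by (intro sum.cong) auto
qed

lemma ip_v0: "u \<in> W \<Longrightarrow> ip u v0 = u n0"
  using finite_low by (auto simp: ip_def v0_def W_def if_distrib[of cnj] if_distrib[of "\<lambda>x. _ * x"] sum.delta cong: if_cong)

lemma ip_self_zero:
  assumes "u \<in> W" "ip u u = 0" shows "u = 0"
proof
  fix n
  have "ip u u = of_real (\<Sum>n\<in>low. (cmod (u n))\<^sup>2)"
    by (simp add: ip_def complex_norm_square[symmetric])
  then have "(\<Sum>n\<in>low. (cmod (u n))\<^sup>2) = 0" using assms(2) by (metis of_real_eq_0_iff)
  then have "\<forall>n\<in>low. u n = 0" using finite_low by (simp add: sum_nonneg_eq_0_iff)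
  then show "u n = 0 n" using assms(1) by (auto simp: W_def)
qed

text \<open>A proper submodule is orthogonal to the highest weight vector, hence to all of \<open>V\<close>.\<close>

lemma irreducible_F:
  assumes U: "cseq.subspace U" "U \<subseteq> V" and FU: "\<And>i j v. i \<in> {1..r} \<Longrightarrow> j \<in> {1..r} \<Longrightarrow> v \<in> U \<Longrightarrow> F i j v \<in> U"
  shows "U = {0} \<or> U = V"
proof (rule disjCI)
  assume "U \<noteq> V"
  have UW: "U \<subseteq> W" using U(2) V_W by blast
  \<comment> \<open>A vector of U with a nonzero coefficient at \<open>n0\<close> would have a
    nonzero multiple of \<open>v0\<close> as a weight component, and \<open>v0\<close> generates
    V.\<close>
  have zero: "u n0 = 0" if u: "u \<in> U" for u
  proof (rule ccontr)
    assume un0: "u n0 \<noteq> 0"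
    obtain K and c :: "weight \<Rightarrow> cseq" where c: "finite K" "\<forall>\<kappa>\<in>K. supported r \<kappa>" "\<forall>\<kappa>. c \<kappa> \<in> cseq.span {x. hwv.hw \<kappa> x}"
      "u = (\<Sum>\<kappa>\<in>K. c \<kappa>)" using hwv.weight_decomposition[of u] u U(2) by blast
    have cw: "c \<kappa> \<in> amb.wsp \<kappa>" for \<kappa> using c(3) hwv.span_hw_wsp by blast
    have cU: "c \<kappa> \<in> U" if "\<kappa> \<in> K" for \<kappa>
      by (rule amb.weight_components[OF U(1), where K = K and u = c and \<kappa> = \<kappa>]) (use FU c cw u that in auto)
    have "(\<Sum>\<kappa>\<in>K. c \<kappa> n0) \<noteq> 0" using un0 unfolding c(4) sum_fun_apply .
    then obtain \<kappa> where k: "\<kappa> \<in> K" "c \<kappa> n0 \<noteq> 0" by (meson sum.neutral)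
    \<comment> \<open>Diagonal operators multiply the coefficient at \<open>n0\<close> by
      \<open>lam i\<close>, so only a component of weight \<open>\<mu>0\<close> can have a nonzero
      one.\<close>
    have "\<kappa> = \<mu>0"
    proof
      fix i
      show "\<kappa> i = \<mu>0 i"
      proof (cases "i \<in> {1..r}")
        case True
        have "F i i (c \<kappa>) n0 = of_rat (\<kappa> i) * c \<kappa> n0"
          using amb.wspD(2)[OF cw True] by (simp add: cscale_def)
        then have "of_nat (lam i) = (of_rat (\<kappa> i) :: complex)" using F_diag_n0[OF True, of "c \<kappa>"] k(2) by simp
        then have "of_rat (of_nat (lam i)) = (of_rat (\<kappa> i) :: complex)" by simp
        then show ?thesis using True by (simp only: of_rat_eq_iff) (simp add: \<mu>0_def)
      next
        case False
        then show ?thesis using c(2) k(1) by (auto simp: supported_def \<mu>0_def)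
      qed
    qed
    then obtain a where a: "c \<kappa> = cscale a v0"
      using hwv.wsp_highest[of "c \<kappa>"] cw[of \<kappa>] cU[OF k(1)] U(2) by blast
    have "a \<noteq> 0" using k(2) a by (auto simp: cscale_def)
    then have "v0 = cscale (inverse a) (c \<kappa>)" unfolding a by simp
    then have v0U: "v0 \<in> U" using cseq.subspace_scale[OF U(1) cU[OF k(1)]] by metis
    have "x \<in> U" if "hwv.hw \<kappa> x" for \<kappa> x
      using that by (induction rule: hword.induct) (auto intro: v0U FU simp: pairs_def)
    then have "hwv.H \<subseteq> U" by (auto simp: hwv.H_def)
    then have "V \<subseteq> U" by (rule cseq.span_minimal[OF _ U(1)])
    then show False using \<open>U \<noteq> V\<close> U(2) by blast
  qed
  \<comment> \<open>Adjointness moves a lowering operator from the word to U, which is stable under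
    all \<open>F i j\<close>.\<close>
  have orth: "\<forall>u\<in>U. ip u x = 0" if "hwv.hw \<kappa> x" for \<kappa> x
    using that
  proof (induction rule: hword.induct)
    case base
    show ?case using zero UW ip_v0 by auto
  next
    case (step \<kappa> x j i)
    have "i \<in> {1..r}" "j \<in> {1..r}" using step(2) by (auto simp: pairs_def)
    then show "\<forall>u\<in>U. ip u (F i j x) = 0" using step.IH FU ip_F[of j i] by metis
  qed
  have orthV: "ip u x = 0" if "x \<in> V" "u \<in> U" for u x
    using that(1)
  proof (induction rule: cseq.span_induct_alt)
    case base
    show "ip u 0 = 0" by (simp add: ip_def)
  next
    case (step a x y)
    have "ip u x = 0" using step(1) orth that(2) unfolding hwv.H_def by blast
    moreover have "ip u (cscale a x + y) = cnj a * ip u x + ip u y"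
      by (simp add: ip_def cscale_def sum.distrib sum_distrib_left algebra_simps)
    ultimately show "ip u (cscale a x + y) = 0" using step(2) by simp
  qed
  have "u = 0" if "u \<in> U" for u
    using ip_self_zero[of u] orthV[of u u] that U(2) UW by blast
  then show "U = {0}" using cseq.subspace_0[OF U(1)] by auto
qed

section \<open>The action of traceless matrices on the Fock module\<close>

definition \<rho> :: "complex mat \<Rightarrow> cseq \<Rightarrow> cseq" where
  "\<rho> X v = (\<Sum>i=1..r. \<Sum>j=1..r. cscale (X $$ (i - 1, j - 1)) (F i j v))"

lemma rho_linear: "clinear (\<rho> X)"
  by (rule clinearI)
    (simp_all only: \<rho>_def clinear_simps[OF clinear_F] cseq.scale_right_distrib sum.distrib cseq.scale_sum_right
      cseq.scale_left_commute)

lemma rho_add: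
  assumes "X \<in> carrier_mat r r" "Y \<in> carrier_mat r r"
  shows "\<rho> (X + Y) v = \<rho> X v + \<rho> Y v"
  unfolding \<rho>_def sum.distrib[symmetric]
proof (intro sum.cong refl)
  fix i j assume "i \<in> {1..r}" "j \<in> {1..r}"
  then have "(X + Y) $$ (i - 1, j - 1) = X $$ (i - 1, j - 1) + Y $$ (i - 1, j - 1)"
    using assms by (subst index_add_mat) auto
  then show "cscale ((X + Y) $$ (i - 1, j - 1)) (F i j v)
     = cscale (X $$ (i - 1, j - 1)) (F i j v) + cscale (Y $$ (i - 1, j - 1)) (F i j v)"
    by (simp only: cseq.scale_left_distrib)
qed

lemma rho_scale:
  assumes "X \<in> carrier_mat r r"
  shows "\<rho> (c \<cdot>\<^sub>m X) v = cscale c (\<rho> X v)"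
  unfolding \<rho>_def cseq.scale_sum_right
proof (intro sum.cong refl)
  fix i j assume "i \<in> {1..r}" "j \<in> {1..r}"
  then have "(c \<cdot>\<^sub>m X) $$ (i - 1, j - 1) = c * X $$ (i - 1, j - 1)"
    using assms by (subst index_smult_mat) auto
  then show "cscale ((c \<cdot>\<^sub>m X) $$ (i - 1, j - 1)) (F i j v) = cscale c (cscale (X $$ (i - 1, j - 1)) (F i j v))"
    by (simp only: cseq.scale_scale)
qed

text \<open>By bilinearity everything reduces to \<open>F_comm\<close>, whose two Kronecker deltas
  collapse the fourfold sums to the entries of the two matrix products.\<close>

lemma rho_bracket:
  assumes X: "X \<in> carrier_mat r r" and Y: "Y \<in> carrier_mat r r"
  shows "\<rho> (X * Y - Y * X) v = \<rho> X (\<rho> Y v) - \<rho> Y (\<rho> X v)"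
proof -
  define x y where "x = (\<lambda>i j. X $$ (i - 1, j - 1))" and "y = (\<lambda>i j. Y $$ (i - 1, j - 1))"
  have entry: "(X * Y - Y * X) $$ (i - 1, j - 1) = (\<Sum>k=1..r. x i k * y k j) - (\<Sum>k=1..r. y i k * x k j)"
    if "i \<in> {1..r}" "j \<in> {1..r}" for i j
  proof -
    have b: "i - 1 < r" "j - 1 < r" using that by auto
    have "(A * B) $$ (i - 1, j - 1) = (\<Sum>k=1..r. A $$ (i - 1, k - 1) * B $$ (k - 1, j - 1))"
      if "A \<in> carrier_mat r r" "B \<in> carrier_mat r r" for A B :: "complex mat"
      using that b by (simp add: scalar_prod_def One_nat_def sum.atLeast1_atMost_eq lessThan_atLeast0)
    then show ?thesis using X Y b by (simp add: x_def y_def)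
  qed
  have prod: "\<rho> A (\<rho> B v) = (\<Sum>i=1..r. \<Sum>j=1..r. \<Sum>k=1..r. \<Sum>l=1..r.
      cscale (A $$ (i - 1, j - 1) * B $$ (k - 1, l - 1)) (F i j (F k l v)))" for A B
    by (simp only: \<rho>_def clinear_simps[OF clinear_F] cseq.scale_sum_right cseq.scale_scale)
  have swap: "(\<Sum>i=1..r. \<Sum>j=1..r. \<Sum>k=1..r. \<Sum>l=1..r. g i j k l) = (\<Sum>i=1..r. \<Sum>j=1..r. \<Sum>k=1..r. \<Sum>l=1..r. g k l i j)"
    for g :: "nat \<Rightarrow> nat \<Rightarrow> nat \<Rightarrow> nat \<Rightarrow> cseq"
  proof -
    have pair: "(\<Sum>i=1..r. \<Sum>j=1..r. f i j) = (\<Sum>p\<in>{1..r} \<times> {1..r}. f (fst p) (snd p))"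
      for f :: "nat \<Rightarrow> nat \<Rightarrow> cseq"
      by (simp add: sum.cartesian_product split_def)
    show ?thesis unfolding pair by (rule sum.swap)
  qed
  have "\<rho> X (\<rho> Y v) - \<rho> Y (\<rho> X v) = (\<Sum>i=1..r. \<Sum>j=1..r. \<Sum>k=1..r. \<Sum>l=1..r.
      cscale (x i j * y k l) (F i j (F k l v))) - (\<Sum>i=1..r. \<Sum>j=1..r. \<Sum>k=1..r. \<Sum>l=1..r.
      cscale (y k l * x i j) (F k l (F i j v)))"
    unfolding prod x_def y_def by (subst (2) swap) (rule refl)
  also have "\<dots> = (\<Sum>i=1..r. \<Sum>j=1..r. \<Sum>k=1..r. \<Sum>l=1..r.
      (if k = j then cscale (x i j * y j l) (F i l v) else 0) - (if l = i then cscale (x i j * y k i) (F k j v) else 0))"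
    unfolding sum_subtractf[symmetric]
  proof (intro sum.cong refl)
    fix i j k l assume r: "i \<in> {1..r}" "j \<in> {1..r}" "k \<in> {1..r}" "l \<in> {1..r}"
    show "cscale (x i j * y k l) (F i j (F k l v)) - cscale (y k l * x i j) (F k l (F i j v))
      = (if k = j then cscale (x i j * y j l) (F i l v) else 0) - (if l = i then cscale (x i j * y k i) (F k j v) else 0)"
      unfolding F_comm[OF r, of v] mult.commute[of "y k l"]
      by (cases "k = j"; cases "l = i") (auto simp: cseq.scale_right_distrib cseq.scale_right_diff_distrib)
  qed
  also have "\<dots> = (\<Sum>i=1..r. \<Sum>j=1..r. \<Sum>l=1..r. cscale (x i j * y j l) (F i l v))
      - (\<Sum>i=1..r. \<Sum>j=1..r. \<Sum>k=1..r. cscale (x i j * y k i) (F k j v))"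
  proof -
    have "(\<Sum>i=1..r. \<Sum>j=1..r. \<Sum>k=1..r. \<Sum>l=1..r. if k = j then cscale (x i j * y j l) (F i l v) else 0)
       = (\<Sum>i=1..r. \<Sum>j=1..r. \<Sum>l=1..r. cscale (x i j * y j l) (F i l v))"
    proof (rule sum.cong[OF refl], rule sum.cong[OF refl])
      fix i j assume "j \<in> {1..r}"
      then show "(\<Sum>k=1..r. \<Sum>l=1..r. if k = j then cscale (x i j * y j l) (F i l v) else 0)
         = (\<Sum>l=1..r. cscale (x i j * y j l) (F i l v))"
        by (subst sum.swap) (simp add: sum.delta)
    qed
    moreover have "(\<Sum>i=1..r. \<Sum>j=1..r. \<Sum>k=1..r. \<Sum>l=1..r. if l = i then cscale (x i j * y k i) (F k j v) else 0)
       = (\<Sum>i=1..r. \<Sum>j=1..r. \<Sum>k=1..r. cscale (x i j * y k i) (F k j v))"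
      by (intro sum.cong refl) (simp add: sum.delta)
    ultimately show ?thesis unfolding sum_subtractf by (simp only:)
  qed
  also have "(\<Sum>i=1..r. \<Sum>j=1..r. \<Sum>l=1..r. cscale (x i j * y j l) (F i l v)) = (\<Sum>i=1..r. \<Sum>l=1..r. \<Sum>j=1..r. cscale (x i j * y j l) (F i l v))"
    by (rule sum.cong[OF refl]) (rule sum.swap)
  also have "(\<Sum>i=1..r. \<Sum>j=1..r. \<Sum>k=1..r. cscale (x i j * y k i) (F k j v)) = (\<Sum>k=1..r. \<Sum>j=1..r. \<Sum>i=1..r. cscale (y k i * x i j) (F k j v))"
  proof -
    have "(\<Sum>i=1..r. \<Sum>j=1..r. \<Sum>k=1..r. cscale (x i j * y k i) (F k j v)) = (\<Sum>i=1..r. \<Sum>k=1..r. \<Sum>j=1..r. cscale (x i j * y k i) (F k j v))"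
      by (rule sum.cong[OF refl]) (rule sum.swap)
    also have "\<dots> = (\<Sum>k=1..r. \<Sum>i=1..r. \<Sum>j=1..r. cscale (x i j * y k i) (F k j v))" by (rule sum.swap)
    also have "\<dots> = (\<Sum>k=1..r. \<Sum>j=1..r. \<Sum>i=1..r. cscale (x i j * y k i) (F k j v))"
      by (rule sum.cong[OF refl]) (rule sum.swap)
    finally show ?thesis by (simp only: mult.commute)
  qed
  also have "(\<Sum>i=1..r. \<Sum>l=1..r. \<Sum>j=1..r. cscale (x i j * y j l) (F i l v)) - (\<Sum>k=1..r. \<Sum>j=1..r. \<Sum>i=1..r. cscale (y k i * x i j) (F k j v))
     = \<rho> (X * Y - Y * X) v"
    unfolding \<rho>_def sum_subtractf[symmetric]
    by (intro sum.cong refl) (simp only: entry cseq.scale_left_diff_distrib cseq.scale_sum_left sum_subtractf)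
  finally show ?thesis ..
qed

text \<open>The operators \<open>F i j\<close> move particles without creating any, so the identity
  matrix acts on V as the number of boxes of the diagram.\<close>

lemma total_number:
  assumes "v \<in> V"
  shows "(\<Sum>k=1..r. F k k v) = cscale (of_nat (\<Sum>k=1..r. lam k)) v"
  using assms
proof (induction rule: cseq.span_induct_alt)
  case base
  show "(\<Sum>k=1..r. F k k 0) = cscale (of_nat (\<Sum>k=1..r. lam k)) 0"
    by (simp add: clinear_simps[OF clinear_F])
next
  case (step a x y)
  obtain \<kappa> where k: "hwv.hw \<kappa> x" using step(1) unfolding hwv.H_def by blast
  have "(\<Sum>k=1..r. F k k x) = (\<Sum>k=1..r. cscale (of_rat (\<kappa> k)) x)"
    by (intro sum.cong refl amb.wspD(2)[OF hwv.hw_wsp[OF k]])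
  also have "\<dots> = cscale (of_rat (\<Sum>k=1..r. \<kappa> k)) x"
    by (simp add: cseq.scale_sum_left of_rat_sum)
  also have "(\<Sum>k=1..r. \<kappa> k) = of_nat (\<Sum>k=1..r. lam k)"
    using hwv.hw_sum[OF k] by (simp add: \<mu>0_def)
  finally have "(\<Sum>k=1..r. F k k x) = cscale (of_nat (\<Sum>k=1..r. lam k)) x"
    by (simp only: of_rat_of_nat_eq)
  then show "(\<Sum>k=1..r. F k k (cscale a x + y)) = cscale (of_nat (\<Sum>k=1..r. lam k)) (cscale a x + y)"
    using step(2)
    by (simp only: clinear_simps[OF clinear_F] sum.distrib cseq.scale_sum_right[symmetric] cseq.scale_right_distrib cseq.scale_left_commute)
qed

text \<open>Passing to the traceless unit changes the operator by a scalar on V, so subspaces stable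
  under \<open>sl\<^sub>r\<close> are stable under every \<open>F i j\<close>.\<close>

lemma rho_E:
  assumes ij: "i \<in> {1..r}" "j \<in> {1..r}" and v: "v \<in> V"
  shows "\<rho> (E r i j) v = F i j v - cscale (if i = j then of_nat (\<Sum>k=1..r. lam k) / of_nat r else 0) v"
proof -
  have "\<rho> (E r i j) v = (\<Sum>a=1..r. \<Sum>b=1..r. (if b = j then (if a = i then F i j v else 0) else 0)
      - (if b = a then cscale (if i = j then 1 / of_nat r else 0) (F a a v) else 0))"
    unfolding \<rho>_def
  proof (intro sum.cong refl)
    fix a b assume ab: "a \<in> {1..r}" "b \<in> {1..r}"
    then have "E r i j $$ (a - 1, b - 1) = (if a = i \<and> b = j then 1 else 0) - (if a = b \<and> i = j then 1 / of_nat r else 0)"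
      using ij by (subst E_index) auto
    then show "cscale (E r i j $$ (a - 1, b - 1)) (F a b v) = (if b = j then (if a = i then F i j v else 0) else 0)
      - (if b = a then cscale (if i = j then 1 / of_nat r else 0) (F a a v) else 0)"
      by (auto simp: cseq.scale_left_diff_distrib)
  qed
  also have "\<dots> = (\<Sum>a=1..r. (if a = i then F i j v else 0) - cscale (if i = j then 1 / of_nat r else 0) (F a a v))"
    using ij by (intro sum.cong refl) (simp only: sum_subtractf sum.delta finite_atLeastAtMost if_True)
  also have "\<dots> = F i j v - cscale (if i = j then 1 / of_nat r else 0) (\<Sum>a=1..r. F a a v)"
    using ij by (simp only: sum_subtractf sum.delta finite_atLeastAtMost if_True cseq.scale_sum_right)
  also have "\<dots> = F i j v - cscale (if i = j then of_nat (\<Sum>k=1..r. lam k) / of_nat r else 0) v"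
    unfolding total_number[OF v] by (cases "i = j") simp_all
  finally show ?thesis .
qed

lemma sl_module_V: "sl_module r V \<rho>"
proof (rule sl_module.intro)
  show "cseq.subspace V" by (rule cseq.subspace_span)
  show "\<exists>B. finite B \<and> cseq.span B = V" by (rule finite_dim_V)
  fix X v assume X: "X \<in> sl r" and v: "v \<in> V"
  show "\<rho> X v \<in> V"
    unfolding \<rho>_def by (intro cseq.span_sum cseq.span_scale hwv.F_span v)
  show "\<rho> X (cscale c v) = cscale c (\<rho> X v)" for c by (rule clinear_simps(3)[OF rho_linear])
  show "\<rho> (c \<cdot>\<^sub>m X) v = cscale c (\<rho> X v)" for c by (rule rho_scale) (use X in \<open>simp add: sl_def\<close>)
next
  fix X u v assume "X \<in> sl r"
  show "\<rho> X (u + v) = \<rho> X u + \<rho> X v" by (rule clinear_simps(1)[OF rho_linear])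
next
  fix X Y v assume "X \<in> sl r" "Y \<in> sl r"
  then have XY: "X \<in> carrier_mat r r" "Y \<in> carrier_mat r r" by (auto simp: sl_def)
  show "\<rho> (X + Y) v = \<rho> X v + \<rho> Y v" by (rule rho_add[OF XY])
  show "\<rho> (X * Y - Y * X) v = \<rho> X (\<rho> Y v) - \<rho> Y (\<rho> X v)" by (rule rho_bracket[OF XY])
qed

lemma irreducible_V: "irreducible_sl_module r V \<rho>"
proof (intro irreducible_sl_module.intro sl_module_V irreducible_sl_module_axioms.intro)
  have "v0 \<in> V" by (rule cseq.span_base) (use hword.base in \<open>auto simp: hwv.H_def intro: hword.base\<close>)
  then show "V \<noteq> {0}" using hwv.v0(2) by blast
next
  fix U assume U: "cseq.subspace U" "U \<subseteq> V" and st: "\<And>X v. X \<in> sl r \<Longrightarrow> v \<in> U \<Longrightarrow> \<rho> X v \<in> U"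
  show "U = {0} \<or> U = V"
  proof (rule irreducible_F[OF U])
    fix i j v assume ij: "i \<in> {1..r}" "j \<in> {1..r}" and v: "v \<in> U"
    let ?c = "if i = j then of_nat (\<Sum>k=1..r. lam k) / of_nat r else 0 :: complex"
    have "F i j v = \<rho> (E r i j) v + cscale ?c v"
      using rho_E[OF ij, of v] v U(2) by (auto simp: algebra_simps)
    then show "F i j v \<in> U"
      using st[OF E_sl[OF ij] v] by (simp only:) (intro cseq.subspace_add[OF U(1)] cseq.subspace_scale[OF U(1)] v)
  qed
qed

text \<open>A diagram fixes the coordinates up to a common constant c, which traceless matrices do
  not see.\<close>

lemma highest_weight_V:
  fixes \<nu> :: weight
  assumes \<nu>: "\<And>i. i \<in> {1..r} \<Longrightarrow> \<nu> i = of_nat (lam i) - c"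
  shows "is_highest_weight r V \<rho> \<nu>"
  unfolding is_highest_weight_def
proof (intro bexI conjI ballI impI)
  have v0V: "v0 \<in> V" by (rule cseq.span_base) (use hword.base in \<open>auto simp: hwv.H_def intro: hword.base\<close>)
  show "v0 \<noteq> 0" by (rule hwv.v0)
  show "\<rho> X v0 = 0" if X: "X \<in> carrier_mat r r" "\<forall>i<r. \<forall>j\<le>i. X $$ (i, j) = 0" for X
    unfolding \<rho>_def
  proof (intro sum.neutral ballI)
    fix i j assume ij: "i \<in> {1..r}" "j \<in> {1..r}"
    show "cscale (X $$ (i - 1, j - 1)) (F i j v0) = 0"
    proof (cases "i < j")
      case True
      then have "F i j v0 = 0" using ij by (intro hwv.killed) (auto simp: pairs_def)
      then show ?thesis by simp
    next
      case False
      then have "i - 1 < r" "j - 1 \<le> i - 1" using ij by auto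
      then have "X $$ (i - 1, j - 1) = 0" using X(2) by blast
      then show ?thesis by simp
    qed
  qed
  show "v0 \<in> weight_space r V \<rho> \<nu>"
    unfolding weight_space_def
  proof (intro CollectI conjI v0V ballI impI)
    fix X assume X: "X \<in> sl r" "diagonal_mat X"
    have off: "X $$ (i - 1, j - 1) = 0" if "i \<in> {1..r}" "j \<in> {1..r}" "j \<noteq> i" for i j
    proof -
      have "i - 1 \<noteq> j - 1" "i - 1 < r" "j - 1 < r" using that by auto
      then show ?thesis using X unfolding diagonal_mat_def sl_def by auto
    qed
    have tr0: "(\<Sum>i=1..r. X $$ (i - 1, i - 1)) = 0"
      using X by (simp add: sl_def One_nat_def sum.atLeast1_atMost_eq)
    have "\<rho> X v0 = (\<Sum>i=1..r. \<Sum>j=1..r. if j = i then cscale (X $$ (i - 1, i - 1)) (F i i v0) else 0)"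
      unfolding \<rho>_def by (intro sum.cong refl) (auto simp: off)
    also have "\<dots> = (\<Sum>i=1..r. cscale (X $$ (i - 1, i - 1)) (F i i v0))"
      by (intro sum.cong refl) (simp add: sum.delta)
    also have "\<dots> = (\<Sum>i=1..r. cscale (of_nat (lam i) * X $$ (i - 1, i - 1)) v0)"
    proof (intro sum.cong refl)
      fix i assume i: "i \<in> {1..r}"
      show "cscale (X $$ (i - 1, i - 1)) (F i i v0) = cscale (of_nat (lam i) * X $$ (i - 1, i - 1)) v0"
        using amb.wspD(2)[OF hwv.v0(1) i] i by (simp add: \<mu>0_def mult.commute)
    qed
    also have "\<dots> = cscale (\<Sum>i=1..r. of_nat (lam i) * X $$ (i - 1, i - 1)) v0"
      by (simp only: cseq.scale_sum_left)
    also have "(\<Sum>i=1..r. of_nat (lam i) * X $$ (i - 1, i - 1)) = weight_eval r \<nu> X + of_rat c * (\<Sum>i=1..r. X $$ (i - 1, i - 1))"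
      unfolding weight_eval_def sum_distrib_left sum.distrib[symmetric]
      by (intro sum.cong refl) (simp add: \<nu> of_rat_diff algebra_simps)
    finally show "\<rho> X v0 = cscale (weight_eval r \<nu> X) v0" by (simp add: tr0)
  qed
qed

end

section \<open>Existence of the irreducible modules and their characters\<close>

lemma irreducible_module_exists:
  assumes r: "r > 0" and \<nu>: "\<nu> \<in> dominant_weights r"
  shows "\<exists>V \<rho>. irreducible_sl_module r V \<rho> \<and> is_highest_weight r V \<rho> \<nu>"
proof -
  \<comment> \<open>Row lengths normalized so that the last one is 0; the diagram has
    \<open>lam 1\<close> columns, and the constant taken off is \<open>\<nu> r\<close>.\<close>
  define lam where "lam = (\<lambda>i. nat \<lfloor>\<nu> i - \<nu> r\<rfloor>)"
  have d: "\<forall>k\<in>{1..<r}. \<nu> k - \<nu> (k + 1) \<in> \<nat>" using \<nu> by (simp add: dominant_weights_iff)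
  have mono: "\<nu> j \<le> \<nu> i" if "1 \<le> i" "i \<le> j" "j \<le> r" for i j
    using that(2,3)
  proof (induction j rule: dec_induct)
    case (step k)
    have "\<nu> k - \<nu> (k + 1) \<in> \<nat>" using d step that(1) by auto
    then have "\<nu> k - \<nu> (k + 1) \<ge> 0" by (rule Nats_cases) simp
    then have "\<nu> (Suc k) \<le> \<nu> k" by (simp only: diff_ge_0_iff_ge Suc_eq_plus1)
    then show ?case using step by (meson Suc_leD order_trans)
  qed simp
  have lam: "of_nat (lam i) = \<nu> i - \<nu> r" if "i \<in> {1..r}" for i
  proof -
    have "\<nu> i - \<nu> r \<in> \<int>" by (rule differences_Ints) (use d Nats_subset_Ints that r in auto)
    moreover have "\<nu> i - \<nu> r \<ge> 0" using mono[of i r] that by simp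
    ultimately show ?thesis by (auto simp: lam_def elim!: Ints_cases)
  qed
  interpret fock r "lam 1" lam
  proof
    have le: "lam j \<le> lam i" if "1 \<le> i" "i \<le> j" "j \<le> r" for i j
    proof -
      have "(of_nat (lam j) :: rat) \<le> of_nat (lam i)" using lam[of i] lam[of j] mono[OF that] that by simp
      then show ?thesis by simp
    qed
    show "lam j \<le> lam i" if "(i, j) \<in> pairs r" for i j using that by (intro le) (auto simp: pairs_def)
    show "lam i \<le> lam 1" if "i \<in> {1..r}" for i using that by (intro le) auto
  qed (rule r)
  have "is_highest_weight r V \<rho> \<nu>" by (rule highest_weight_V[of _ "- \<nu> r"]) (simp add: lam)
  then show ?thesis using irreducible_V by blast
qed

text \<open>Existence makes the choice in \<open>irrep\<close> meet its specification, and the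
  formula holds for whatever module was chosen.\<close>

theorem irrep_char_times_denominator:
  assumes "r > 0" "\<nu> \<in> dominant_weights r"
  shows "irrep_char r \<nu> * weyl_product r = alt r (\<nu> + weyl_vector r)"
proof -
  obtain V \<rho> where irrep: "irrep r \<nu> = (V, \<rho>)" by force
  have "\<exists>x. case x of (V, \<rho>) \<Rightarrow> irreducible_sl_module r V \<rho> \<and> is_highest_weight r V \<rho> \<nu>"
    using irreducible_module_exists[OF assms] by auto
  then have "case irrep r \<nu> of (V, \<rho>) \<Rightarrow> irreducible_sl_module r V \<rho> \<and> is_highest_weight r V \<rho> \<nu>"
    unfolding irrep_def by (rule someI_ex)
  then have "irreducible_sl_module r V \<rho>" "is_highest_weight r V \<rho> \<nu>" by (simp_all add: irrep)
  from irreducible_module_character[OF this assms(2)] show ?thesis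
    by (simp add: irrep_char_def irrep)
qed

subsection \<open>The character of the symmetric power\<close>

text \<open>Coordinate k is \<open>a (k - 1) - a k - n/r\<close> under the conventions
  \<open>a 0 = n\<close> and \<open>a r = 0\<close>; they appear as case distinctions because
  \<open>a\<close> is arbitrary at those arguments.\<close>

lemma Pi_weight_apply:
  assumes r: "r \<ge> 2"
  shows "(wscale (of_nat n) (fund_weight r 1) - (\<Sum>i=1..r-1. wscale (of_nat (a i)) (simple_root i))) k =
    (if k \<in> {1..r} then (if k = 1 then of_nat n else of_nat (a (k - 1))) - (if k < r then of_nat (a k) else 0) - of_nat n / of_nat r else 0)"
proof -
  have "(\<Sum>i=1..r-1. wscale (of_nat (a i)) (simple_root i)) k
     = (\<Sum>i=1..r-1. (if i = k then of_nat (a k) else 0) - (if i = k - 1 then (if k \<ge> 1 then of_nat (a (k - 1)) else 0) else 0))"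
    unfolding sum_fun_apply by (intro sum.cong refl) (auto simp: wscale_def simple_root_def eps_def)
  also have "\<dots> = (if k \<in> {1..r-1} then of_nat (a k) else 0) - (if k - 1 \<in> {1..r-1} then of_nat (a (k - 1)) else 0)"
    by (auto simp: sum_subtractf sum.delta)
  finally have "(\<Sum>i=1..r-1. wscale (of_nat (a i)) (simple_root i)) k
     = (if k \<in> {1..r-1} then of_nat (a k) else 0) - (if k - 1 \<in> {1..r-1} then of_nat (a (k - 1)) else 0)" .
  moreover have "fund_weight r 1 k = (if k = 1 then 1 - 1 / of_nat r else if k \<in> {2..r} then - 1 / of_nat r else 0)"
    using r by (subst fund_weight_apply) (auto simp: field_simps)
  moreover have "(wscale (of_nat n) (fund_weight r 1) - S) k = of_nat n * fund_weight r 1 k - S k" for S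
    by (simp only: minus_apply wscale_def)
  ultimately show ?thesis using r
    by (simp only:) (auto simp: right_diff_distrib)
qed

text \<open>The weights are the monomials of degree n in r variables: the exponents
  \<open>\<mu> i + n/r\<close> are natural numbers with sum n, and the sequence \<open>a\<close>
  consists of their tail sums.\<close>

lemma Pi_weights_iff:
  assumes r: "r \<ge> 2"
  shows "\<mu> \<in> Pi_weights r n \<longleftrightarrow>
    supported r \<mu> \<and> (\<Sum>i=1..r. \<mu> i) = 0 \<and> (\<forall>i\<in>{1..r}. \<mu> i + of_nat n / of_nat r \<in> \<nat>)"
proof
  assume "\<mu> \<in> Pi_weights r n"
  then obtain a where mu: "\<mu> = wscale (of_nat n) (fund_weight r 1) - (\<Sum>i=1..r-1. wscale (of_nat (a i)) (simple_root i))"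
    and a: "a 1 \<le> n" "\<And>i. 1 \<le> i \<Longrightarrow> i < r - 1 \<Longrightarrow> a (i + 1) \<le> a i"
    unfolding Pi_weights_def by blast
  have app: "\<mu> k = (if k \<in> {1..r} then (if k = 1 then of_nat n else of_nat (a (k - 1))) - (if k < r then of_nat (a k) else 0) - of_nat n / of_nat r else 0)" for k
    unfolding mu by (rule Pi_weight_apply[OF r])
  have "supported r \<mu>" unfolding supported_def app by auto
  moreover have "(\<Sum>i=1..r. \<mu> i) = 0"
  proof -
    have "(\<Sum>i=1..r. wscale (of_nat n) (fund_weight r 1) i) = of_nat n * (\<Sum>i=1..r. fund_weight r 1 i)"
      by (simp only: wscale_def sum_distrib_left)
    also have "\<dots> = 0" using r by (subst sum_fund_weight) auto
    finally have 1: "(\<Sum>i=1..r. wscale (of_nat n) (fund_weight r 1) i) = 0" .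
    have s: "(\<Sum>k=1..r. simple_root i k) = 0" if "i \<in> {1..r-1}" for i
      using that r by (auto simp: simple_root_def eps_def sum_subtractf sum.delta)
    have "(\<Sum>k=1..r. (\<Sum>i=1..r-1. wscale (of_nat (a i)) (simple_root i)) k)
       = (\<Sum>i=1..r-1. of_nat (a i) * (\<Sum>k=1..r. simple_root i k))"
      unfolding sum_fun_apply wscale_def sum_distrib_left by (rule sum.swap)
    also have "\<dots> = 0" by (intro sum.neutral ballI) (simp only: s mult_zero_right)
    finally show ?thesis using 1 unfolding mu by (simp only: minus_apply sum_subtractf)
  qed
  moreover have "\<mu> i + of_nat n / of_nat r \<in> \<nat>" if i: "i \<in> {1..r}" for i
  proof -
    define x where "x = (if i = 1 then n else a (i - 1))"
    define y where "y = (if i < r then a i else 0)"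
    have "y \<le> x"
    proof (cases "i = 1 \<or> i = r")
      case False
      then have "a (i - 1 + 1) \<le> a (i - 1)" using i by (intro a(2)) auto
      then show ?thesis using False i by (simp add: x_def y_def)
    qed (use a(1) r in \<open>auto simp: x_def y_def\<close>)
    have "\<mu> i + of_nat n / of_nat r = of_nat x - of_nat y"
      using i unfolding app x_def y_def by auto
    also have "\<dots> = of_nat (x - y)" using \<open>y \<le> x\<close> by (simp add: of_nat_diff)
    finally show ?thesis by simp
  qed
  ultimately show "supported r \<mu> \<and> (\<Sum>i=1..r. \<mu> i) = 0 \<and> (\<forall>i\<in>{1..r}. \<mu> i + of_nat n / of_nat r \<in> \<nat>)"
    by blast
next
  assume *: "supported r \<mu> \<and> (\<Sum>i=1..r. \<mu> i) = 0 \<and> (\<forall>i\<in>{1..r}. \<mu> i + of_nat n / of_nat r \<in> \<nat>)"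
  define b where "b = (\<lambda>i. nat \<lfloor>\<mu> i + of_nat n / of_nat r\<rfloor>)"
  have b: "of_nat (b i) = \<mu> i + of_nat n / of_nat r" if "i \<in> {1..r}" for i
  proof -
    have "\<mu> i + of_nat n / of_nat r \<in> \<nat>" using * that by blast
    then show ?thesis unfolding b_def by (rule Nats_cases) simp
  qed
  have "(of_nat (\<Sum>i=1..r. b i) :: rat) = of_nat n"
    using * r by (simp add: b sum.distrib)
  then have bn: "(\<Sum>i=1..r. b i) = n" by (simp only: of_nat_eq_iff)
  define a where "a = (\<lambda>i. \<Sum>k=i+1..r. b k)"
  have a_step: "a i = b (i + 1) + a (i + 1)" if "i < r" for i
    using that unfolding a_def by (subst sum.atLeast_Suc_atMost) (auto simp: Suc_eq_plus1 simp del: add_Suc_right)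
  have a0: "a 0 = n" using bn by (simp add: a_def One_nat_def)
  have ar: "a r = 0" by (simp add: a_def)
  have "\<mu> = wscale (of_nat n) (fund_weight r 1) - (\<Sum>i=1..r-1. wscale (of_nat (a i)) (simple_root i))"
  proof
    fix k
    show "\<mu> k = (wscale (of_nat n) (fund_weight r 1) - (\<Sum>i=1..r-1. wscale (of_nat (a i)) (simple_root i))) k"
    proof (cases "k \<in> {1..r}")
      case True
      have "a (k - 1) = b k + a k" using a_step[of "k - 1"] True by auto
      then have "(of_nat (a (k - 1)) :: rat) = \<mu> k + of_nat n / of_nat r + of_nat (a k)"
        using b[OF True] by simp
      moreover have "(if k = 1 then of_nat n else of_nat (a (k - 1))) = (of_nat (a (k - 1)) :: rat)" using a0 by simp
      moreover have "(if k < r then of_nat (a k) else 0) = (of_nat (a k) :: rat)" using ar True by auto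
      ultimately show ?thesis unfolding Pi_weight_apply[OF r] using True by simp
    next
      case False
      then show ?thesis unfolding Pi_weight_apply[OF r] using * by (auto simp: supported_def)
    qed
  qed
  moreover have "a 1 \<le> n" using a_step[of 0] a0 r by simp
  moreover have "a (i + 1) \<le> a i" if "i < r - 1" for i using a_step[of i] that by simp
  ultimately show "\<mu> \<in> Pi_weights r n" unfolding Pi_weights_def by blast
qed

lemma finite_Pi_weights:
  assumes r: "r \<ge> 2" shows "finite (Pi_weights r n)"
proof -
  let ?x = "of_nat n / of_nat r :: rat"
  let ?B = "(\<lambda>b. of_nat b - ?x) ` {..n}"
  have "Pi_weights r n \<subseteq> {f. \<forall>i. (i \<in> {1..r} \<longrightarrow> f i \<in> ?B) \<and> (i \<notin> {1..r} \<longrightarrow> f i = 0)}"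
  proof (intro subsetI CollectI allI conjI impI)
    fix \<mu> i assume m: "\<mu> \<in> Pi_weights r n"
    note m' = m[unfolded Pi_weights_iff[OF r]]
    show "\<mu> i = 0" if "i \<notin> {1..r}" using m' that by (simp add: supported_def)
    assume i: "i \<in> {1..r}"
    have nn: "\<mu> k + ?x \<ge> 0" if "k \<in> {1..r}" for k
    proof -
      have "\<mu> k + ?x \<in> \<nat>" using m' that by blast
      then show ?thesis by (rule Nats_cases) simp
    qed
    have "\<mu> i + ?x \<le> (\<Sum>k=1..r. \<mu> k + ?x)" using i nn by (intro member_le_sum) auto
    also have "\<dots> = of_nat n" using m' r by (simp add: sum.distrib)
    finally have le: "\<mu> i + ?x \<le> of_nat n" .
    have "\<mu> i + ?x \<in> \<nat>" using m' i by blast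
    then obtain b where b: "\<mu> i + ?x = of_nat b" by (rule Nats_cases)
    then have "b \<le> n" using le by simp
    moreover have "\<mu> i = of_nat b - ?x" using b by simp
    ultimately show "\<mu> i \<in> ?B" by blast
  qed
  moreover have "finite {f. \<forall>i. (i \<in> {1..r} \<longrightarrow> f i \<in> ?B) \<and> (i \<notin> {1..r} \<longrightarrow> f i = (0::rat))}"
    by (rule finite_set_of_finite_funs) auto
  ultimately show ?thesis by (rule finite_subset)
qed

lemma pos_wscale: "root_positive r u \<Longrightarrow> c \<ge> 0 \<Longrightarrow> root_positive r (wscale c u)"
proof (cases "c = 0")
  case True
  then have "wscale c u = 0" by (simp add: wscale_def fun_eq_iff)
  then show ?thesis by (simp add: pos_0)
next
  case False
  assume "root_positive r u" "c \<ge> 0"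
  show ?thesis
  proof (cases "u = 0")
    case True
    then have "wscale c u = 0" by (simp add: wscale_def fun_eq_iff)
    then show ?thesis by (simp add: pos_0)
  next
    case u: False
    then show ?thesis using \<open>root_positive r u\<close> \<open>c \<ge> 0\<close> False by (simp add: root_positive_def wform_wscale_left)
  qed
qed

lemma pos_sum:
  assumes "finite A" "\<And>x. x \<in> A \<Longrightarrow> root_positive r (f x)"
  shows "root_positive r (sum f A)"
  using assms
proof (induction A)
  case (insert x A)
  then show ?case unfolding sum.insert[OF insert.hyps] by (intro pos_add) auto
qed (simp only: sum.empty pos_0)

text \<open>The complete homogeneous symmetric polynomial of degree n, with exponents projected to
  coordinate sum 0.\<close>

definition sym_power_char :: "nat \<Rightarrow> nat \<Rightarrow> (weight \<Rightarrow>\<^sub>0 int)" where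
  "sym_power_char r n = (\<Sum>\<mu>\<in>Pi_weights r n. monom1 \<mu>)"

lemma lookup_hpoly:
  assumes r: "r \<ge> 2" shows "lk (sym_power_char r n) \<mu> = (if \<mu> \<in> Pi_weights r n then 1 else 0)"
  using finite_Pi_weights[OF r] by (simp add: sym_power_char_def lookup_sum lookup_single when_def sum.delta)

lemma weyl_act_Pi_weights:
  assumes r: "r \<ge> 2" and w: "w permutes {1..r}" and m: "\<mu> \<in> Pi_weights r n"
  shows "weyl_act w \<mu> \<in> Pi_weights r n"
proof -
  note m' = m[unfolded Pi_weights_iff[OF r]]
  have "(\<Sum>i=1..r. weyl_act w \<mu> i) = 0"
    using sum_weyl_act[OF w, of "\<lambda>x y. x" \<mu> \<mu>] m' by simp
  moreover have "weyl_act w \<mu> i + of_nat n / of_nat r \<in> \<nat>" if "i \<in> {1..r}" for i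
  proof -
    have "Hilbert_Choice.inv w i \<in> {1..r}"
      using that permutes_in_image[OF permutes_inv[OF w]] by blast
    then show ?thesis using m' by (simp add: weyl_act_def)
  qed
  ultimately show ?thesis
    unfolding Pi_weights_iff[OF r] using m' supported_weyl_act[OF w] by blast
qed

text \<open>The Casimir identity for the \<open>n\<close>-th symmetric power, in terms of the exponents \<open>b\<close> of a monomial.\<close>

lemma sum_normalized_squares:
  fixes b :: "nat \<Rightarrow> rat"
  assumes r: "r \<ge> 2" and b: "(\<Sum>i=1..r. b i) = N"
  shows "(\<Sum>k=1..r. (b k - N / of_nat r) * (b k - N / of_nat r))
     + (\<Sum>(i, j)\<in>pairs r. b i - b j + 2 * (b j * (b i + 1))) = N * N - N * N / of_nat r + (of_nat r - 1) * N"
proof -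
  have 1: "(\<Sum>k=1..r. (b k - N / of_nat r) * (b k - N / of_nat r)) = (\<Sum>k=1..r. b k * b k) - N * N / of_nat r"
  proof -
    have "(\<Sum>k=1..r. (b k - N / of_nat r) * (b k - N / of_nat r))
       = (\<Sum>k=1..r. b k * b k - 2 * (N / of_nat r) * b k + N / of_nat r * (N / of_nat r))"
      by (intro sum.cong refl) (simp add: algebra_simps)
    also have "\<dots> = (\<Sum>k=1..r. b k * b k) - 2 * (N / of_nat r) * (\<Sum>k=1..r. b k) + of_nat r * (N / of_nat r * (N / of_nat r))"
      by (simp add: sum.distrib sum_subtractf sum_distrib_left)
    also have "\<dots> = (\<Sum>k=1..r. b k * b k) - N * N / of_nat r"
      using r unfolding b by (simp add: field_simps)
    finally show ?thesis .
  qed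
  have "N * N = (\<Sum>i=1..r. \<Sum>j=1..r. b i * b j)"
    unfolding b[symmetric] by (rule sum_product)
  also have "\<dots> = (\<Sum>i=1..r. b i * b i) + (\<Sum>(i, j)\<in>pairs r. b i * b j + b j * b i)"
    by (rule sum_square_pairs)
  finally have 2: "(\<Sum>(i, j)\<in>pairs r. 2 * (b i * b j)) = N * N - (\<Sum>i=1..r. b i * b i)"
    by (simp add: mult.commute)
  have "(\<Sum>(i, j)\<in>pairs r. b i - b j + 2 * (b j * (b i + 1))) = (\<Sum>(i, j)\<in>pairs r. (b i + b j) + 2 * (b i * b j))"
    by (intro sum.cong refl) (auto simp: algebra_simps)
  also have "\<dots> = (\<Sum>(i, j)\<in>pairs r. b i + b j) + (\<Sum>(i, j)\<in>pairs r. 2 * (b i * b j))"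
    by (simp only: split_def sum.distrib)
  also have "\<dots> = (of_nat r - 1) * N + (N * N - (\<Sum>i=1..r. b i * b i))"
    unfolding 2 sum_pairs_add b ..
  finally show ?thesis unfolding 1 by simp
qed

lemma multiple_fund_weight_dominant:
  assumes r: "r \<ge> 2" shows "wscale (of_nat n) (fund_weight r 1) \<in> dominant_weights r"
proof -
  have "(\<Sum>i=1..r-1. wscale (of_nat (if i = 1 then n else 0)) (fund_weight r i))
     = (\<Sum>i=1..r-1. if i = 1 then wscale (of_nat n) (fund_weight r 1) else 0)"
    by (intro sum.cong refl) (auto simp: wscale_def fun_eq_iff)
  also have "\<dots> = wscale (of_nat n) (fund_weight r 1)"
    using r by (simp add: sum.delta)
  finally show ?thesis unfolding dominant_weights_def mem_Collect_eq
    by (intro exI[of _ "\<lambda>i. if i = 1 then n else 0"]) simp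
qed

text \<open>An application of \<open>character_times_denominator\<close> in which the trace
  coefficients are given by a formula, so that no model of the symmetric power as a module is
  required.\<close>

lemma hpoly_times_denominator:
  assumes r: "r \<ge> 2"
  shows "sym_power_char r n * weyl_product r = alt r (wscale (of_nat n) (fund_weight r 1) + weyl_vector r)"
proof -
  define x where "x = (of_nat n / of_nat r :: rat)"
  define P where "P = (\<lambda>\<mu>. \<mu> \<in> Pi_weights r n)"
  have P: "P \<mu> \<longleftrightarrow> supported r \<mu> \<and> (\<Sum>i=1..r. \<mu> i) = 0 \<and> (\<forall>i\<in>{1..r}. \<mu> i + x \<in> \<nat>)" for \<mu>
    unfolding P_def x_def by (rule Pi_weights_iff[OF r])
  \<comment> \<open>On polynomials \<open>F i j\<close> would be
    \<open>x\<^sub>i \<partial>\<^sub>j\<close>, and following it by \<open>F j i\<close> multiplies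
    the monomial with exponents b by \<open>b j * (b i + 1)\<close>; here
    \<open>b k = \<mu> k + x\<close>.\<close>
  define t where "t = (\<lambda>i j \<mu>. if P \<mu> then (\<mu> j + x) * (\<mu> i + x + 1) else 0)"
  define T where "T = (\<lambda>i j. \<Sum>\<mu>\<in>Pi_weights r n. Poly_Mapping.single \<mu> (of_rat (t i j \<mu>) :: complex))"
  have lT: "lk (T i j) \<mu> = of_rat (t i j \<mu>)" for i j \<mu>
    using finite_Pi_weights[OF r] by (simp add: T_def lookup_sum lookup_single when_def sum.delta t_def P_def)
  have lh: "lk (cmap (sym_power_char r n)) \<mu> = (if P \<mu> then 1 else 0)" for \<mu>
    by (simp add: lookup_cmap lookup_hpoly[OF r] P_def)
  have keys: "\<mu> \<in> Poly_Mapping.keys (sym_power_char r n) \<longleftrightarrow> P \<mu>" for \<mu>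
    by (simp add: in_keys_iff lookup_hpoly[OF r] P_def)
  have shift: "t i j (\<mu> + (eps j - eps i)) = t i j \<mu> + (if P \<mu> then \<mu> i - \<mu> j else 0)"
    if ij: "i \<in> {1..r}" "j \<in> {1..r}" "i \<noteq> j" for i j \<mu>
  proof -
    define \<mu>' where "\<mu>' = \<mu> + (eps j - eps i)"
    have v: "\<mu>' i = \<mu> i - 1" "\<mu>' j = \<mu> j + 1" "\<And>k. k \<noteq> i \<Longrightarrow> k \<noteq> j \<Longrightarrow> \<mu>' k = \<mu> k"
      using ij by (auto simp: \<mu>'_def eps_def)
    have s: "supported r \<mu>' \<longleftrightarrow> supported r \<mu>" using ij by (auto simp: \<mu>'_def supported_def eps_def)
    have sm: "(\<Sum>k=1..r. \<mu>' k) = (\<Sum>k=1..r. \<mu> k)"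
      using ij by (simp add: \<mu>'_def sum.distrib sum_subtractf eps_def sum.delta)
    have nat_dec: "y = 0" if y: "y \<in> \<nat>" "y - 1 \<notin> \<nat>" for y :: rat
    proof (rule ccontr)
      assume "y \<noteq> 0"
      obtain m where m: "y = of_nat m" using y(1) by (rule Nats_cases)
      then have "y - 1 = of_nat (m - 1)" using \<open>y \<noteq> 0\<close> by (cases m) auto
      then show False using y(2) by simp
    qed
    have nat_inc: "y + 1 \<in> \<nat>" if "y \<in> \<nat>" for y :: rat using that by (intro Nats_add) auto
    have other: "\<mu> k + x \<in> \<nat> \<longleftrightarrow> \<mu>' k + x \<in> \<nat>" if "k \<noteq> i" "k \<noteq> j" for k using v(3)[OF that] by simp
    \<comment> \<open>The cases with just one weight are the boundary ones: if only \<mu> is a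
      weight, its exponent i is 0; if only \<open>\<mu>'\<close> is, its exponent j is 0. The
      product formula then gives the right value.\<close>
    consider "P \<mu>" "P \<mu>'" | "P \<mu>" "\<not> P \<mu>'" | "\<not> P \<mu>" "P \<mu>'" | "\<not> P \<mu>" "\<not> P \<mu>'" by blast
    then have "t i j \<mu>' = t i j \<mu> + (if P \<mu> then \<mu> i - \<mu> j else 0)"
    proof cases
      case 1
      then show ?thesis unfolding t_def v(1,2) by (simp add: algebra_simps)
    next
      case 2
      have "\<mu> i + x - 1 \<notin> \<nat>"
      proof
        assume d: "\<mu> i + x - 1 \<in> \<nat>"
        have "\<mu>' k + x \<in> \<nat>" if "k \<in> {1..r}" for k
        proof -
          have "\<mu> k + x \<in> \<nat>" using 2(1) that by (simp add: P)
          moreover have "\<mu>' i + x = \<mu> i + x - 1" "\<mu>' j + x = \<mu> j + x + 1" using v(1,2) by simp_all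
          ultimately show ?thesis using nat_inc d other by metis
        qed
        then show False using 2 s sm by (simp only: P) blast
      qed
      moreover have "\<mu> i + x \<in> \<nat>" using 2(1) ij by (simp add: P)
      ultimately have "\<mu> i + x = 0" using nat_dec by blast
      then have "x = - \<mu> i" by simp
      then show ?thesis using 2 unfolding t_def by simp
    next
      case 3
      have "\<mu> j + x \<notin> \<nat>"
      proof
        assume d: "\<mu> j + x \<in> \<nat>"
        have "\<mu> k + x \<in> \<nat>" if "k \<in> {1..r}" for k
        proof -
          have "\<mu>' k + x \<in> \<nat>" using 3(2) that by (simp add: P)
          moreover have "\<mu> i + x = \<mu>' i + x + 1" using v(1) by simp
          ultimately show ?thesis using nat_inc d other by metis
        qed
        then show False using 3 s sm by (simp only: P) blast
      qed
      moreover have "\<mu>' j + x \<in> \<nat>" using 3(2) ij by (simp only: P)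
      ultimately have "\<mu> j + 1 + x = 0" using nat_dec[of "\<mu> j + 1 + x"] unfolding v(2) by (simp add: algebra_simps)
      then show ?thesis using 3 unfolding t_def v(2) by simp
    next
      case 4
      then show ?thesis by (simp add: t_def)
    qed
    then show ?thesis by (simp only: \<mu>'_def)
  qed
  have lead: "leading r (sym_power_char r n) (wscale (of_nat n) (fund_weight r 1))"
    unfolding leading_def
  proof (intro conjI ballI)
    have "wscale (of_nat n) (fund_weight r 1) \<in> Pi_weights r n"
    proof -
      have "(\<Sum>i=1..r-1. wscale (of_nat 0) (simple_root i)) = 0"
        by (intro sum.neutral ballI) (simp add: wscale_def fun_eq_iff)
      then have "wscale (of_nat n) (fund_weight r 1) = wscale (of_nat n) (fund_weight r 1) - (\<Sum>i=1..r-1. wscale (of_nat 0) (simple_root i))"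
        by (simp only: diff_zero)
      then show ?thesis unfolding Pi_weights_def mem_Collect_eq by (intro exI[of _ "\<lambda>_. 0"]) auto
    qed
    then show "lk (sym_power_char r n) (wscale (of_nat n) (fund_weight r 1)) = 1" by (simp add: lookup_hpoly[OF r])
    fix \<mu> assume "\<mu> \<in> Poly_Mapping.keys (sym_power_char r n)"
    then have "\<mu> \<in> Pi_weights r n" by (simp add: keys P_def)
    then obtain a :: "nat \<Rightarrow> nat" where mu: "\<mu> = wscale (of_nat n) (fund_weight r 1) - (\<Sum>i=1..r-1. wscale (of_nat (a i)) (simple_root i))"
      unfolding Pi_weights_def by blast
    have "root_positive r (\<Sum>i=1..r-1. wscale (of_nat (a i)) (simple_root i))"
      unfolding simple_root_def by (intro pos_sum pos_wscale pos_root) (auto simp: pairs_def)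
    moreover have "wscale (of_nat n) (fund_weight r 1) - \<mu> = (\<Sum>i=1..r-1. wscale (of_nat (a i)) (simple_root i))"
      unfolding mu by (simp only: diff_diff_eq2 add_diff_cancel_left')
    ultimately show "root_positive r (wscale (of_nat n) (fund_weight r 1) - \<mu>)" by simp
  qed
  \<comment> \<open>The Casimir eigenvalue
    \<open>(n\<Lambda>\<^sub>1, n\<Lambda>\<^sub>1 + 2\<delta>)\<close>.\<close>
  define c where "c = of_nat n * of_nat n - of_nat n * of_nat n / of_nat r + (of_nat r - 1) * (of_nat n :: rat)"
  show ?thesis
  proof (rule character_times_denominator[where T = T and c = "of_rat c"])
    fix i j assume "(i, j) \<in> pairs r"
    then have ij: "i \<in> {1..r}" "j \<in> {1..r}" "i \<noteq> j" by (auto simp: pairs_def)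
    show "(monom1 (eps i) - monom1 (eps j)) * T i j = monom1 (eps j) * (weight_deriv i (cmap (sym_power_char r n)) - weight_deriv j (cmap (sym_power_char r n)))"
    proof (rule poly_mapping_eqI)
      fix \<mu>0
      define \<mu> where "\<mu> = \<mu>0 - eps j"
      have e: "\<mu>0 - eps i = \<mu> + (eps j - eps i)" by (simp add: \<mu>_def)
      have "(of_rat (t i j (\<mu> + (eps j - eps i))) :: complex) - of_rat (t i j \<mu>)
         = of_rat (\<mu> i) * (if P \<mu> then 1 else 0) - of_rat (\<mu> j) * (if P \<mu> then 1 else 0)"
        unfolding shift[OF ij] by (simp add: of_rat_add of_rat_diff)
      then show "lk ((monom1 (eps i) - monom1 (eps j)) * T i j) \<mu>0 = lk (monom1 (eps j) * (weight_deriv i (cmap (sym_power_char r n)) - weight_deriv j (cmap (sym_power_char r n)))) \<mu>0"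
        unfolding left_diff_distrib lookup_minus lookup_single_mult e \<mu>_def[symmetric] lookup_D lT lh .
    qed
  next
    show "Cst (of_rat c) * cmap (sym_power_char r n) = (\<Sum>k=1..r. weight_deriv k (weight_deriv k (cmap (sym_power_char r n))))
       + (\<Sum>(i, j)\<in>pairs r. weight_deriv i (cmap (sym_power_char r n)) - weight_deriv j (cmap (sym_power_char r n)) + 2 * T i j)"
    proof (rule poly_mapping_eqI)
      fix \<mu>
      have two: "lk (2 * y) \<mu> = 2 * lk y \<mu>" for y :: "weight \<Rightarrow>\<^sub>0 complex"
        using lookup_Cst_mult[of 2 y \<mu>] by (simp add: Cst_simps)
      have "lk ((\<Sum>k=1..r. weight_deriv k (weight_deriv k (cmap (sym_power_char r n)))) + (\<Sum>(i, j)\<in>pairs r. weight_deriv i (cmap (sym_power_char r n)) - weight_deriv j (cmap (sym_power_char r n)) + 2 * T i j)) \<mu>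
        = (\<Sum>k=1..r. of_rat (\<mu> k) * (of_rat (\<mu> k) * lk (cmap (sym_power_char r n)) \<mu>))
          + (\<Sum>(i, j)\<in>pairs r. of_rat (\<mu> i) * lk (cmap (sym_power_char r n)) \<mu> - of_rat (\<mu> j) * lk (cmap (sym_power_char r n)) \<mu> + 2 * lk (T i j) \<mu>)"
        by (simp add: lookup_add lookup_sum lookup_D split_def lookup_minus two)
      also have "\<dots> = of_rat c * lk (cmap (sym_power_char r n)) \<mu>"
      proof (cases "P \<mu>")
        case True
        let ?b = "\<lambda>k. \<mu> k + x"
        have "(\<Sum>k=1..r. ?b k) = of_nat n" using True r by (simp add: P sum.distrib x_def)
        from sum_normalized_squares[OF r this]
        have "(\<Sum>k=1..r. \<mu> k * \<mu> k) + (\<Sum>(i, j)\<in>pairs r. \<mu> i - \<mu> j + 2 * t i j \<mu>) = c"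
          using True by (simp add: x_def[symmetric] c_def t_def)
        then have "of_rat c = (\<Sum>k=1..r. of_rat (\<mu> k) * of_rat (\<mu> k))
           + (\<Sum>(i, j)\<in>pairs r. of_rat (\<mu> i) - of_rat (\<mu> j) + 2 * of_rat (t i j \<mu>) :: complex)"
          by (simp add: of_rat_add of_rat_sum of_rat_mult of_rat_diff split_def flip: \<open>_ = c\<close>)
        then show ?thesis using True by (simp add: lT lh)
      next
        case False
        then show ?thesis by (simp add: lT lh t_def split_def)
      qed
      finally show "lk (Cst (of_rat c) * cmap (sym_power_char r n)) \<mu> = lk ((\<Sum>k=1..r. weight_deriv k (weight_deriv k (cmap (sym_power_char r n))))
       + (\<Sum>(i, j)\<in>pairs r. weight_deriv i (cmap (sym_power_char r n)) - weight_deriv j (cmap (sym_power_char r n)) + 2 * T i j)) \<mu>"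
        by (simp add: lookup_Cst_mult)
    qed
  next
    fix \<mu> assume "\<mu> \<in> Poly_Mapping.keys (sym_power_char r n)"
    then show "(\<Sum>i=1..r. \<mu> i) = 0" "supported r \<mu>" by (simp_all add: keys P)
  next
    show "weyl_symmetric r (sym_power_char r n)"
    proof (rule symI_adj)
      fix k \<mu> assume "k \<in> {1..<r}"
      then have p: "adj k permutes {1..r}" by (rule adj_permutes)
      have "weyl_act (adj k) \<mu> \<in> Pi_weights r n \<longleftrightarrow> \<mu> \<in> Pi_weights r n"
      proof
        assume "weyl_act (adj k) \<mu> \<in> Pi_weights r n"
        then have "weyl_act (adj k) (weyl_act (adj k) \<mu>) \<in> Pi_weights r n" by (rule weyl_act_Pi_weights[OF r p])
        moreover have "weyl_act (adj k) (weyl_act (adj k) \<mu>) = \<mu>" by (simp add: fun_eq_iff weyl_act_transpose)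
        ultimately show "\<mu> \<in> Pi_weights r n" by metis
      qed (rule weyl_act_Pi_weights[OF r p])
      then show "lk (sym_power_char r n) (weyl_act (adj k) \<mu>) = lk (sym_power_char r n) \<mu>" by (simp add: lookup_hpoly[OF r])
    qed
  qed (rule lead dominant_strictdom multiple_fund_weight_dominant r)+
qed

text \<open>Both sides have the same product with the denominator, which cancels.\<close>

lemma irrep_char_symmetric_power:
  assumes r: "r \<ge> 2"
  shows "irrep_char r (wscale (of_nat n) (fund_weight r 1)) = sym_power_char r n"
proof (rule mult_dn_cancel)
  have "r > 0" using r by simp
  from irrep_char_times_denominator[OF this multiple_fund_weight_dominant[OF r]] hpoly_times_denominator[OF r]
  show "irrep_char r (wscale (of_nat n) (fund_weight r 1)) * weyl_product r = sym_power_char r n * weyl_product r" by simp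
qed

subsection \<open>Adams operations\<close>

lemma adams_eq_lin: "adams p f = lin (\<lambda>\<mu>. monom1 (wscale (of_nat p) \<mu>)) f"
  unfolding adams_def lin_def
proof (rule sum.cong[OF refl])
  fix \<mu>
  show "Poly_Mapping.single (wscale (of_nat p) \<mu>) (lk f \<mu>) = of_int (lk f \<mu>) * monom1 (wscale (of_nat p) \<mu>)"
    by (rule poly_mapping_eqI) (simp add: lookup_of_int_mult lookup_single when_def)
qed

lemma adams_hpoly: "adams p (sym_power_char r n) = (\<Sum>\<mu>\<in>Pi_weights r n. monom1 (wscale (of_nat p) \<mu>))"
  by (simp add: adams_eq_lin sym_power_char_def lin_sum)

lemma sym_adams_hpoly:
  assumes r: "r \<ge> 2" shows "weyl_symmetric r (adams p (sym_power_char r n))"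
proof (rule symI_adj)
  fix k \<mu> assume "k \<in> {1..<r}"
  then have per: "adj k permutes {1..r}" by (rule adj_permutes)
  have invol: "weyl_act (adj k) (weyl_act (adj k) \<mu>) = \<mu>" for \<mu>
    by (simp add: fun_eq_iff weyl_act_transpose)
  have "act (adj k) (adams p (sym_power_char r n)) = (\<Sum>\<mu>\<in>Pi_weights r n. monom1 (wscale (of_nat p) (weyl_act (adj k) \<mu>)))"
    unfolding adams_hpoly by (simp add: act_def lin_sum weyl_act_wscale)
  also have "\<dots> = adams p (sym_power_char r n)"
    unfolding adams_hpoly
    by (rule sum.reindex_bij_witness[of _ "weyl_act (adj k)" "weyl_act (adj k)"])
      (simp_all only: invol weyl_act_Pi_weights[OF r per])
  finally show "lk (adams p (sym_power_char r n)) (weyl_act (adj k) \<mu>) = lk (adams p (sym_power_char r n)) \<mu>"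
    using lookup_act[of "adj k" "adams p (sym_power_char r n)" \<mu>] by simp
qed

lemma sum_weyl_vector: "(\<Sum>i=1..r. weyl_vector r i) = 0"
proof -
  have "(\<Sum>i=1..r. weyl_vector r i) = (\<Sum>i=1..r. weyl_vector r (1 + r - i))"
    by (rule sum.reindex_bij_witness[of _ "\<lambda>i. 1 + r - i" "\<lambda>i. 1 + r - i"]) auto
  also have "\<dots> = (\<Sum>i=1..r. - weyl_vector r i)"
    by (intro sum.cong refl) (auto simp: weyl_vector_apply of_nat_diff field_simps)
  finally show ?thesis by (simp add: sum_negf)
qed

text \<open>Distinct weights \<open>\<nu> + \<delta>\<close> in the open chamber have alternating
  sums with separate leading coefficients. This yields the uniqueness behind the definite
  description in \<open>adams_coeffs\<close>.\<close>

lemma lookup_combination_alt: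
  assumes m: "Poly_Mapping.keys m \<subseteq> dominant_weights r" and \<nu>: "\<nu> \<in> dominant_weights r"
  shows "lk (lin (\<lambda>\<nu>. alt r (\<nu> + weyl_vector r)) m) (\<nu> + weyl_vector r) = lk m \<nu>"
proof -
  have "lk (lin (\<lambda>\<nu>. alt r (\<nu> + weyl_vector r)) m) (\<nu> + weyl_vector r)
     = (\<Sum>\<kappa>\<in>Poly_Mapping.keys m. if \<kappa> = \<nu> then lk m \<kappa> else 0)"
    unfolding lin_def lookup_sum
  proof (rule sum.cong[OF refl])
    fix \<kappa> assume "\<kappa> \<in> Poly_Mapping.keys m"
    then have "strictdom r (\<kappa> + weyl_vector r)" using m by (intro dominant_strictdom) auto
    then show "lk (of_int (lk m \<kappa>) * alt r (\<kappa> + weyl_vector r)) (\<nu> + weyl_vector r) = (if \<kappa> = \<nu> then lk m \<kappa> else 0)"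
      unfolding lookup_of_int_mult lookup_alt_strictdom[OF _ dominant_strictdom[OF \<nu>]]
      by (simp only: lookup_alt_strictdom[OF _ dominant_strictdom[OF \<nu>]] add_right_cancel) simp
  qed
  then show ?thesis by (simp add: sum.delta in_keys_iff)
qed

lemma lin_irrep_char_times_dn:
  assumes r: "r > 0" and m: "Poly_Mapping.keys m \<subseteq> dominant_weights r"
  shows "lin (irrep_char r) m * weyl_product r = lin (\<lambda>\<nu>. alt r (\<nu> + weyl_vector r)) m"
  unfolding lin_def sum_distrib_right
proof (rule sum.cong[OF refl])
  fix \<nu> assume "\<nu> \<in> Poly_Mapping.keys m"
  then have "irrep_char r \<nu> * weyl_product r = alt r (\<nu> + weyl_vector r)"
    using m by (intro irrep_char_times_denominator r) auto
  then show "of_int (lk m \<nu>) * irrep_char r \<nu> * weyl_product r = of_int (lk m \<nu>) * alt r (\<nu> + weyl_vector r)"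
    by (simp only: mult.assoc)
qed

text \<open>Times the denominator, the Adams image is antisymmetric; its coefficients at strictly
  dominant weights, moved back by \<delta>, form the required combination of irreducible characters.
  Existence and uniqueness together give access to \<open>adams_coeffs\<close>.\<close>

lemma adams_coeffs_symmetric_power:
  fixes r n p :: nat
  assumes r: "r \<ge> 2"
  defines "m \<equiv> adams_coeffs r p (wscale (of_nat n) (fund_weight r 1))"
  shows "Poly_Mapping.keys m \<subseteq> dominant_weights r" "adams p (sym_power_char r n) = lin (irrep_char r) m"
proof -
  let ?f = "adams p (sym_power_char r n)"
  have r0: "r > 0" using r by simp
  define G where "G = ?f * weyl_product r"
  have anti: "weyl_antisymmetric r G"
    unfolding G_def by (rule antisym_sym_mult[OF sym_adams_hpoly[OF r] antisym_dn])
  \<comment> \<open>A strictly dominant exponent has positive integral gaps and \<delta> has all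
    gaps 1, so subtracting \<delta> leaves natural numbers.\<close>
  have dom: "\<kappa> - weyl_vector r \<in> dominant_weights r" if \<kappa>: "\<kappa> \<in> Poly_Mapping.keys G" "strictdom r \<kappa>" for \<kappa>
  proof -
    obtain a b where ab: "\<kappa> = a + b" "a \<in> Poly_Mapping.keys ?f" "b \<in> Poly_Mapping.keys (weyl_product r :: weight \<Rightarrow>\<^sub>0 int)"
      using \<kappa>(1) unfolding G_def by (rule keys_multE)
    obtain \<tau> where l: "\<tau> \<in> Pi_weights r n" "a = wscale (of_nat p) \<tau>"
    proof -
      have "a \<in> (\<Union>\<mu>\<in>Pi_weights r n. Poly_Mapping.keys (monom1 (wscale (of_nat p) \<mu>) :: weight \<Rightarrow>\<^sub>0 int))"
        by (rule subsetD[OF keys_sum]) (use ab(2) in \<open>simp only: adams_hpoly\<close>)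
      then show ?thesis using that by auto
    qed
    note l' = l(1)[unfolded Pi_weights_iff[OF r]]
    obtain w where w: "w permutes {1..r}" "b = weyl_act w (weyl_vector r)"
      using ab(3) unfolding dn_eq_alt by (rule keys_alt)
    have sb: "(\<Sum>i=1..r. b i) = 0"
      using sum_weyl_act[OF w(1), of "\<lambda>x y. x" "weyl_vector r" "weyl_vector r"] sum_weyl_vector w(2) by simp
    have sa: "(\<Sum>i=1..r. a i) = 0"
      using l' unfolding l(2) wscale_def sum_distrib_left[symmetric] by simp
    have "supported r (\<kappa> - weyl_vector r)"
      unfolding ab(1) l(2) using l' keys_dn(1)[OF ab(3)]
      by (intro supported_diff supported_add supported_wscale supported_weyl_vector) auto
    moreover have "(\<Sum>i=1..r. (\<kappa> - weyl_vector r) i) = 0"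
      using sa sb sum_weyl_vector[of r] by (simp add: ab(1) sum.distrib sum_subtractf)
    moreover have "(\<kappa> - weyl_vector r) k - (\<kappa> - weyl_vector r) (k + 1) \<in> \<nat>" if k: "k \<in> {1..<r}" for k
    proof -
      have in_r: "k \<in> {1..r}" "k + 1 \<in> {1..r}" using k by auto
      have "(\<tau> k + of_nat n / of_nat r) - (\<tau> (k + 1) + of_nat n / of_nat r) \<in> \<int>"
        using l' in_r Nats_subset_Ints by (intro Ints_diff) blast+
      then have "\<tau> k - \<tau> (k + 1) \<in> \<int>" by simp
      then have "of_nat p * (\<tau> k - \<tau> (k + 1)) \<in> \<int>" by (rule Ints_mult[OF Ints_of_nat])
      then have "of_nat p * (\<tau> k - \<tau> (k + 1)) + (b k - b (k + 1)) \<in> \<int>"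
        using keys_dn(2)[OF ab(3) in_r] by (rule Ints_add)
      then have "of_nat p * (\<tau> k - \<tau> (k + 1)) + (b k - b (k + 1)) - 1 \<in> \<int>"
        by (rule Ints_diff[OF _ Ints_1])
      moreover have "of_nat p * (\<tau> k - \<tau> (k + 1)) + (b k - b (k + 1)) = \<kappa> k - \<kappa> (k + 1)"
        by (simp add: ab(1) l(2) wscale_def algebra_simps)
      ultimately obtain z where z: "\<kappa> k - \<kappa> (k + 1) - 1 = of_int z" by (metis Ints_cases)
      have d: "weyl_vector r k - weyl_vector r (k + 1) = 1"
        using in_r by (simp add: weyl_vector_apply field_simps)
      have "\<kappa> k - \<kappa> (k + 1) > 0" using \<kappa>(2) k by (simp add: strictdom_def)
      then have "(of_int z :: rat) > of_int (- 1)" using z by simp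
      then have "z \<ge> 0" unfolding of_int_less_iff by simp
      then obtain j where "z = int j" by (rule nonneg_int_cases)
      then have "\<kappa> k - \<kappa> (k + 1) - 1 \<in> \<nat>" using z by simp
      moreover have "(\<kappa> - weyl_vector r) k - (\<kappa> - weyl_vector r) (k + 1) = \<kappa> k - \<kappa> (k + 1) - 1"
        using d by (simp only: minus_apply)
      ultimately show ?thesis by (simp only:)
    qed
    ultimately show ?thesis unfolding dominant_weights_iff by blast
  qed
  let ?K = "{\<kappa>. \<kappa> \<in> Poly_Mapping.keys G \<and> strictdom r \<kappa>}"
  define m0 where "m0 = (\<Sum>\<kappa>\<in>?K. Poly_Mapping.single (\<kappa> - weyl_vector r) (lk G \<kappa>))"
  have keys0: "Poly_Mapping.keys m0 \<subseteq> dominant_weights r"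
  proof
    fix \<nu> assume "\<nu> \<in> Poly_Mapping.keys m0"
    then have "\<nu> \<in> (\<Union>\<kappa>\<in>?K. Poly_Mapping.keys (Poly_Mapping.single (\<kappa> - weyl_vector r) (lk G \<kappa>)))"
      unfolding m0_def by (rule subsetD[OF keys_sum])
    then obtain \<kappa> where "\<kappa> \<in> ?K" "\<nu> = \<kappa> - weyl_vector r" by (auto split: if_splits)
    then show "\<nu> \<in> dominant_weights r" using dom by blast
  qed
  have "?f = lin (irrep_char r) m0"
  proof (rule mult_dn_cancel)
    have "lin (irrep_char r) m0 * weyl_product r = lin (\<lambda>\<nu>. alt r (\<nu> + weyl_vector r)) m0"
      by (rule lin_irrep_char_times_dn[OF r0 keys0])
    also have "\<dots> = (\<Sum>\<kappa>\<in>?K. of_int (lk G \<kappa>) * alt r \<kappa>)"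
      unfolding m0_def lin_sum lin_single by (simp only: diff_add_cancel)
    also have "\<dots> = G" by (rule antisym_expand[OF anti, symmetric])
    finally show "?f * weyl_product r = lin (irrep_char r) m0 * weyl_product r" by (simp only: G_def)
  qed
  then have ex: "Poly_Mapping.keys m0 \<subseteq> dominant_weights r \<and> ?f = lin (irrep_char r) m0"
    using keys0 by simp
  have uniq: "m' = m0" if m': "Poly_Mapping.keys m' \<subseteq> dominant_weights r \<and> ?f = lin (irrep_char r) m'" for m'
  proof (rule poly_mapping_eqI)
    fix \<nu>
    have eq: "lin (\<lambda>\<nu>. alt r (\<nu> + weyl_vector r)) m' = lin (\<lambda>\<nu>. alt r (\<nu> + weyl_vector r)) m0"
      using lin_irrep_char_times_dn[OF r0] m' ex by metis
    show "lk m' \<nu> = lk m0 \<nu>"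
    proof (cases "\<nu> \<in> dominant_weights r")
      case True
      then show ?thesis using lookup_combination_alt[of m' r \<nu>] lookup_combination_alt[of m0 r \<nu>] m' ex eq by metis
    next
      case False
      then have "\<nu> \<notin> Poly_Mapping.keys m'" "\<nu> \<notin> Poly_Mapping.keys m0" using m' ex by auto
      then show ?thesis by (simp add: in_keys_iff)
    qed
  qed
  have "m = m0"
    unfolding m_def adams_coeffs_def irrep_char_symmetric_power[OF r] lin_def[symmetric]
    by (rule the_equality) (use ex uniq in auto)
  then show "Poly_Mapping.keys m \<subseteq> dominant_weights r" "?f = lin (irrep_char r) m" using ex by auto
qed

subsection \<open>The torus knot invariant\<close>

text \<open>The norm is constant on the orbit, so the Gaussian factor leaves the sum and the linear
  part of the exponent is \<open>qdim\<close>.\<close>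

lemma lin_alt_gauss:
  "lin (\<lambda>\<mu>. qpow (a * wnormsq r \<mu> + wform r \<mu> (weyl_vector r))) (alt r \<kappa>)
     = qpow (a * wnormsq r \<kappa>) * qdim r (alt r \<kappa>)"
  unfolding qdim_eq_lin alt_def lin_sum lin_single sum_distrib_left
  by (intro sum.cong refl) (simp add: wnormsq_weyl_act qpow_add)

text \<open>Completing the square: the first summand is twice the exponent of the twist, the second
  gives the prefactor of the final formula.\<close>

lemma wnormsq_add_weyl_vector:
  "wnormsq r (\<nu> + weyl_vector r) = wform r \<nu> (\<nu> + wscale 2 (weyl_vector r)) + wnormsq r (weyl_vector r)"
  by (simp add: wnormsq_def wform_add_left wform_add_right wform_wscale_right wform_commute[of r "weyl_vector r" \<nu>])

text \<open>The theorem with denominators cleared, an identity in the ring of Laurent polynomials,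
  so that the fraction field enters only at the very end.\<close>

lemma gauss_sum_eq_invariant:
  fixes r n p p' :: nat
  assumes r: "r \<ge> 2"
  defines "a \<equiv> of_nat p' / (2 * of_nat p)"
  shows "(\<Sum>\<mu>\<in>Pi_weights r n. \<Sum>w | w permutes {1..r}. (-1) ^ coxeter_length r w
          * qpow (a * wnormsq r (wscale (of_nat p) \<mu> + weyl_act w (weyl_vector r))
                  + wform r (wscale (of_nat p) \<mu> + weyl_act w (weyl_vector r)) (weyl_vector r)))
    = qpow (a * wnormsq r (weyl_vector r)) * qdim r (weyl_denominator r)
        * torus_knot_invariant r p p' (wscale (of_nat n) (fund_weight r 1))"
proof -
  let ?\<phi> = "\<lambda>\<mu>. qpow (a * wnormsq r \<mu> + wform r \<mu> (weyl_vector r))"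
  define m where "m = adams_coeffs r p (wscale (of_nat n) (fund_weight r 1))"
  note m = adams_coeffs_symmetric_power[OF r, of p n, folded m_def]
  have r0: "r > 0" using r by simp
  have "adams p (sym_power_char r n) * weyl_product r = (\<Sum>\<mu>\<in>Pi_weights r n. \<Sum>w | w permutes {1..r}.
      Poly_Mapping.single (wscale (of_nat p) \<mu> + weyl_act w (weyl_vector r)) (sign w))"
    unfolding adams_hpoly dn_eq_alt alt_def sum_distrib_right sum_distrib_left by (simp add: mult_single)
       (rule sum.swap)
  then have "lin ?\<phi> (adams p (sym_power_char r n) * weyl_product r) = (\<Sum>\<mu>\<in>Pi_weights r n. \<Sum>w | w permutes {1..r}.
      of_int (sign w) * ?\<phi> (wscale (of_nat p) \<mu> + weyl_act w (weyl_vector r)))"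
    by (simp only: lin_sum lin_single)
  also have "\<dots> = (\<Sum>\<mu>\<in>Pi_weights r n. \<Sum>w | w permutes {1..r}. (-1) ^ coxeter_length r w
      * ?\<phi> (wscale (of_nat p) \<mu> + weyl_act w (weyl_vector r)))"
    by (intro sum.cong refl) (simp add: minus_one_power_coxeter_length)
  finally have lhs: "lin ?\<phi> (adams p (sym_power_char r n) * weyl_product r) = \<dots>" .
  have "lin ?\<phi> (adams p (sym_power_char r n) * weyl_product r) = lin ?\<phi> (lin (\<lambda>\<nu>. alt r (\<nu> + weyl_vector r)) m)"
    unfolding m(2) lin_irrep_char_times_dn[OF r0 m(1)] ..
  also have "\<dots> = (\<Sum>\<nu>\<in>Poly_Mapping.keys m. of_int (lk m \<nu>) * lin ?\<phi> (alt r (\<nu> + weyl_vector r)))"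
    by (simp only: lin_def[of "\<lambda>\<nu>. alt r (\<nu> + weyl_vector r)"] lin_sum lin_of_int_mult)
  also have "\<dots> = (\<Sum>\<nu>\<in>Poly_Mapping.keys m. qpow (a * wnormsq r (weyl_vector r)) * qdim r (weyl_denominator r)
      * (of_int (lk m \<nu>) * qdim r (irrep_char r \<nu>) * twist_pow r \<nu> (of_nat p' / of_nat p)))"
  proof (rule sum.cong[OF refl])
    fix \<nu> assume "\<nu> \<in> Poly_Mapping.keys m"
    then have "\<nu> \<in> dominant_weights r" using m(1) by blast
    then have "irrep_char r \<nu> * weyl_product r = alt r (\<nu> + weyl_vector r)" by (rule irrep_char_times_denominator[OF r0])
    then have "qdim r (alt r (\<nu> + weyl_vector r)) = qdim r (irrep_char r \<nu>) * qdim r (weyl_denominator r)"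
      by (metis qdim_mult dn_eq_alt weyl_denominator_eq_alt)
    moreover have "qpow (a * wnormsq r (\<nu> + weyl_vector r)) = twist_pow r \<nu> (of_nat p' / of_nat p) * qpow (a * wnormsq r (weyl_vector r))"
      unfolding twist_pow_def wnormsq_add_weyl_vector qpow_add[symmetric] by (simp add: a_def algebra_simps)
    ultimately show "of_int (lk m \<nu>) * lin ?\<phi> (alt r (\<nu> + weyl_vector r)) = qpow (a * wnormsq r (weyl_vector r)) * qdim r (weyl_denominator r)
      * (of_int (lk m \<nu>) * qdim r (irrep_char r \<nu>) * twist_pow r \<nu> (of_nat p' / of_nat p))"
      unfolding lin_alt_gauss by (simp only: mult_ac)
  qed
  also have "\<dots> = qpow (a * wnormsq r (weyl_vector r)) * qdim r (weyl_denominator r)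
        * torus_knot_invariant r p p' (wscale (of_nat n) (fund_weight r 1))"
    unfolding torus_knot_invariant_def m_def[symmetric] sum_distrib_left ..
  finally show ?thesis unfolding lhs .
qed

theorem theorem5p1:
  fixes r n p p' :: nat
  assumes "r \<ge> 2" and "p > 0" and "p' > 0" and "coprime p p'"
  shows "to_fract (torus_knot_invariant r p p' (wscale (of_nat n) (fund_weight r 1))) =
    to_fract (qpow (- (of_nat p' / (2 * of_nat p)) * wnormsq r (weyl_vector r)))
      / to_fract (qdim r (weyl_denominator r))
    * to_fract (\<Sum>\<mu> \<in> Pi_weights r n. \<Sum>w | w permutes {1..r}.
        (-1) ^ coxeter_length r w
          * qpow (of_nat p' / (2 * of_nat p)
                    * wnormsq r (wscale (of_nat p) \<mu> + weyl_act w (weyl_vector r))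
                  + wform r (wscale (of_nat p) \<mu> + weyl_act w (weyl_vector r)) (weyl_vector r)))"
proof -
  let ?x = "of_nat p' / (2 * of_nat p) * wnormsq r (weyl_vector r)"
  have "qpow (- ?x) * qpow ?x = 1" by (simp only: qpow_add[symmetric] left_minus) (simp add: qpow_def)
  from arg_cong[OF this, of to_fract]
  have one: "to_fract (qpow (- ?x)) * to_fract (qpow ?x) = 1" by simp
  have ne: "to_fract (qdim r (weyl_denominator r)) \<noteq> 0"
    unfolding to_fract_eq_0_iff weyl_denominator_eq_alt dn_eq_alt[symmetric] by (rule qdim_dn_nonzero)
  have cancel: "j = x / d * (y * d * j)" if "d \<noteq> 0" "x * y = 1" for x y d j :: "qlaurent fract"
  proof -
    have "x / d * (y * d * j) = (x * y) * j * (d / d)" by (simp add: mult_ac)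
    then show ?thesis using that by simp
  qed
  show ?thesis
    unfolding gauss_sum_eq_invariant[OF assms(1)] to_fract_mult mult_minus_left
    by (rule cancel[OF ne one])
qed

end
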